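(* Let $m_n\to\infty$ be positive integers and let $w_n:\mathcal{Z}\to\mathbb{R}^{m_n}$ be measurable functions with $\int w_n\,dQ=0$ and $\int|w_n|^2\,dQ<\infty$. Suppose that the sequence of matrices $W_n=\int w_nw_n^{\top}\,dQ$ is regular and that $\int|w_n|^4\,dQ=O(m_n^2)$. If $m_n^4=o(n)$, then $$\frac{-2\log\mathscr{R}_n-m_n}{\sqrt{2m_n}}\Longrightarrow N(0,1)\qquad\text{as } n\to\infty.$$
   Context: $(\mathcal{Z},\mathscr{S})$ is a measurable space; $Z_1,\dots,Z_n$ are independent copies of a $\mathcal{Z}$-valued random variable $Z$ with distribution $Q$ (the same for all $n$). $|\cdot|$ is the Euclidean norm and $\Longrightarrow$ denotes convergence in distribution. A sequence $W_n$ of $m_n\times m_n$ dispersion (covariance) matrices is called regular if $0<\inf_n\inf_{|u|=1}u^{\top}W_nu\le\sup_n\sup_{|u|=1}u^{\top}W_nu<\infty$. With $\mathscr{P}_n=\{\pi\in[0,1]^n:\pi_1+\dots+\pi_n=1\}$, the empirical likelihood is $$\mathscr{R}_n=\sup\Big\{\prod_{j=1}^n n\pi_j:\ \pi\in\mathscr{P}_n,\ \sum_{j=1}^n\pi_jw_n(Z_j)=0\Big\},$$ with the supremum taken in $[0,\infty)$, so that $\sup\emptyset=0$ and $-2\log 0=+\infty$. *)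

theory Defs
  imports "HOL-Probability.Probability" "HOL-Library.Landau_Symbols"
begin

text \<open>A vector in the Euclidean space of dimension \<open>m\<close> is a function \<open>nat \<Rightarrow> real\<close> of
  which only the coordinates in \<open>{..<m}\<close> are used; its Euclidean norm is \<open>L2_set v {..<m}\<close>.
  Matrices are treated likewise. Sample sizes and observation indices start at 1.\<close>

definition quad_form :: "nat \<Rightarrow> (nat \<Rightarrow> nat \<Rightarrow> real) \<Rightarrow> (nat \<Rightarrow> real) \<Rightarrow> real" where
  "quad_form m W u = (\<Sum>i<m. \<Sum>k<m. u i * W i k * u k)"

text \<open>Infima and suprema are taken in the extended reals, so no boundedness is built in.\<close>

definition regular_dispersion :: "(nat \<Rightarrow> nat) \<Rightarrow> (nat \<Rightarrow> nat \<Rightarrow> nat \<Rightarrow> real) \<Rightarrow> bool" where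
  "regular_dispersion m W \<longleftrightarrow>
     0 < (INF n\<in>{1..}. INF u\<in>{u. L2_set u {..<m n} = 1}. ereal (quad_form (m n) (W n) u)) \<and>
     (SUP n\<in>{1..}. SUP u\<in>{u. L2_set u {..<m n} = 1}. ereal (quad_form (m n) (W n) u)) < \<infinity>"

definition prob_vectors :: "nat \<Rightarrow> (nat \<Rightarrow> real) set" where
  "prob_vectors n = {\<pi> \<in> {1..n} \<rightarrow>\<^sub>E {0..1}. (\<Sum>j=1..n. \<pi> j) = 1}"

text \<open>Empirical likelihood of the vectors \<open>a 1, \<dots>, a n\<close> of dimension \<open>m\<close>. The supremum is
  taken in \<open>ennreal\<close>, where the supremum of the empty set is 0; it never exceeds 1, by the
  inequality of arithmetic and geometric means.\<close>

definition emp_lik :: "nat \<Rightarrow> nat \<Rightarrow> (nat \<Rightarrow> nat \<Rightarrow> real) \<Rightarrow> ennreal" where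
  "emp_lik n m a =
     (SUP \<pi>\<in>{\<pi> \<in> prob_vectors n. \<forall>i<m. (\<Sum>j=1..n. \<pi> j * a j i) = 0}.
        ennreal (\<Prod>j=1..n. real n * \<pi> j))"

text \<open>The value at \<open>\<top>\<close> is irrelevant, since \<open>emp_lik\<close> is finite.\<close>

definition neg2_log :: "ennreal \<Rightarrow> ereal" where
  "neg2_log r = (if r = 0 then \<infinity> else ereal (- 2 * ln (enn2real r)))"

text \<open>Convergence in distribution of extended real random variables to a law on the real
  line, by convergence of distribution functions; \<open>weak_conv_m\<close> only covers sequences of
  laws on the real line. As the limit is a real probability law, all mass of \<open>X n\<close> at infinite
  values has to vanish in the limit.\<close>

definition conv_in_distribution ::
  "'a measure \<Rightarrow> (nat \<Rightarrow> 'a \<Rightarrow> ereal) \<Rightarrow> real measure \<Rightarrow> bool" where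
  "conv_in_distribution M X L \<longleftrightarrow>
     (\<forall>n. X n \<in> borel_measurable M) \<and>
     weak_conv (\<lambda>n x. measure M {\<omega> \<in> space M. X n \<omega> \<le> ereal x}) (cdf L)"

end

theory Submission
  imports Defs
begin

text \<open>Whitening the constraint functions does not change the empirical likelihood, so they may be
  taken orthonormal in \<open>L\<^sup>2(Q)\<close>. The statistic is then sandwiched between the logarithms of
  an explicit dual bound and of explicit feasible weights, both of which differ from
  \<open>|v\<^sub>1 + \<dots> + v\<^sub>n|\<^sup>2 / n\<close>, for \<open>v\<^sub>j\<close> the value of the whitened functions at the
  \<open>j\<close>-th observation, by terms of order \<open>m\<^sup>2 / \<surd>n\<close> relative to \<open>\<surd>m\<close>; no
  optimal multiplier is needed. The characteristic function of this squared norm is computed by a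
  Lindeberg argument, exchanging the \<open>v\<^sub>j\<close> one at a time for Gaussian vectors. The Gaussian
  vectors never appear, because the averages over them are replaced by an explicit approximate
  solution of the backward heat equation which has exactly the right values at both ends.\<close>

section \<open>Whitening\<close>

text \<open>With \<open>m\<close> growing, no fixed-dimensional central limit theorem applies:
  normality comes from summing many squared coordinates, so every estimate has to be explicit in
  \<open>m\<close>. Only the fourth moment of the norm is available. Third powers are therefore
  always split, by Cauchy-Schwarz or weighted AM-GM, into second and fourth powers, and the largest
  observation is bounded through the sum of fourth powers, which makes \<open>max |v j|^2\<close> at
  most of order \<open>m * sqrt n\<close>. Times the squared sample mean, of order
  \<open>m / n\<close>, this is \<open>m^2 / sqrt n\<close>: the growth condition is also what keeps
  the explicit weights positive. The approximate heat solution comes from the exact Gaussian average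
  of \<open>exp (\<i> \<theta> |y|^2)\<close>, namely \<open>(1 - 2 \<i> \<theta> s)^(-m/2) * exp
  (\<i> \<theta> x / (1 - 2 \<i> \<theta> s))\<close>. Expanding its exponent to second order in
  \<theta> gives \<open>swap_char\<close>. The exponent stays affine in \<open>x\<close>, so
  elementary Taylor bounds for the exponential suffice, and the truncation costs in total order
  \<open>|\<theta>|^3 m\<close>, which vanishes for \<theta> of order
  \<open>m^(-1/2)\<close>.\<close>

definition ip :: "nat \<Rightarrow> (nat \<Rightarrow> real) \<Rightarrow> (nat \<Rightarrow> real) \<Rightarrow> real" where
  "ip m x y = (\<Sum>i<m. x i * y i)"

text \<open>In matrix terms, \<open>A W A\<^sup>T\<close> is the identity and \<open>A\<close> is
  injective. Both uses, solving linear systems and invariance of the constraints, pass from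
  \<open>A y = 0\<close> to \<open>y = 0\<close>, so injectivity is carried along in the
  construction.\<close>

definition whitens :: "nat \<Rightarrow> (nat \<Rightarrow> nat \<Rightarrow> real) \<Rightarrow> (nat \<Rightarrow> nat \<Rightarrow> real) \<Rightarrow> bool" where
  "whitens m W A \<longleftrightarrow>
     (\<forall>i<m. \<forall>k<m. (\<Sum>p<m. \<Sum>q<m. A i p * W p q * A k q) = (if i = k then 1 else 0)) \<and>
     (\<forall>y. (\<forall>i<m. ip m (A i) y = 0) \<longrightarrow> (\<forall>i<m. y i = 0))"

text \<open>The solution is \<open>x = A\<^sup>T A b\<close>: then
  \<open>A (W x - b) = (A W A\<^sup>T) A b - A b = 0\<close>, and injectivity of \<open>A\<close>
  gives \<open>W x = b\<close>.\<close>

lemma whitens_solve: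
  assumes A: "whitens m W A"
  obtains x where "\<And>i. i < m \<Longrightarrow> (\<Sum>k<m. W i k * x k) = b i"
proof -
  define g where "g l = ip m (A l) b" for l
  define x where "x k = (\<Sum>l<m. A l k * g l)" for k
  define e where "e p = (\<Sum>q<m. W p q * x q) - b p" for p
  have "ip m (A i) e = 0" if "i < m" for i
  proof -
    have "ip m (A i) e = (\<Sum>p<m. \<Sum>q<m. \<Sum>l<m. A i p * W p q * A l q * g l) - g i"
      by (simp add: ip_def e_def x_def g_def right_diff_distrib sum_subtractf sum_distrib_left
          algebra_simps)
    also have "(\<Sum>p<m. \<Sum>q<m. \<Sum>l<m. A i p * W p q * A l q * g l)
        = (\<Sum>p<m. \<Sum>l<m. \<Sum>q<m. A i p * W p q * A l q * g l)"
      by (intro sum.cong refl sum.swap)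
    also have "\<dots> = (\<Sum>l<m. \<Sum>p<m. \<Sum>q<m. A i p * W p q * A l q * g l)"
      by (rule sum.swap)
    also have "\<dots> = (\<Sum>l<m. (if i = l then 1 else 0) * g l)"
      using A that by (intro sum.cong refl) (simp add: whitens_def flip: sum_distrib_right)
    also have "\<dots> = g i"
      using that by (simp add: if_distrib[of "\<lambda>x. x * _"] cong: if_cong)
    finally show ?thesis by simp
  qed
  with A have "\<forall>i<m. e i = 0" by (auto simp: whitens_def)
  then show ?thesis by (intro that[of x]) (auto simp: e_def)
qed

lemma quad_form_Suc:
  assumes "\<And>i. i < m \<Longrightarrow> W m i = W i m"
  shows "quad_form (Suc m) W u
    = quad_form m W u + 2 * u m * (\<Sum>i<m. W i m * u i) + W m m * (u m)\<^sup>2"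
proof -
  have "(\<Sum>k<m. u m * W m k * u k) = (\<Sum>i<m. u i * W i m * u m)"
    using assms by (intro sum.cong) auto
  then show ?thesis
    by (simp add: quad_form_def sum.distrib power2_eq_square sum_distrib_left algebra_simps)
qed

text \<open>Gram-Schmidt with respect to the form \<open>W\<close>, adding one coordinate at a time.
  The new row is a multiple of \<open>d = (-c, 1)\<close>, where \<open>c\<close> solves the old
  system with the new column on the right, so that \<open>d\<close> is \<open>W\<close>-orthogonal
  to all old coordinate vectors. The resulting \<open>A\<close> is lower triangular.\<close>

lemma whitens_exists:
  assumes "\<And>i k. i < m \<Longrightarrow> k < m \<Longrightarrow> W i k = W k i"
    and "\<And>u. \<exists>i<m. u i \<noteq> 0 \<Longrightarrow> quad_form m W u > 0"
  shows "\<exists>A. whitens m W A"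
  using assms
proof (induction m)
  case 0
  then show ?case by (simp add: whitens_def)
next
  case (Suc m)
  have sym: "W i k = W k i" if "i \<le> m" "k \<le> m" for i k
    using Suc.prems(1)[of i k] that by auto
  have "quad_form m W u > 0" if u: "\<exists>i<m. u i \<noteq> 0" for u
  proof -
    obtain i where i: "i < m" "u i \<noteq> 0" using u by auto
    have "quad_form (Suc m) W (u(m := 0)) > 0"
      using i by (intro Suc.prems exI[of _ i]) auto
    also have "quad_form (Suc m) W (u(m := 0)) = quad_form m W (u(m := 0))"
      using sym by (subst quad_form_Suc) auto
    also have "\<dots> = quad_form m W u" by (simp add: quad_form_def)
    finally show ?thesis .
  qed
  with sym have "\<exists>A. whitens m W A"
    by (intro Suc.IH) simp_all
  then obtain A where A: "whitens m W A" ..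
  obtain c where c: "\<And>i. i < m \<Longrightarrow> (\<Sum>k<m. W i k * c k) = W i m"
    using whitens_solve[OF A, where b = "\<lambda>i. W i m"] by blast
  \<comment> \<open>The Schur complement of the old block; it equals the value of the form at
    \<open>d\<close> and is therefore positive.\<close>
  define r where "r = W m m - (\<Sum>k<m. W m k * c k)"
  define d where "d p = (if p < m then - c p else 1)" for p
  have Wd: "(\<Sum>q<Suc m. W p q * d q) = (if p < m then 0 else r)" if "p \<le> m" for p
    using c[of p] that by (auto simp: d_def r_def sum_negf)
  have qd: "quad_form (Suc m) W d = r"
  proof -
    have "quad_form (Suc m) W d = (\<Sum>i<Suc m. d i * (\<Sum>k<Suc m. W i k * d k))"
      by (simp only: quad_form_def sum_distrib_left mult.assoc)
    also have "\<dots> = (\<Sum>i<Suc m. d i * (if i < m then 0 else r))"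
      by (intro sum.cong refl arg_cong2[where f = "(*)"] Wd) auto
    also have "\<dots> = r" by (simp add: d_def)
    finally show ?thesis .
  qed
  have "r > 0"
    unfolding qd[symmetric] by (rule Suc.prems) (auto simp: d_def intro!: exI[of _ m])
  define A' where "A' i p = (if i < m then (if p < m then A i p else 0) else d p / sqrt r)" for i p
  have old: "(\<Sum>p<Suc m. \<Sum>q<Suc m. A' i p * W p q * A' k q) = (if i = k then 1 else 0)"
    if "i < m" "k < m" for i k
    using A that by (simp add: A'_def whitens_def)
  have new: "(\<Sum>p<Suc m. \<Sum>q<Suc m. A' i p * W p q * A' m q) = (if i = m then 1 else 0)"
    if "i \<le> m" for i
  proof -
    have "(\<Sum>p<Suc m. \<Sum>q<Suc m. A' i p * W p q * A' m q)
        = (\<Sum>p<Suc m. A' i p / sqrt r * (\<Sum>q<Suc m. W p q * d q))"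
      unfolding sum_distrib_left by (intro sum.cong refl) (simp add: A'_def)
    also have "\<dots> = (\<Sum>p<Suc m. A' i p / sqrt r * (if p < m then 0 else r))"
      by (intro sum.cong refl arg_cong2[where f = "(*)"] Wd) auto
    also have "\<dots> = A' i m * sqrt r"
      using \<open>r > 0\<close> by (simp add: real_div_sqrt field_simps)
    finally show ?thesis
      using that \<open>r > 0\<close> by (auto simp: A'_def d_def)
  qed
  have swap: "(\<Sum>p<Suc m. \<Sum>q<Suc m. A' i p * W p q * A' k q)
      = (\<Sum>p<Suc m. \<Sum>q<Suc m. A' k p * W p q * A' i q)" for i k
    by (subst sum.swap) (auto intro!: sum.cong simp: sym mult_ac)
  have "(\<Sum>p<Suc m. \<Sum>q<Suc m. A' i p * W p q * A' k q) = (if i = k then 1 else 0)"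
    if "i < Suc m" "k < Suc m" for i k
  proof (cases "k = m")
    case True
    then show ?thesis using new[of i] that by auto
  next
    case k: False
    show ?thesis
    proof (cases "i = m")
      case True
      then show ?thesis using new[of k] swap[of i k] that by auto
    next
      case False
      then show ?thesis using old[of i k] k that by auto
    qed
  qed
  moreover have "\<forall>i<Suc m. y i = 0" if y: "\<forall>i<Suc m. ip (Suc m) (A' i) y = 0" for y
  proof -
    have "ip m (A i) y = 0" if "i < m" for i
      using y[rule_format, of i] that by (simp add: ip_def A'_def)
    with A have *: "\<forall>i<m. y i = 0" by (auto simp: whitens_def)
    moreover have "y m = 0"
      using y[rule_format, of m] * \<open>r > 0\<close> by (simp add: ip_def A'_def d_def)
    ultimately show ?thesis by (auto simp: less_Suc_eq)
  qed
  ultimately show ?case unfolding whitens_def by blast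
qed

lemma ip_cauchy_schwarz: "(ip m x y)\<^sup>2 \<le> ip m x x * ip m y y"
  using Cauchy_Schwarz_ineq_sum[of x y "{..<m}"] by (simp add: ip_def power2_eq_square)

lemma ip_nonneg [simp]: "0 \<le> ip m x x"
  by (simp add: ip_def sum_nonneg)

lemma sum_swap_pairs:
  "(\<Sum>p\<in>A. \<Sum>q\<in>B. \<Sum>i\<in>C. \<Sum>k\<in>D. F p q i k) = (\<Sum>i\<in>C. \<Sum>k\<in>D. \<Sum>p\<in>A. \<Sum>q\<in>B. F p q i k)"
  using sum.swap[of "\<lambda>(p, q) (i, k). F p q i k" "C \<times> D" "A \<times> B"]
  by (simp add: sum.cartesian_product')

text \<open>For \<open>y = A x\<close> and \<open>u = A\<^sup>T y\<close>, whitening gives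
  \<open>quad_form m W u = |y|^2\<close>, hence \<open>c |u|^2 \<le> |y|^2\<close>. Since also
  \<open>|y|^2\<close> is the inner product of \<open>u\<close> and \<open>x\<close>, Cauchy-Schwarz
  bounds \<open>|y|^4\<close> by \<open>|y|^2 |x|^2 / c\<close>.\<close>

lemma whitens_norm_le:
  assumes A: "whitens m W A" and "0 < c"
    and W: "\<And>u. c * ip m u u \<le> quad_form m W u"
  shows "ip m (\<lambda>i. ip m (A i) x) (\<lambda>i. ip m (A i) x) \<le> ip m x x / c"
proof -
  define y where "y i = ip m (A i) x" for i
  define u where "u p = (\<Sum>i<m. y i * A i p)" for p
  have yu: "ip m y y = ip m u x"
  proof -
    have "ip m y y = (\<Sum>i<m. \<Sum>p<m. y i * A i p * x p)"
      unfolding ip_def by (subst (2) y_def) (simp add: ip_def sum_distrib_left mult.assoc)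
    also have "\<dots> = (\<Sum>p<m. \<Sum>i<m. y i * A i p * x p)" by (rule sum.swap)
    finally show ?thesis by (simp add: ip_def u_def sum_distrib_right)
  qed
  have "quad_form m W u = (\<Sum>p<m. \<Sum>q<m. (\<Sum>i<m. y i * A i p) * (\<Sum>k<m. y k * A k q) * W p q)"
    unfolding quad_form_def u_def by (simp only: mult_ac)
  also have "\<dots> = (\<Sum>p<m. \<Sum>q<m. \<Sum>i<m. \<Sum>k<m. y i * A i p * (y k * A k q) * W p q)"
    by (subst sum_product) (simp only: sum_distrib_right)
  also have "\<dots> = (\<Sum>i<m. \<Sum>k<m. \<Sum>p<m. \<Sum>q<m. y i * A i p * (y k * A k q) * W p q)"
    by (rule sum_swap_pairs)
  also have "\<dots> = (\<Sum>i<m. \<Sum>k<m. y i * y k * (\<Sum>p<m. \<Sum>q<m. A i p * W p q * A k q))"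
    by (simp add: sum_distrib_left mult_ac)
  also have "\<dots> = (\<Sum>i<m. \<Sum>k<m. y i * y k * (if i = k then 1 else 0))"
    using A by (intro sum.cong refl) (simp add: whitens_def)
  also have "\<dots> = ip m y y" by (simp add: ip_def if_distrib cong: if_cong)
  finally have "c * ip m u u \<le> ip m y y" using W[of u] by simp
  have "(ip m y y)\<^sup>2 \<le> ip m u u * ip m x x"
    unfolding yu by (rule ip_cauchy_schwarz)
  also have "\<dots> \<le> ip m y y / c * ip m x x"
    using \<open>c * ip m u u \<le> ip m y y\<close> \<open>0 < c\<close> by (intro mult_right_mono) (auto simp: field_simps)
  finally have "ip m y y * ip m y y \<le> ip m y y * (ip m x x / c)"
    by (simp add: power2_eq_square)
  moreover have "0 \<le> ip m x x / c" using \<open>0 < c\<close> by simp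
  ultimately have "ip m y y \<le> ip m x x / c"
    using ip_nonneg[of m y] by (metis mult_left_le_imp_le less_eq_real_def)
  then show ?thesis by (simp add: y_def[abs_def])
qed

section \<open>Quadratic approximation of the empirical likelihood statistic\<close>

lemma ln_one_plus_ge_cubic:
  fixes t :: real
  assumes "\<bar>t\<bar> \<le> 1/2"
  shows "t - t\<^sup>2 / 2 - \<bar>t\<bar> ^ 3 \<le> ln (1 + t)"
proof (cases "0 \<le> t")
  case True
  have "ln (1 + 0) - 0 + 0\<^sup>2 / 2 \<le> ln (1 + t) - t + t\<^sup>2 / 2"
  proof (rule DERIV_nonneg_imp_nondecreasing[OF True])
    fix x :: real assume x: "0 \<le> x" "x \<le> t"
    have "((\<lambda>x. ln (1 + x) - x + x\<^sup>2 / 2) has_real_derivative x\<^sup>2 / (1 + x)) (at x)"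
      using x by (auto intro!: derivative_eq_intros simp: field_simps power2_eq_square)
    then show "\<exists>y. ((\<lambda>x. ln (1 + x) - x + x\<^sup>2 / 2) has_real_derivative y) (at x) \<and> 0 \<le> y"
      using x by (intro exI[of _ "x\<^sup>2 / (1 + x)"]) auto
  qed
  then have "t - t\<^sup>2 / 2 \<le> ln (1 + t)" by simp
  moreover have "0 \<le> \<bar>t\<bar> ^ 3" by simp
  ultimately show ?thesis by linarith
next
  case False
  then have t: "t \<le> 0" "- (1/2) \<le> t" using assms by auto
  \<comment> \<open>For positive \<open>t\<close> the quadratic bound already suffices; here the
    cubic term makes the derivative nonpositive, because \<open>1 + x\<close> is at least
    1/2.\<close>
  have "ln (1 + t) - t + t\<^sup>2 / 2 - t ^ 3 \<ge> ln (1 + 0) - 0 + 0\<^sup>2 / 2 - 0 ^ 3"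
  proof (rule DERIV_nonpos_imp_nonincreasing[OF t(1)])
    fix x :: real assume x: "t \<le> x" "x \<le> 0"
    with t have "1/2 \<le> 1 + x" by auto
    have "((\<lambda>x. ln (1 + x) - x + x\<^sup>2 / 2 - x ^ 3) has_real_derivative x\<^sup>2 / (1 + x) - 3 * x\<^sup>2) (at x)"
      using \<open>1/2 \<le> 1 + x\<close> by (auto intro!: derivative_eq_intros simp: field_simps power2_eq_square)
    moreover have "x\<^sup>2 * 1 \<le> x\<^sup>2 * (3 * (1 + x))"
      using \<open>1/2 \<le> 1 + x\<close> by (intro mult_left_mono) auto
    then have "x\<^sup>2 / (1 + x) - 3 * x\<^sup>2 \<le> 0"
      using \<open>1/2 \<le> 1 + x\<close> by (simp add: divide_le_eq algebra_simps)
    ultimately show "\<exists>y. ((\<lambda>x. ln (1 + x) - x + x\<^sup>2 / 2 - x ^ 3) has_real_derivative y) (at x) \<and> y \<le> 0"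
      by blast
  qed
  moreover have "\<bar>t\<bar> ^ 3 = - (t ^ 3)" using t by (simp add: abs_if power_minus_odd)
  ultimately show ?thesis by simp
qed

text \<open>The sum of cubes is split by Cauchy-Schwarz as \<open>|t| * t^2\<close>, since only sums
  of second and fourth powers will be controlled.\<close>

lemma sum_ln_one_plus_ge_cubic:
  fixes t :: "'i \<Rightarrow> real"
  assumes "finite J" and t: "\<And>j. j \<in> J \<Longrightarrow> (t j)\<^sup>2 \<le> 1/4"
  shows "(\<Sum>j\<in>J. t j) - (\<Sum>j\<in>J. (t j)\<^sup>2) / 2 - sqrt ((\<Sum>j\<in>J. (t j)\<^sup>2) * (\<Sum>j\<in>J. (t j) ^ 4))
    \<le> (\<Sum>j\<in>J. ln (1 + t j))"
proof -
  have half: "\<bar>t j\<bar> \<le> 1/2" if "j \<in> J" for j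
    using power2_le_imp_le[of "\<bar>t j\<bar>" "1/2"] t[OF that] by (simp add: power2_eq_square)
  have "(\<Sum>j\<in>J. \<bar>t j\<bar> * (t j)\<^sup>2)\<^sup>2 \<le> (\<Sum>j\<in>J. \<bar>t j\<bar>\<^sup>2) * (\<Sum>j\<in>J. ((t j)\<^sup>2)\<^sup>2)"
    by (rule Cauchy_Schwarz_ineq_sum)
  then have "(\<Sum>j\<in>J. \<bar>t j\<bar> ^ 3) \<le> sqrt ((\<Sum>j\<in>J. (t j)\<^sup>2) * (\<Sum>j\<in>J. (t j) ^ 4))"
    by (intro real_le_rsqrt) (simp add: eval_nat_numeral mult_ac)
  moreover have "(\<Sum>j\<in>J. t j - (t j)\<^sup>2 / 2 - \<bar>t j\<bar> ^ 3) \<le> (\<Sum>j\<in>J. ln (1 + t j))"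
    by (intro sum_mono ln_one_plus_ge_cubic half)
  ultimately show ?thesis
    by (simp add: sum_subtractf sum_divide_distrib)
qed

text \<open>The multiplier \<open>l\<close> is a dual certificate: since \<open>y \<le> exp (y - 1)\<close>, the product of the
  \<open>n * \<pi> j * (1 + ip m l (a j))\<close>, whose sum is \<open>n\<close>, is at most 1.\<close>

lemma emp_lik_le:
  assumes pos: "\<And>j. j \<in> {1..n} \<Longrightarrow> 0 < 1 + ip m l (a j)"
  shows "emp_lik n m a \<le> ennreal (exp (- (\<Sum>j=1..n. ln (1 + ip m l (a j)))))"
  unfolding emp_lik_def
proof (rule SUP_least)
  fix \<pi> assume "\<pi> \<in> {\<pi> \<in> prob_vectors n. \<forall>i<m. (\<Sum>j = 1..n. \<pi> j * a j i) = 0}"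
  then have \<pi>: "\<And>j. j \<in> {1..n} \<Longrightarrow> 0 \<le> \<pi> j" "(\<Sum>j=1..n. \<pi> j) = 1"
    and zero: "\<And>i. i < m \<Longrightarrow> (\<Sum>j = 1..n. \<pi> j * a j i) = 0"
    by (auto simp: prob_vectors_def PiE_iff)
  define y where "y j = real n * \<pi> j * (1 + ip m l (a j))" for j
  have "(\<Sum>j=1..n. \<pi> j * ip m l (a j)) = (\<Sum>j=1..n. \<Sum>i<m. l i * (\<pi> j * a j i))"
    by (simp add: ip_def sum_distrib_left mult_ac)
  also have "\<dots> = (\<Sum>i<m. l i * (\<Sum>j=1..n. \<pi> j * a j i))"
    by (subst sum.swap) (simp add: sum_distrib_left)
  also have "\<dots> = 0" by (intro sum.neutral ballI) (simp only: zero lessThan_iff mult_zero_right)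
  finally have "(\<Sum>j=1..n. y j) = n"
    using \<pi>(2) by (simp add: y_def algebra_simps sum.distrib flip: sum_distrib_left)
  have "(\<Prod>j=1..n. y j) \<le> (\<Prod>j=1..n. exp (y j - 1))"
  proof (rule prod_mono)
    fix j assume "j \<in> {1..n}"
    then show "0 \<le> y j \<and> y j \<le> exp (y j - 1)"
      using \<pi>(1)[of j] pos[of j] exp_ge_add_one_self[of "y j - 1"] by (auto simp: y_def)
  qed
  also have "\<dots> = 1"
    using \<open>(\<Sum>j=1..n. y j) = n\<close> by (simp add: sum_subtractf flip: exp_sum)
  finally have "(\<Prod>j=1..n. real n * \<pi> j) * (\<Prod>j=1..n. 1 + ip m l (a j)) \<le> 1"
    by (simp add: y_def flip: prod.distrib)
  moreover have "exp (\<Sum>j=1..n. ln (1 + ip m l (a j))) = (\<Prod>j=1..n. 1 + ip m l (a j))"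
    using pos by (simp add: exp_sum)
  ultimately have "(\<Prod>j=1..n. real n * \<pi> j) * exp (\<Sum>j=1..n. ln (1 + ip m l (a j))) \<le> 1"
    by simp
  then show "ennreal (\<Prod>j = 1..n. real n * \<pi> j)
      \<le> ennreal (exp (- (\<Sum>j = 1..n. ln (1 + ip m l (a j)))))"
    by (intro ennreal_leI) (simp add: exp_minus field_simps)
qed

text \<open>The primal counterpart of the dual bound: one admissible weight vector bounds the
  supremum from below. That no weight exceeds 1 comes from nonnegativity and total mass 1.\<close>

lemma emp_lik_ge:
  assumes n: "n \<ge> 1"
    and y: "\<And>j. j \<in> {1..n} \<Longrightarrow> y j < 1" "(\<Sum>j=1..n. y j) = 0"
    and feasible: "\<And>i. i < m \<Longrightarrow> (\<Sum>j=1..n. (1 - y j) * a j i) = 0"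
  shows "ennreal (exp (\<Sum>j=1..n. ln (1 - y j))) \<le> emp_lik n m a"
proof -
  define \<pi> where "\<pi> = (\<lambda>j\<in>{1..n}. (1 - y j) / n)"
  have sum1: "(\<Sum>j=1..n. \<pi> j) = 1"
    using y n by (simp add: \<pi>_def sum_subtractf flip: sum_divide_distrib)
  have nonneg: "0 \<le> \<pi> j" if "j \<in> {1..n}" for j
    using y(1)[OF that] that by (simp add: \<pi>_def)
  have "\<pi> j \<le> 1" if "j \<in> {1..n}" for j
    unfolding sum1[symmetric] by (intro member_le_sum that) (auto intro: nonneg)
  with sum1 nonneg have "\<pi> \<in> prob_vectors n"
    by (auto simp: prob_vectors_def \<pi>_def)
  moreover have "(\<Sum>j=1..n. \<pi> j * a j i) = 0" if "i < m" for i
    using feasible[OF that] n by (simp add: \<pi>_def flip: sum_divide_distrib)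
  moreover have "exp (\<Sum>j=1..n. ln (1 - y j)) = (\<Prod>j=1..n. n * \<pi> j)"
    using y(1) n by (simp add: exp_sum \<pi>_def)
  ultimately show ?thesis
    unfolding emp_lik_def by (auto intro!: SUP_upper2[of \<pi>])
qed

text \<open>The positive lower bound on \<open>r\<close> excludes the infinite value, so that the
  statistic becomes a real number that can be compared with the quadratic form.\<close>

lemma neg2_log_bounds:
  assumes "ennreal (exp (- u)) \<le> r" "r \<le> ennreal (exp (- l))"
  obtains x where "neg2_log r = ereal x" "2 * l \<le> x" "x \<le> 2 * u"
proof -
  obtain s where s: "r = ennreal s" "0 \<le> s"
    using assms(2) by (cases r) (auto simp: top_unique)
  then have "exp (- u) \<le> s" "s \<le> exp (- l)" using assms by auto
  then have "0 < s" by (meson exp_gt_zero less_le_trans)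
  have "- u \<le> ln s" using \<open>exp (- u) \<le> s\<close> \<open>0 < s\<close> by (simp add: ln_ge_iff)
  moreover have "ln s \<le> - l"
    using \<open>s \<le> exp (- l)\<close> \<open>0 < s\<close> ln_le_cancel_iff[of s "exp (- l)"] by simp
  ultimately show ?thesis
    using s \<open>0 < s\<close> by (intro that[of "- 2 * ln s"]) (auto simp: neg2_log_def)
qed

text \<open>The operator norm is at most the Frobenius norm, by Cauchy-Schwarz over pairs of
  indices. The Frobenius norm is the convenient one because its expected square can be computed
  entry by entry.\<close>

lemma abs_bilinear_le:
  assumes "0 \<le> e" "(\<Sum>i<m. \<Sum>k<m. (E i k)\<^sup>2) \<le> e\<^sup>2"
  shows "\<bar>\<Sum>i<m. \<Sum>k<m. u i * E i k * w k\<bar> \<le> e * (sqrt (ip m u u) * sqrt (ip m w w))"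
proof -
  have "(\<Sum>i<m. \<Sum>k<m. u i * E i k * w k)\<^sup>2
      = (\<Sum>(i, k)\<in>{..<m} \<times> {..<m}. E i k * (u i * w k))\<^sup>2"
    by (simp add: sum.cartesian_product mult_ac)
  also have "\<dots> \<le> (\<Sum>(i, k)\<in>{..<m} \<times> {..<m}. (E i k)\<^sup>2) * (\<Sum>(i, k)\<in>{..<m} \<times> {..<m}. (u i * w k)\<^sup>2)"
    using Cauchy_Schwarz_ineq_sum[of "\<lambda>(i, k). E i k" "\<lambda>(i, k). u i * w k" "{..<m} \<times> {..<m}"]
    by (simp add: case_prod_beta)
  also have "\<dots> = (\<Sum>i<m. \<Sum>k<m. (E i k)\<^sup>2) * (ip m u u * ip m w w)"
    unfolding sum.cartesian_product[symmetric] ip_def sum_product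
    by (simp add: power2_eq_square mult_ac)
  also have "\<dots> \<le> e\<^sup>2 * (ip m u u * ip m w w)"
    using assms by (intro mult_right_mono) auto
  also have "\<dots> = (e * (sqrt (ip m u u) * sqrt (ip m w w)))\<^sup>2"
    by (simp only: power_mult_distrib real_sqrt_pow2 ip_nonneg)
  finally have "\<bar>\<Sum>i<m. \<Sum>k<m. u i * E i k * w k\<bar> \<le> \<bar>e * (sqrt (ip m u u) * sqrt (ip m w w))\<bar>"
    by (simp only: abs_le_square_iff)
  also have "\<dots> = e * (sqrt (ip m u u) * sqrt (ip m w w))"
    using assms by (intro abs_of_nonneg mult_nonneg_nonneg real_sqrt_ge_zero ip_nonneg)
  finally show ?thesis .
qed

text \<open>The upper bound on the statistic comes from the weights \<open>(1 - y j) / n\<close> with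
  \<open>y j = ip m \<mu> (a j - b)\<close>, where \<open>\<mu>\<close> solves the linear system of the sample covariance; the
  lower bound from the multiplier \<open>b\<close>.\<close>

lemma neg2_log_emp_lik_approx:
  fixes a :: "nat \<Rightarrow> nat \<Rightarrow> real"
  assumes n: "n \<ge> 1" and b: "\<And>i. b i = (\<Sum>j=1..n. a j i) / real n" and e: "0 \<le> e"
    and S: "(\<Sum>i<m. \<Sum>k<m. ((\<Sum>j=1..n. a j i * a j k) / n - (if i = k then 1 else 0))\<^sup>2) \<le> e\<^sup>2"
    and small: "e + ip m b b \<le> 1/2" "ip m b b \<le> 1/8"
      "\<And>j. j \<in> {1..n} \<Longrightarrow> ip m b b * ip m (a j) (a j) \<le> 1/64"
    and G: "(\<Sum>j=1..n. (ip m (a j) (a j))\<^sup>2) + n * (ip m b b)\<^sup>2 \<le> G"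
  obtains x where "neg2_log (emp_lik n m a) = ereal x"
    "\<bar>x - n * ip m b b\<bar> \<le> 2 * n * ip m b b * (e + ip m b b)
       + 32 * sqrt (n * ip m b b ^ 3 * G)"
proof -
  define c where "c = b"
  define \<beta> where "\<beta> = ip m c c"
  \<comment> \<open>\<open>E\<close> is the error of the sample second-moment matrix and
    \<open>V\<close> the centred sample covariance. As \<open>V\<close> is the identity plus
    \<open>E\<close> minus the rank-one matrix of \<open>c\<close>, it lies within
    \<open>e' = e + \<beta>\<close> of the identity in operator norm.\<close>
  define E where "E i k = (\<Sum>j=1..n. a j i * a j k) / n - (if i = k then 1 else 0)" for i k
  define V where "V i k = (\<Sum>j=1..n. a j i * a j k) / n - c i * c k" for i k
  define e' where "e' = e + \<beta>"
  have n0: "real n > 0" using n by simp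
  have \<beta>: "0 \<le> \<beta>" "\<beta> \<le> 1/8" "e' \<le> 1/2" "0 \<le> e'"
    using small e by (auto simp: \<beta>_def c_def e'_def)
  have sqrt_mono: "sqrt x \<le> k * sqrt y" if "x \<le> k\<^sup>2 * y" "0 \<le> k" for k x y :: real
    using real_sqrt_le_mono[OF that(1)] that(2) by (simp add: real_sqrt_mult)
  have sum_a: "(\<Sum>j=1..n. a j i) = n * c i" for i
    using n0 by (simp add: c_def b)
  have sum_aa: "(\<Sum>j=1..n. a j i * a j k) = n * (E i k + (if i = k then 1 else 0))" for i k
    using n0 by (simp add: E_def)
  have bil_E: "\<bar>\<Sum>i<m. \<Sum>k<m. u i * E i k * w k\<bar> \<le> e * (sqrt (ip m u u) * sqrt (ip m w w))" for u w
    using e S unfolding E_def by (rule abs_bilinear_le)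
  have bil_S: "(\<Sum>i<m. \<Sum>k<m. u i * (E i k + (if i = k then 1 else 0)) * w k)
      = (\<Sum>i<m. \<Sum>k<m. u i * E i k * w k) + ip m u w" for u w
  proof -
    have "u i * (E i k + (if i = k then 1 else 0)) * w k = u i * E i k * w k + (if i = k then u i * w k else 0)"
      for i k by (simp add: algebra_simps)
    then show ?thesis by (simp add: sum.distrib ip_def)
  qed
  have bil_V: "(\<Sum>i<m. \<Sum>k<m. u i * V i k * w k)
      = (\<Sum>i<m. \<Sum>k<m. u i * E i k * w k) + ip m u w - ip m u c * ip m c w" for u w
    unfolding bil_S[symmetric] ip_def[of m u c] ip_def[of m c w] sum_product
    unfolding sum_subtractf[symmetric]
    by (intro sum.cong refl) (simp add: V_def E_def algebra_simps)
  have ip_le: "\<bar>ip m u w\<bar> \<le> sqrt (ip m u u) * sqrt (ip m w w)" for u w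
    unfolding real_sqrt_mult[symmetric] by (rule real_le_rsqrt) (simp add: ip_cauchy_schwarz)
  have bil_V_le: "\<bar>(\<Sum>i<m. \<Sum>k<m. u i * V i k * w k) - ip m u w\<bar> \<le> e' * (sqrt (ip m u u) * sqrt (ip m w w))"
    for u w
  proof -
    have "\<bar>ip m u c * ip m c w\<bar> \<le> (sqrt (ip m u u) * sqrt \<beta>) * (sqrt \<beta> * sqrt (ip m w w))"
      unfolding abs_mult \<beta>_def by (intro mult_mono ip_le) auto
    also have "\<dots> = \<beta> * (sqrt (ip m u u) * sqrt (ip m w w))"
      using \<beta> by simp
    finally show ?thesis
      using bil_E[of u w] unfolding bil_V e'_def distrib_right by linarith
  qed
  have sum_sq: "(\<Sum>j=1..n. (ip m u (a j))\<^sup>2) = n * ((\<Sum>i<m. \<Sum>k<m. u i * E i k * u k) + ip m u u)" for u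
  proof -
    have "(\<Sum>j=1..n. (ip m u (a j))\<^sup>2) = (\<Sum>j=1..n. \<Sum>i<m. \<Sum>k<m. u i * u k * (a j i * a j k))"
      by (simp add: power2_eq_square ip_def sum_product mult_ac)
    also have "\<dots> = (\<Sum>i<m. \<Sum>k<m. \<Sum>j=1..n. u i * u k * (a j i * a j k))"
      by (subst sum.swap, intro sum.cong[OF refl], rule sum.swap)
    also have "\<dots> = n * (\<Sum>i<m. \<Sum>k<m. u i * (E i k + (if i = k then 1 else 0)) * u k)"
      unfolding sum_distrib_left[symmetric] sum_aa by (simp only: sum_distrib_left mult_ac)
    finally show ?thesis by (simp only: bil_S)
  qed
  have sum_ip: "(\<Sum>j=1..n. ip m u (a j)) = n * ip m u c" for u
    unfolding ip_def by (subst sum.swap) (simp only: sum_a sum_distrib_left[symmetric] mult.left_commute)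
  have G': "(\<Sum>j=1..n. (ip m (a j) (a j))\<^sup>2) + n * \<beta>\<^sup>2 \<le> G"
    using G by (simp add: \<beta>_def c_def)
  then have "0 \<le> G"
    by (smt (verit) n0 sum_nonneg zero_le_power2 mult_nonneg_nonneg of_nat_0_le_iff)

  \<comment> \<open>Dual side: both the sum and, up to \<open>n * e * \<beta>\<close>, the sum of
    squares of the \<open>t j\<close> equal \<open>n * \<beta>\<close>, so twice the sum of
    logarithms is \<open>n * \<beta>\<close> to leading order.\<close>
  define t where "t j = ip m c (a j)" for j
  have t2: "(t j)\<^sup>2 \<le> \<beta> * ip m (a j) (a j)" for j
    unfolding t_def \<beta>_def by (rule ip_cauchy_schwarz)
  have t_small: "(t j)\<^sup>2 \<le> 1/64" if "j \<in> {1..n}" for j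
    using t2[of j] small(3)[OF that] by (simp add: \<beta>_def c_def)
  have t4: "(\<Sum>j=1..n. (t j) ^ 4) \<le> \<beta>\<^sup>2 * G"
  proof -
    have "(t j) ^ 4 \<le> \<beta>\<^sup>2 * (ip m (a j) (a j))\<^sup>2" for j
      using power_mono[OF t2[of j] zero_le_power2, of 2] by (simp add: power_mult_distrib)
    then have "(\<Sum>j=1..n. (t j) ^ 4) \<le> \<beta>\<^sup>2 * (\<Sum>j=1..n. (ip m (a j) (a j))\<^sup>2)"
      unfolding sum_distrib_left by (intro sum_mono)
    also have "\<dots> \<le> \<beta>\<^sup>2 * G"
    proof (intro mult_left_mono)
      have "0 \<le> n * \<beta>\<^sup>2" by simp
      then show "(\<Sum>j=1..n. (ip m (a j) (a j))\<^sup>2) \<le> G" using G' by linarith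
    qed simp
    finally show ?thesis .
  qed
  have cEc: "\<bar>\<Sum>i<m. \<Sum>k<m. c i * E i k * c k\<bar> \<le> e * \<beta>"
    using bil_E[of c c] \<beta> by (simp add: \<beta>_def)
  have t_sq: "\<bar>(\<Sum>j=1..n. (t j)\<^sup>2) - n * \<beta>\<bar> \<le> n * (e * \<beta>)"
    using mult_left_mono[OF cEc, of "real n"] n0 unfolding t_def sum_sq \<beta>_def[symmetric]
    by (simp add: distrib_left abs_mult)
  have "n * (e * \<beta>) \<le> n * (1 * \<beta>)"
    using \<beta> n0 by (intro mult_left_mono mult_right_mono) (auto simp: e'_def)
  with t_sq have "(\<Sum>j=1..n. (t j)\<^sup>2) \<le> 2 * (n * \<beta>)"
    by (simp only: abs_le_iff mult_1) linarith
  then have "(\<Sum>j=1..n. (t j)\<^sup>2) * (\<Sum>j=1..n. (t j) ^ 4) \<le> 2 * (n * \<beta>) * (\<beta>\<^sup>2 * G)"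
    using t4 \<beta> n0 by (intro mult_mono) (auto intro: sum_nonneg)
  also have "\<dots> \<le> 4 * (n * \<beta> ^ 3 * G)"
    using \<beta> n0 \<open>0 \<le> G\<close> by (simp add: power3_eq_cube power2_eq_square)
  finally have t_cub: "sqrt ((\<Sum>j=1..n. (t j)\<^sup>2) * (\<Sum>j=1..n. (t j) ^ 4)) \<le> 2 * sqrt (n * \<beta> ^ 3 * G)"
    by (intro sqrt_mono) simp_all
  have t_sum: "(\<Sum>j=1..n. t j) = n * \<beta>"
    unfolding t_def sum_ip \<beta>_def ..
  have "n * \<beta> - n * (e * \<beta>) - 4 * sqrt (n * \<beta> ^ 3 * G) \<le> 2 * (\<Sum>j=1..n. ln (1 + t j))"
  proof -
    have "(t j)\<^sup>2 \<le> 1/4" if "j \<in> {1..n}" for j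
      using t_small[OF that] by simp
    then have "n * \<beta> - (\<Sum>j=1..n. (t j)\<^sup>2) / 2 - 2 * sqrt (n * \<beta> ^ 3 * G) \<le> (\<Sum>j=1..n. ln (1 + t j))"
      using sum_ln_one_plus_ge_cubic[of "{1..n}" t] t_cub t_sum by simp
    with t_sq show ?thesis by (simp add: abs_le_iff)
  qed
  moreover have "emp_lik n m a \<le> ennreal (exp (- (\<Sum>j=1..n. ln (1 + t j))))"
    unfolding t_def
  proof (rule emp_lik_le)
    fix j assume "j \<in> {1..n}"
    then have "\<bar>t j\<bar> < 1"
      using t_small[of j] by (intro power2_less_imp_less[of "\<bar>t j\<bar>" 1]) auto
    then show "0 < 1 + ip m c (a j)" by (auto simp: t_def)
  qed
  ultimately have lower: "emp_lik n m a \<le> ennreal (exp (- (\<Sum>j=1..n. ln (1 + t j))))"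
    "n * \<beta> - n * (e * \<beta>) - 4 * sqrt (n * \<beta> ^ 3 * G) \<le> 2 * (\<Sum>j=1..n. ln (1 + t j))"
    by auto

  have V_pos: "ip m u u / 2 \<le> quad_form m V u" for u
  proof -
    have "e' * ip m u u \<le> 1/2 * ip m u u"
      using \<beta> by (intro mult_right_mono ip_nonneg)
    then have "e' * (sqrt (ip m u u) * sqrt (ip m u u)) \<le> 1/2 * ip m u u"
      by simp
    then show ?thesis
      using bil_V_le[of u u] by (simp add: quad_form_def abs_le_iff)
  qed
  \<comment> \<open>Primal side. Whitening is used here as a solver for the linear system with the
    positive definite matrix \<open>V\<close>.\<close>
  have "\<exists>A. whitens m V A"
  proof (rule whitens_exists)
    fix u :: "nat \<Rightarrow> real" assume "\<exists>i<m. u i \<noteq> 0"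
    then have "0 < ip m u u"
      unfolding ip_def by (auto intro!: sum_pos2 simp: zero_less_mult_iff neq_iff)
    then show "quad_form m V u > 0" using V_pos[of u] by simp
  qed (simp add: V_def mult_ac)
  then obtain \<mu> where \<mu>: "\<And>i. i < m \<Longrightarrow> (\<Sum>k<m. V i k * \<mu> k) = c i"
    using whitens_solve by blast
  have bil_\<mu>: "(\<Sum>i<m. \<Sum>k<m. u i * V i k * \<mu> k) = ip m u c" for u
    unfolding ip_def mult.assoc sum_distrib_left[symmetric] using \<mu> by simp
  \<comment> \<open>A crude bound first: \<open>V\<close> is at least half the identity, so
    \<open>|\<mu>|^2 \<le> 2 (\<mu>, c)\<close>; with Cauchy-Schwarz this gives
    \<open>(\<mu>, c) \<le> 2 \<beta>\<close> and \<open>|\<mu>|^2 \<le> 4 \<beta>\<close>.\<close>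
  have "ip m \<mu> \<mu> \<le> 2 * ip m \<mu> c"
    using V_pos[of \<mu>] bil_\<mu>[of \<mu>] by (simp add: quad_form_def)
  have "(ip m \<mu> c)\<^sup>2 \<le> ip m \<mu> \<mu> * \<beta>"
    unfolding \<beta>_def by (rule ip_cauchy_schwarz)
  also have "\<dots> \<le> 2 * ip m \<mu> c * \<beta>"
    using \<beta> \<open>ip m \<mu> \<mu> \<le> 2 * ip m \<mu> c\<close> by (intro mult_right_mono)
  finally have "ip m \<mu> c * ip m \<mu> c \<le> ip m \<mu> c * (2 * \<beta>)"
    by (simp add: power2_eq_square mult_ac)
  moreover have "0 \<le> ip m \<mu> c"
    using \<open>ip m \<mu> \<mu> \<le> 2 * ip m \<mu> c\<close> ip_nonneg[of m \<mu>] by linarith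
  ultimately have \<mu>c: "ip m \<mu> c \<le> 2 * \<beta>"
    using \<beta> by (metis mult_left_le_imp_le less_eq_real_def mult_nonneg_nonneg zero_le_numeral)
  then have \<mu>\<mu>: "ip m \<mu> \<mu> \<le> 4 * \<beta>"
    using \<open>ip m \<mu> \<mu> \<le> 2 * ip m \<mu> c\<close> by linarith
  have "sqrt (ip m \<mu> \<mu>) \<le> sqrt (4 * \<beta>)" using \<mu>\<mu> by (rule real_sqrt_le_mono)
  then have "sqrt \<beta> * sqrt (ip m \<mu> \<mu>) \<le> sqrt \<beta> * (2 * sqrt \<beta>)"
    using \<beta> by (intro mult_left_mono) (auto simp: real_sqrt_mult)
  also have "sqrt \<beta> * (2 * sqrt \<beta>) = 2 * \<beta>" using \<beta> by simp
  finally have "sqrt \<beta> * sqrt (ip m \<mu> \<mu>) \<le> 2 * \<beta>" .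
  then have eb: "e' * (sqrt \<beta> * sqrt (ip m \<mu> \<mu>)) \<le> e' * (2 * \<beta>)"
    using \<beta> by (intro mult_left_mono)
  have comm: "ip m c \<mu> = ip m \<mu> c" by (simp add: ip_def mult.commute)
  \<comment> \<open>The refinement: the \<open>V\<close>-product of \<open>c\<close> and \<mu> is
    exactly \<beta>, and replacing \<open>V\<close> by the identity costs
    \<open>e' |c| |\<mu>|\<close>, which the crude bound controls.\<close>
  have "\<beta> - ip m c \<mu> \<ge> - (e' * (sqrt \<beta> * sqrt (ip m \<mu> \<mu>)))"
    using bil_V_le[of c \<mu>] by (simp add: bil_\<mu> \<beta>_def abs_le_iff)
  with comm eb have \<mu>c': "ip m \<mu> c \<le> \<beta> + 2 * e' * \<beta>" by (simp add: mult_ac)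

  define y where "y j = ip m \<mu> (\<lambda>i. a j i - c i)" for j
  have y_eq: "y j = ip m \<mu> (a j) - ip m \<mu> c" for j
    by (simp add: y_def ip_def algebra_simps sum_subtractf)
  have y_sum: "(\<Sum>j=1..n. y j) = 0"
    unfolding y_eq sum_subtractf sum_ip by simp
  \<comment> \<open>Centring makes the sum of squares the quadratic form of \<open>V\<close> at
    \<mu>. The quadratic term of the logarithms thus contributes \<open>n (\<mu>, c)\<close>, which
    is \<open>n * \<beta>\<close> to leading order, as on the dual side.\<close>
  have y_sq: "(\<Sum>j=1..n. (y j)\<^sup>2) = n * ip m \<mu> c"
  proof -
    have "(\<Sum>j=1..n. (y j)\<^sup>2)
        = (\<Sum>j=1..n. (ip m \<mu> (a j))\<^sup>2) - 2 * ip m \<mu> c * (\<Sum>j=1..n. ip m \<mu> (a j)) + n * (ip m \<mu> c)\<^sup>2"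
      unfolding y_eq power2_diff sum.distrib sum_subtractf sum_distrib_left by (simp add: mult_ac)
    also have "\<dots> = n * (\<Sum>i<m. \<Sum>k<m. \<mu> i * V i k * \<mu> k)"
      unfolding sum_sq sum_ip bil_V comm by (simp add: algebra_simps power2_eq_square)
    finally show ?thesis by (simp only: bil_\<mu>)
  qed
  have y2: "(y j)\<^sup>2 \<le> 8 * \<beta> * (ip m (a j) (a j) + \<beta>)" for j
  proof -
    have "(y j)\<^sup>2 \<le> ip m \<mu> \<mu> * ip m (\<lambda>i. a j i - c i) (\<lambda>i. a j i - c i)"
      unfolding y_def by (rule ip_cauchy_schwarz)
    also have "ip m (\<lambda>i. a j i - c i) (\<lambda>i. a j i - c i) \<le> (\<Sum>i<m. 2 * (a j i * a j i) + 2 * (c i * c i))"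
      unfolding ip_def
    proof (rule sum_mono)
      fix i
      show "(a j i - c i) * (a j i - c i) \<le> 2 * (a j i * a j i) + 2 * (c i * c i)"
        using zero_le_square[of "a j i + c i"] by (simp add: algebra_simps)
    qed
    also have "\<dots> = 2 * (ip m (a j) (a j) + \<beta>)"
      by (simp add: ip_def \<beta>_def sum.distrib sum_distrib_left distrib_left)
    finally have "(y j)\<^sup>2 \<le> ip m \<mu> \<mu> * (2 * (ip m (a j) (a j) + \<beta>))"
      by (simp add: mult_left_mono)
    also have "\<dots> \<le> 4 * \<beta> * (2 * (ip m (a j) (a j) + \<beta>))"
      using \<mu>\<mu> \<beta> by (intro mult_right_mono) auto
    finally show ?thesis by (simp add: algebra_simps)
  qed
  \<comment> \<open>The thresholds 1/64 and 1/8 in the assumptions are chosen for this line: 8/64 +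
    8 * (1/8)^2 = 1/4.\<close>
  have y_small: "(y j)\<^sup>2 \<le> 1/4" if "j \<in> {1..n}" for j
  proof -
    have "\<beta> * \<beta> \<le> 1/8 * (1/8)" using \<beta> by (intro mult_mono) auto
    then show ?thesis
      using y2[of j] small(3)[OF that] by (simp add: \<beta>_def c_def algebra_simps)
  qed
  \<comment> \<open>The summand \<open>n * \<beta>\<^sup>2\<close> in the bound by \<open>G\<close>
    pays for the centring of the observations.\<close>
  have y4: "(\<Sum>j=1..n. (y j) ^ 4) \<le> 128 * \<beta>\<^sup>2 * G"
  proof -
    have "(y j) ^ 4 \<le> 128 * \<beta>\<^sup>2 * ((ip m (a j) (a j))\<^sup>2 + \<beta>\<^sup>2)" for j
    proof -
      have "(y j) ^ 4 \<le> 64 * \<beta>\<^sup>2 * (ip m (a j) (a j) + \<beta>)\<^sup>2"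
        using power_mono[OF y2[of j] zero_le_power2, of 2] by (simp add: power_mult_distrib)
      also have "\<dots> \<le> 64 * \<beta>\<^sup>2 * (2 * ((ip m (a j) (a j))\<^sup>2 + \<beta>\<^sup>2))"
        using zero_le_power2[of "ip m (a j) (a j) - \<beta>"]
        by (intro mult_left_mono) (simp_all add: power2_eq_square algebra_simps)
      finally show ?thesis by (simp add: algebra_simps)
    qed
    then have "(\<Sum>j=1..n. (y j) ^ 4) \<le> (\<Sum>j=1..n. 128 * \<beta>\<^sup>2 * ((ip m (a j) (a j))\<^sup>2 + \<beta>\<^sup>2))"
      by (intro sum_mono)
    also have "\<dots> = 128 * \<beta>\<^sup>2 * ((\<Sum>j=1..n. (ip m (a j) (a j))\<^sup>2) + n * \<beta>\<^sup>2)"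
      by (simp add: sum.distrib flip: sum_distrib_left)
    also have "\<dots> \<le> 128 * \<beta>\<^sup>2 * G"
      using G' by (intro mult_left_mono) auto
    finally show ?thesis .
  qed
  have "(\<Sum>j=1..n. (y j)\<^sup>2) * (\<Sum>j=1..n. (y j) ^ 4) \<le> (n * (2 * \<beta>)) * (128 * \<beta>\<^sup>2 * G)"
    using y4 \<beta> n0 \<mu>c unfolding y_sq by (intro mult_mono mult_left_mono) (auto intro: sum_nonneg)
  also have "\<dots> = 256 * (n * \<beta> ^ 3 * G)" by (simp add: power3_eq_cube power2_eq_square)
  finally have y_cub: "sqrt ((\<Sum>j=1..n. (y j)\<^sup>2) * (\<Sum>j=1..n. (y j) ^ 4)) \<le> 16 * sqrt (n * \<beta> ^ 3 * G)"
    by (intro sqrt_mono) simp_all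
  have "- (n * ip m \<mu> c) / 2 - 16 * sqrt (n * \<beta> ^ 3 * G) \<le> (\<Sum>j=1..n. ln (1 - y j))"
    using sum_ln_one_plus_ge_cubic[of "{1..n}" "\<lambda>j. - y j"] y_small y_cub y_sum y_sq
    by (simp add: sum_negf)
  moreover have "n * ip m \<mu> c \<le> n * (\<beta> + 2 * e' * \<beta>)"
    using \<mu>c' by (intro mult_left_mono) auto
  ultimately have upper: "2 * - (\<Sum>j=1..n. ln (1 - y j)) \<le> n * \<beta> + 2 * n * \<beta> * e' + 32 * sqrt (n * \<beta> ^ 3 * G)"
    by (simp add: algebra_simps)
  have "ennreal (exp (- (- (\<Sum>j=1..n. ln (1 - y j))))) \<le> emp_lik n m a"
    unfolding minus_minus
  proof (rule emp_lik_ge[OF n _ y_sum])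
    fix j assume "j \<in> {1..n}"
    then have "\<bar>y j\<bar> < 1"
      using y_small[of j] by (intro power2_less_imp_less[of "\<bar>y j\<bar>" 1]) auto
    then show "y j < 1" by auto
  next
    \<comment> \<open>This is where the equation for \<mu> enters: the sum of the
      \<open>y j * a j\<close> is \<open>n V \<mu> = n c\<close>, which is exactly the sum of the
      \<open>a j\<close>.\<close>
    fix i assume i: "i < m"
    have "(\<Sum>j=1..n. y j * a j i)
        = (\<Sum>k<m. \<mu> k * (\<Sum>j=1..n. a j i * a j k)) - ip m \<mu> c * (\<Sum>j=1..n. a j i)"
      unfolding y_eq left_diff_distrib sum_subtractf sum_distrib_left ip_def sum_distrib_right
      by (subst sum.swap) (simp add: mult_ac)
    also have "\<dots> = (\<Sum>k<m. \<mu> k * (n * V i k))"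
    proof -
      have "n * V i k = (\<Sum>j=1..n. a j i * a j k) - n * (c i * c k)" for k
        using n0 by (simp add: V_def right_diff_distrib)
      then show ?thesis
        unfolding sum_a ip_def sum_distrib_right sum_subtractf[symmetric]
        by (simp add: right_diff_distrib mult_ac)
    qed
    also have "\<dots> = n * (\<Sum>k<m. V i k * \<mu> k)"
      by (simp add: sum_distrib_left mult_ac)
    also have "\<dots> = n * c i" by (simp only: \<mu>[OF i])
    moreover have "(\<Sum>j=1..n. (1 - y j) * a j i) = n * c i - (\<Sum>j=1..n. y j * a j i)"
      by (simp only: left_diff_distrib sum_subtractf mult_1 sum_a)
    ultimately show "(\<Sum>j=1..n. (1 - y j) * a j i) = 0" by simp
  qed
  then obtain x where x: "neg2_log (emp_lik n m a) = ereal x"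
      "2 * (\<Sum>j=1..n. ln (1 + t j)) \<le> x" "x \<le> 2 * - (\<Sum>j=1..n. ln (1 - y j))"
    using neg2_log_bounds lower(1) by blast
  have "n * (e * \<beta>) \<le> 2 * n * \<beta> * e'" "0 \<le> sqrt (n * \<beta> ^ 3 * G)"
    using \<beta> e n0 \<open>0 \<le> G\<close> by (auto simp: e'_def algebra_simps)
  then have "\<bar>x - n * \<beta>\<bar> \<le> 2 * n * \<beta> * e' + 32 * sqrt (n * \<beta> ^ 3 * G)"
    using x(2,3) lower(2) upper by (simp only: abs_le_iff) linarith
  then show ?thesis
    using x(1) that by (simp add: e'_def \<beta>_def c_def)
qed

section \<open>Measurability of the empirical likelihood\<close>

lemma pointwise_convergent_subsequence:
  fixes q :: "nat \<Rightarrow> 'i \<Rightarrow> real"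
  assumes "finite J" "\<And>k j. j \<in> J \<Longrightarrow> q k j \<in> {0..1}"
  obtains l r where "strict_mono r" "\<And>j. j \<in> J \<Longrightarrow> (\<lambda>k. q (r k) j) \<longlonglongrightarrow> l j"
proof -
  have "\<exists>l r. strict_mono r \<and> (\<forall>e>0. \<forall>\<^sub>F k in sequentially. \<forall>i\<in>J. dist (q (r k) i) (l i) < e)"
    using compact_lemma_general[of J "\<lambda>x j. x j" q "\<lambda>x. x"] assms
    by (force intro!: boundedI[of _ 1])
  then obtain l r where r: "strict_mono r"
    and l: "\<And>e. e > 0 \<Longrightarrow> \<forall>\<^sub>F k in sequentially. \<forall>i\<in>J. dist (q (r k) i) (l i) < e" by blast
  have "(\<lambda>k. q (r k) j) \<longlonglongrightarrow> l j" if "j \<in> J" for j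
    unfolding tendsto_iff
  proof (intro allI impI)
    fix e :: real assume "e > 0"
    then show "\<forall>\<^sub>F k in sequentially. dist (q (r k) j) (l j) < e"
      by (rule eventually_mono[OF l]) (use that in auto)
  qed
  with r show ?thesis by (rule that)
qed

text \<open>The constraint on the total mass is left out here and relaxed later together with the
  linear constraints, so that rational approximations arise by rounding each coordinate
  separately.\<close>

definition rational_cube :: "nat \<Rightarrow> (nat \<Rightarrow> real) set" where
  "rational_cube n = {1..n} \<rightarrow>\<^sub>E (\<rat> \<inter> {0..1})"

text \<open>By compactness, the supremum is attained and can be approximated by rational weights
  which satisfy the constraints approximately.\<close>

lemma le_emp_lik_iff_rational:
  assumes c: "0 < c"
  shows "ennreal c \<le> emp_lik n m a \<longleftrightarrow>
    (\<forall>k. \<exists>q\<in>rational_cube n. (\<forall>i<m. \<bar>\<Sum>j=1..n. q j * a j i\<bar> < 1 / Suc k) \<and> \<bar>(\<Sum>j=1..n. q j) - 1\<bar> < 1 / Suc k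
       \<and> c - 1 / Suc k < (\<Prod>j=1..n. real n * q j))" (is "_ \<longleftrightarrow> ?rhs")
proof
  assume le: "ennreal c \<le> emp_lik n m a"
  show ?rhs
  proof
    fix k
    define e where "e = 1 / real (Suc k)"
    have "e > 0" by (simp add: e_def)
    \<comment> \<open>\<open>c - e\<close> may be negative; \<open>ennreal\<close> then maps it to
      0, which still lies strictly below \<open>ennreal c\<close>.\<close>
    have "ennreal (c - e) < ennreal c"
      using \<open>e > 0\<close> c by (simp add: ennreal_lessI)
    also note le
    finally obtain \<pi> where \<pi>: "\<pi> \<in> prob_vectors n" "\<And>i. i < m \<Longrightarrow> (\<Sum>j=1..n. \<pi> j * a j i) = 0"
      and "ennreal (c - e) < ennreal (\<Prod>j=1..n. real n * \<pi> j)"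
      by (auto simp: emp_lik_def less_SUP_iff)
    then have prod: "c - e < (\<Prod>j=1..n. real n * \<pi> j)"
      by (meson ennreal_leI not_le)
    have \<pi>01: "\<pi> j \<in> {0..1}" if "j \<in> {1..n}" for j
      using \<pi>(1) that by (auto simp: prob_vectors_def PiE_iff)
    \<comment> \<open>Rounding down to multiples of \<open>1 / Suc l\<close> never leaves the unit
      interval. The sum may drop below 1, which the relaxed mass constraint permits.\<close>
    define q where "q l = (\<lambda>j\<in>{1..n}. of_int \<lfloor>real (Suc l) * \<pi> j\<rfloor> / real (Suc l))" for l
    have q_lim: "(\<lambda>l. q l j) \<longlonglongrightarrow> \<pi> j" if "j \<in> {1..n}" for j
    proof -
      have lo: "\<pi> j - 1 / real (Suc l) \<le> q l j" and hi: "q l j \<le> \<pi> j" for l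
      proof -
        have "(real (Suc l) * \<pi> j - 1) / real (Suc l) \<le> of_int \<lfloor>real (Suc l) * \<pi> j\<rfloor> / real (Suc l)"
          by (intro divide_right_mono) (linarith, simp)
        then have "(real (Suc l) * \<pi> j - 1) / real (Suc l) \<le> q l j"
          using that by (simp only: q_def restrict_apply if_True)
        then show "\<pi> j - 1 / real (Suc l) \<le> q l j" by (simp add: diff_divide_distrib)
        have "of_int \<lfloor>real (Suc l) * \<pi> j\<rfloor> / real (Suc l) \<le> real (Suc l) * \<pi> j / real (Suc l)"
          by (intro divide_right_mono) auto
        then show "q l j \<le> \<pi> j" using that by (simp add: q_def)
      qed
      have "(\<lambda>l. \<pi> j - 1 / real (Suc l)) \<longlonglongrightarrow> \<pi> j - 0"
        by (intro tendsto_intros LIMSEQ_Suc lim_1_over_n)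
      then have lim: "(\<lambda>l. \<pi> j - 1 / real (Suc l)) \<longlonglongrightarrow> \<pi> j" by simp
      show ?thesis
        by (rule tendsto_sandwich[OF always_eventually always_eventually lim tendsto_const])
          (intro allI lo hi)+
    qed
    have "q l \<in> rational_cube n" for l
    proof -
      have "q l j \<in> \<rat> \<inter> {0..1}" if "j \<in> {1..n}" for j
      proof -
        have "real (Suc l) * \<pi> j \<le> real (Suc l) * 1" using \<pi>01[OF that] by (intro mult_left_mono) auto
        then have "real_of_int \<lfloor>real (Suc l) * \<pi> j\<rfloor> \<le> real (Suc l)"
          using of_int_floor_le[of "real (Suc l) * \<pi> j"] unfolding mult_1_right by (rule order_trans[rotated])
        then show ?thesis using \<pi>01[OF that] that by (auto simp: q_def)
      qed
      then show ?thesis by (auto simp: rational_cube_def q_def)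
    qed
    moreover have "\<forall>\<^sub>F l in sequentially. \<forall>i<m. \<bar>\<Sum>j=1..n. q l j * a j i\<bar> < e"
    proof -
      have "\<forall>\<^sub>F l in sequentially. \<bar>\<Sum>j=1..n. q l j * a j i\<bar> < e" if "i < m" for i
      proof -
        have "(\<lambda>l. \<bar>\<Sum>j=1..n. q l j * a j i\<bar>) \<longlonglongrightarrow> \<bar>\<Sum>j=1..n. \<pi> j * a j i\<bar>"
          by (intro tendsto_intros q_lim)
        with \<pi>(2)[OF that] \<open>e > 0\<close> show ?thesis by (intro order_tendstoD) auto
      qed
      then have "\<forall>\<^sub>F l in sequentially. \<forall>i\<in>{..<m}. \<bar>\<Sum>j=1..n. q l j * a j i\<bar> < e"
        by (intro eventually_ball_finite) auto
      then show ?thesis by (simp only: Ball_def lessThan_iff)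
    qed
    moreover have "\<forall>\<^sub>F l in sequentially. \<bar>(\<Sum>j=1..n. q l j) - 1\<bar> < e"
    proof -
      have "(\<lambda>l. \<bar>(\<Sum>j=1..n. q l j) - 1\<bar>) \<longlonglongrightarrow> \<bar>(\<Sum>j=1..n. \<pi> j) - 1\<bar>"
        by (intro tendsto_intros q_lim)
      with \<pi>(1) \<open>e > 0\<close> show ?thesis by (intro order_tendstoD) (auto simp: prob_vectors_def)
    qed
    moreover have "\<forall>\<^sub>F l in sequentially. c - e < (\<Prod>j=1..n. real n * q l j)"
    proof -
      have "(\<lambda>l. \<Prod>j=1..n. real n * q l j) \<longlonglongrightarrow> (\<Prod>j=1..n. real n * \<pi> j)"
        by (intro tendsto_intros q_lim)
      with prod show ?thesis by (intro order_tendstoD)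
    qed
    ultimately have "\<forall>\<^sub>F l in sequentially. q l \<in> rational_cube n \<and> (\<forall>i<m. \<bar>\<Sum>j=1..n. q l j * a j i\<bar> < e)
        \<and> \<bar>(\<Sum>j=1..n. q l j) - 1\<bar> < e \<and> c - e < (\<Prod>j=1..n. real n * q l j)"
      by (simp add: eventually_conj_iff)
    then obtain l where "q l \<in> rational_cube n \<and> (\<forall>i<m. \<bar>\<Sum>j=1..n. q l j * a j i\<bar> < e)
        \<and> \<bar>(\<Sum>j=1..n. q l j) - 1\<bar> < e \<and> c - e < (\<Prod>j=1..n. real n * q l j)"
      using eventually_happens'[OF sequentially_bot] by blast
    then show "\<exists>q\<in>rational_cube n. (\<forall>i<m. \<bar>\<Sum>j=1..n. q j * a j i\<bar> < 1 / Suc k)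
        \<and> \<bar>(\<Sum>j=1..n. q j) - 1\<bar> < 1 / Suc k \<and> c - 1 / Suc k < (\<Prod>j=1..n. real n * q j)"
      unfolding e_def by blast
  qed
next
  assume ?rhs
  then have "\<forall>k. \<exists>q. q \<in> rational_cube n \<and> ((\<forall>i<m. \<bar>\<Sum>j=1..n. q j * a j i\<bar> < 1 / Suc k)
      \<and> \<bar>(\<Sum>j=1..n. q j) - 1\<bar> < 1 / Suc k \<and> c - 1 / Suc k < (\<Prod>j=1..n. real n * q j))"
    unfolding Bex_def .
  from choice[OF this] obtain q where
    "\<forall>k. q k \<in> rational_cube n \<and> ((\<forall>i<m. \<bar>\<Sum>j=1..n. q k j * a j i\<bar> < 1 / Suc k)
      \<and> \<bar>(\<Sum>j=1..n. q k j) - 1\<bar> < 1 / Suc k \<and> c - 1 / Suc k < (\<Prod>j=1..n. real n * q k j))" ..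
  then have q: "\<And>k. q k \<in> rational_cube n" "\<And>k i. i < m \<Longrightarrow> \<bar>\<Sum>j=1..n. q k j * a j i\<bar> < 1 / Suc k"
      "\<And>k. \<bar>(\<Sum>j=1..n. q k j) - 1\<bar> < 1 / Suc k" "\<And>k. c - 1 / Suc k < (\<Prod>j=1..n. real n * q k j)"
    by simp_all
  have q01: "q k j \<in> {0..1}" if "j \<in> {1..n}" for k j
    using q(1)[of k] that by (auto simp: rational_cube_def PiE_iff)
  \<comment> \<open>Along a subsequence the nearly feasible rational points converge; all tolerances
    vanish in the limit, so the limit is exactly feasible and its product is at least
    \<open>c\<close>.\<close>
  then obtain l r where r: "strict_mono r" and l: "\<And>j. j \<in> {1..n} \<Longrightarrow> (\<lambda>k. q (r k) j) \<longlonglongrightarrow> l j"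
    using pointwise_convergent_subsequence[of "{1..n}" q, OF finite_atLeastAtMost q01] by blast
  have inv: "(\<lambda>k. 1 / real (Suc (r k))) \<longlonglongrightarrow> 0"
    using LIMSEQ_subseq_LIMSEQ[OF LIMSEQ_Suc[OF lim_1_over_n[where 'a = real]] r]
    by (simp add: o_def)
  define \<pi> where "\<pi> = restrict l {1..n}"
  have "(\<Sum>j=1..n. l j * a j i) = 0" if "i < m" for i
  proof -
    have "(\<lambda>k. \<bar>\<Sum>j=1..n. q (r k) j * a j i\<bar>) \<longlonglongrightarrow> \<bar>\<Sum>j=1..n. l j * a j i\<bar>"
      by (intro tendsto_intros l)
    then have "\<bar>\<Sum>j=1..n. l j * a j i\<bar> \<le> 0"
      using q(2)[OF that] by (intro LIMSEQ_le[OF _ inv]) (auto intro!: exI[of _ 0] less_imp_le)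
    then show ?thesis by simp
  qed
  moreover have "(\<Sum>j=1..n. l j) = 1"
  proof -
    have "(\<lambda>k. \<bar>(\<Sum>j=1..n. q (r k) j) - 1\<bar>) \<longlonglongrightarrow> \<bar>(\<Sum>j=1..n. l j) - 1\<bar>"
      by (intro tendsto_intros l)
    then have "\<bar>(\<Sum>j=1..n. l j) - 1\<bar> \<le> 0"
      using q(3) by (intro LIMSEQ_le[OF _ inv]) (auto intro!: exI[of _ 0] less_imp_le)
    then show ?thesis by simp
  qed
  moreover have "l j \<in> {0..1}" if "j \<in> {1..n}" for j
    by (rule closed_sequentially[OF closed_atLeastAtMost _ l[OF that]]) (rule q01[OF that])
  moreover have "c \<le> (\<Prod>j=1..n. real n * l j)"
  proof (rule LIMSEQ_le)
    show "(\<lambda>k. c - 1 / real (Suc (r k))) \<longlonglongrightarrow> c"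
      using tendsto_diff[OF tendsto_const[of c] inv] by simp
    show "(\<lambda>k. \<Prod>j=1..n. real n * q (r k) j) \<longlonglongrightarrow> (\<Prod>j=1..n. real n * l j)"
      by (intro tendsto_intros l)
  qed (use q(4) in \<open>auto intro!: exI[of _ 0] less_imp_le\<close>)
  ultimately have "\<pi> \<in> prob_vectors n" "\<forall>i<m. (\<Sum>j=1..n. \<pi> j * a j i) = 0"
      "c \<le> (\<Prod>j=1..n. real n * \<pi> j)"
    by (auto simp: \<pi>_def prob_vectors_def)
  then show "ennreal c \<le> emp_lik n m a"
    unfolding emp_lik_def by (intro SUP_upper2[of \<pi>] ennreal_leI) auto
qed

lemma emp_lik_less_top: "emp_lik n m a < \<top>"
proof -
  have "emp_lik n m a \<le> ennreal (real n ^ n)"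
    unfolding emp_lik_def
  proof (intro SUP_least ennreal_leI)
    fix \<pi> assume "\<pi> \<in> {\<pi> \<in> prob_vectors n. \<forall>i<m. (\<Sum>j = 1..n. \<pi> j * a j i) = 0}"
    then have "\<pi> j \<in> {0..1}" if "j \<in> {1..n}" for j
      using that by (auto simp: prob_vectors_def PiE_iff)
    then have "(\<Prod>j=1..n. real n * \<pi> j) \<le> (\<Prod>j=1..n. real n)"
      by (intro prod_mono) (auto simp: mult_left_le)
    then show "(\<Prod>j=1..n. real n * \<pi> j) \<le> real n ^ n" by simp
  qed
  then show ?thesis using ennreal_less_top le_less_trans by blast
qed

text \<open>The supremum runs over an uncountable set that itself depends on \<omega>. The rational
  description turns each upper level set into countable intersections and unions of sets given by
  finitely many measurable inequalities.\<close>

lemma borel_measurable_emp_lik: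
  assumes "\<And>j i. j \<in> {1..n} \<Longrightarrow> i < m \<Longrightarrow> (\<lambda>\<omega>. a \<omega> j i) \<in> borel_measurable M"
  shows "(\<lambda>\<omega>. emp_lik n m (a \<omega>)) \<in> borel_measurable M"
proof (rule borel_measurableI_ge)
  fix y :: ennreal
  consider "y = 0" | "y = \<top>" | c where "y = ennreal c" "0 < c"
    by (cases y) (auto simp: le_less)
  then show "{\<omega> \<in> space M. y \<le> emp_lik n m (a \<omega>)} \<in> sets M"
  proof cases
    case 2
    then have "{\<omega> \<in> space M. y \<le> emp_lik n m (a \<omega>)} = {}"
      using less_imp_neq[OF emp_lik_less_top[of n m]] by (auto simp: top_unique)
    then show ?thesis by (simp only: sets.empty_sets)
  next
    case (3 c)
    have D: "countable (rational_cube n)"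
      unfolding rational_cube_def by (intro countable_PiE countable_Int1 countable_rat) auto
    have m1: "(\<lambda>\<omega>. \<Sum>j=1..n. q j * a \<omega> j i) \<in> borel_measurable M" if "i < m" for q :: "nat \<Rightarrow> real" and i
      using that by (intro borel_measurable_sum borel_measurable_times assms) auto
    have m2: "{\<omega> \<in> space M. \<forall>i<m. \<bar>\<Sum>j=1..n. q j * a \<omega> j i\<bar> < e} \<in> sets M" for q :: "nat \<Rightarrow> real" and e
    proof -
      have "{\<omega> \<in> space M. \<forall>i\<in>{..<m}. \<bar>\<Sum>j=1..n. q j * a \<omega> j i\<bar> < e} \<in> sets M"
        by (intro sets.sets_Collect_finite_All borel_measurable_less borel_measurable_abs
            borel_measurable_const m1) auto
      then show ?thesis by (simp only: Ball_def lessThan_iff)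
    qed
    have m3: "{\<omega> \<in> space M. \<exists>q\<in>rational_cube n. (\<forall>i<m. \<bar>\<Sum>j=1..n. q j * a \<omega> j i\<bar> < 1 / Suc k)
        \<and> \<bar>(\<Sum>j=1..n. q j) - 1\<bar> < 1 / Suc k \<and> c - 1 / Suc k < (\<Prod>j=1..n. real n * q j)} \<in> sets M" for k
      by (intro sets.sets_Collect_countable_Ex'[OF _ D] sets.sets_Collect_conj m2 sets.sets_Collect_const)
    show ?thesis
      unfolding 3 le_emp_lik_iff_rational[OF 3(2)]
      by (intro sets.sets_Collect_countable_All m3)
  qed simp
qed

section \<open>Characteristic function of the squared norm of a sum\<close>

lemma cmod_exp_taylor_le:
  fixes b :: complex
  assumes "Re b \<le> 0" "0 \<le> x" "0 \<le> y"
  shows "cmod (exp (b * of_real y) - exp (b * of_real x) * (1 + b * of_real (y - x)))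
      \<le> cmod b ^ 2 * \<bar>y - x\<bar> ^ 2" (is ?th1)
    and "cmod (exp (b * of_real y)
        - exp (b * of_real x) * (1 + b * of_real (y - x) + b\<^sup>2 * of_real ((y - x)\<^sup>2) / 2))
      \<le> cmod b ^ 3 * \<bar>y - x\<bar> ^ 3 / 2" (is ?th2)
proof -
  \<comment> \<open>On this half-line \<open>exp (b * z)\<close> has modulus at most 1 because
    \<open>Re b\<close> is nonpositive, so the remainder needs no smallness of the increment.
    \<open>complex_Taylor\<close> divides by \<open>fact n\<close>, whence the factors 1 and
    1/2.\<close>
  define S where "S = complex_of_real ` {0..}"
  have S: "convex S" "of_real x \<in> S" "of_real y \<in> S"
    using assms by (auto simp: S_def intro!: convex_linear_image linear_of_real)
  have der: "((\<lambda>z. b ^ i * exp (b * z)) has_field_derivative b ^ Suc i * exp (b * z)) (at z within S)"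
    for i z
    by (auto intro!: derivative_eq_intros)
  have bnd: "cmod (b ^ Suc k * exp (b * z)) \<le> cmod b ^ Suc k" if "z \<in> S" for k z
    using that assms by (auto simp: S_def norm_mult norm_power mult_nonpos_nonneg intro!: mult_left_le)
  have dist: "cmod (of_real y - of_real x) = \<bar>y - x\<bar>"
    by (metis norm_of_real of_real_diff)
  show ?th1
    using complex_Taylor[of S 1 "\<lambda>i z. b ^ i * exp (b * z)", OF S(1) der bnd S(2,3)]
    by (simp add: dist algebra_simps power2_eq_square)
  show ?th2
    using complex_Taylor[of S 2 "\<lambda>i z. b ^ i * exp (b * z)", OF S(1) der bnd S(2,3)]
    by (simp add: dist algebra_simps numeral_2_eq_2 numeral_3_eq_3)
qed

text \<open>Later \<open>A\<close> is linear and \<open>B\<close> quadratic in an observation, so a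
  term of order \<open>B^3\<close> would require a sixth moment of the norm. The case split avoids
  it: if \<open>B\<close> is the smaller one, the third-order remainder is at most
  \<open>(2 |A|)^3 / 2 = 4 |A|^3\<close>; otherwise a second-order expansion is enough, with
  \<open>(A + B)^2 \<le> 4 B^2\<close> and the omitted \<open>A^2 / 2\<close> at most
  \<open>B^2\<close>, hence the constant 5.\<close>

lemma cmod_exp_taylor_split_le:
  fixes b :: complex
  assumes "Re b \<le> 0" "0 \<le> x" "0 \<le> y" and y: "y = x + (A + B)"
  shows "cmod (exp (b * of_real y) - exp (b * of_real x) * (1 + b * of_real (A + B) + b\<^sup>2 * of_real (A\<^sup>2) / 2))
    \<le> cmod b ^ 2 * (\<bar>A\<bar> * \<bar>B\<bar> + 5 * B\<^sup>2) + 4 * cmod b ^ 3 * \<bar>A\<bar> ^ 3" (is "cmod (?e - ?E * (?l + ?q)) \<le> _")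
proof -
  have E: "cmod ?E \<le> 1" using assms by (simp add: mult_nonpos_nonneg)
  show ?thesis
  proof (cases "\<bar>B\<bar> \<le> \<bar>A\<bar>")
    case True
    have "\<bar>A + B\<bar> ^ 3 \<le> (2 * \<bar>A\<bar>) ^ 3" using True by (intro power_mono) auto
    then have "cmod b ^ 3 * \<bar>A + B\<bar> ^ 3 \<le> cmod b ^ 3 * (2 * \<bar>A\<bar>) ^ 3"
      by (intro mult_left_mono) auto
    then have cube: "cmod b ^ 3 * \<bar>A + B\<bar> ^ 3 / 2 \<le> 4 * cmod b ^ 3 * \<bar>A\<bar> ^ 3"
      by (simp add: power_mult_distrib)
    have eq: "?e - ?E * (?l + ?q) = (?e - ?E * (?l + b\<^sup>2 * of_real ((A + B)\<^sup>2) / 2))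
        + ?E * b\<^sup>2 * of_real (A * B + B\<^sup>2 / 2)"
      by (simp add: power2_eq_square field_simps)
    have 2: "cmod (?E * b\<^sup>2 * of_real (A * B + B\<^sup>2 / 2)) \<le> 1 * (cmod b)\<^sup>2 * (\<bar>A\<bar> * \<bar>B\<bar> + 5 * B\<^sup>2)"
      unfolding norm_mult norm_power norm_of_real
    proof (intro mult_mono E order_refl)
      have "\<bar>A * B + B\<^sup>2 / 2\<bar> \<le> \<bar>A * B\<bar> + \<bar>B\<^sup>2 / 2\<bar>" by (rule abs_triangle_ineq)
      also have "\<dots> \<le> \<bar>A\<bar> * \<bar>B\<bar> + 5 * B\<^sup>2"
        using zero_le_power2[of B] unfolding abs_mult by linarith
      finally show "\<bar>A * B + B\<^sup>2 / 2\<bar> \<le> \<bar>A\<bar> * \<bar>B\<bar> + 5 * B\<^sup>2" .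
    qed auto
    have 1: "cmod (?e - ?E * (?l + b\<^sup>2 * of_real ((A + B)\<^sup>2) / 2)) \<le> cmod b ^ 3 * \<bar>A + B\<bar> ^ 3 / 2"
      using cmod_exp_taylor_le(2)[OF assms(1-3)] by (simp add: y)
    show ?thesis
      unfolding eq using order_trans[OF norm_triangle_ineq add_mono[OF order_trans[OF 1 cube] 2]]
      by (simp only: mult_1 add.commute)
  next
    case False
    have "\<bar>A + B\<bar>\<^sup>2 \<le> (2 * \<bar>B\<bar>)\<^sup>2" using False by (intro power_mono) auto
    then have sq: "(cmod b)\<^sup>2 * \<bar>A + B\<bar>\<^sup>2 \<le> (cmod b)\<^sup>2 * (4 * B\<^sup>2)"
      by (intro mult_left_mono) (auto simp: power_mult_distrib)
    have eq: "?e - ?E * (?l + ?q) = (?e - ?E * ?l) - ?E * b\<^sup>2 * of_real (A\<^sup>2 / 2)"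
      by (simp add: field_simps)
    have 2: "cmod (?E * b\<^sup>2 * of_real (A\<^sup>2 / 2)) \<le> 1 * (cmod b)\<^sup>2 * B\<^sup>2"
      unfolding norm_mult norm_power norm_of_real
    proof (intro mult_mono E order_refl)
      have "\<bar>A\<bar>\<^sup>2 \<le> \<bar>B\<bar>\<^sup>2" using False by (intro power_mono) auto
      then show "\<bar>A\<^sup>2 / 2\<bar> \<le> B\<^sup>2"
        using zero_le_power2[of A] unfolding power2_abs by linarith
    qed auto
    have 1: "cmod (?e - ?E * ?l) \<le> (cmod b)\<^sup>2 * \<bar>A + B\<bar>\<^sup>2"
      using cmod_exp_taylor_le(1)[OF assms(1-3)] by (simp add: y)
    have "cmod (?e - ?E * (?l + ?q)) \<le> (cmod b)\<^sup>2 * (4 * B\<^sup>2) + 1 * (cmod b)\<^sup>2 * B\<^sup>2"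
      unfolding eq by (rule order_trans[OF norm_triangle_ineq4 add_mono[OF order_trans[OF 1 sq] 2]])
    also have "\<dots> \<le> (cmod b)\<^sup>2 * (\<bar>A\<bar> * \<bar>B\<bar> + 5 * B\<^sup>2) + 4 * cmod b ^ 3 * \<bar>A\<bar> ^ 3"
      by (simp add: distrib_left)
    finally show ?thesis .
  qed
qed

text \<open>\<open>swap_char \<theta> m s x\<close> approximates the characteristic function, at \<open>\<theta>\<close>, of the square of
  the norm of a vector with squared norm \<open>x\<close> to which an independent Gaussian vector with
  covariance \<open>s\<close> times the identity is added.\<close>

definition swap_char :: "real \<Rightarrow> real \<Rightarrow> real \<Rightarrow> real \<Rightarrow> complex" where
  "swap_char \<theta> m s x = exp (\<i> * of_real (\<theta> * (x + m * s)) - of_real (\<theta>\<^sup>2 * (m * s\<^sup>2 + 2 * s * x)))"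

text \<open>First-order Taylor expansion in the time \<open>s\<close>: the bracket is 1 plus
  \<open>d\<close> times the \<open>s\<close>-derivative of the exponent. The second derivative is
  the exponential, of modulus at most 1, times the square of that derivative minus the constant
  \<open>2 * \<theta>\<^sup>2 * m\<close>.\<close>

lemma swap_char_time_step:
  assumes "0 \<le> s" "0 \<le> d" "s + d \<le> 1" "0 \<le> x" "0 \<le> m"
  shows "cmod (swap_char \<theta> m (s + d) x - swap_char \<theta> m s x *
      (1 + of_real d * (\<i> * of_real (\<theta> * m) - of_real (2 * \<theta>\<^sup>2 * m * s) - of_real (2 * \<theta>\<^sup>2 * x))))
    \<le> ((\<bar>\<theta>\<bar> * m + 2 * \<theta>\<^sup>2 * m + 2 * \<theta>\<^sup>2 * x)\<^sup>2 + 2 * \<theta>\<^sup>2 * m) * d\<^sup>2"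
proof -
  define S where "S = complex_of_real ` {0..1}"
  define h where "h z = \<i> * of_real \<theta> * (of_real x + of_real m * z)
      - of_real (\<theta>\<^sup>2) * (of_real m * z\<^sup>2 + 2 * of_real x * z)" for z
  define g where "g z = \<i> * of_real \<theta> * of_real m - of_real (\<theta>\<^sup>2) * (2 * of_real m * z + 2 * of_real x)" for z
  \<comment> \<open>The function \<open>exp (h z)\<close> and its first two derivatives, in the
    indexed form that \<open>complex_Taylor\<close> expects.\<close>
  define f where "f i z = (if i = 0 then 1 else if i = Suc 0 then g z else (g z)\<^sup>2 - 2 * of_real (\<theta>\<^sup>2 * m)) * exp (h z)"
    for i :: nat and z
  have S: "convex S" "of_real s \<in> S" "of_real (s + d) \<in> S"
    using assms unfolding S_def by (auto intro!: convex_linear_image linear_of_real simp del: of_real_add)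
  have dh: "(h has_field_derivative g z) (at z within S)" for z
    unfolding h_def g_def by (auto intro!: derivative_eq_intros simp: algebra_simps)
  have dg: "(g has_field_derivative - 2 * of_real (\<theta>\<^sup>2 * m)) (at z within S)" for z
    unfolding g_def by (auto intro!: derivative_eq_intros simp: algebra_simps)
  have der: "(f i has_field_derivative f (Suc i) z) (at z within S)" if "i \<le> 1" for i z
  proof -
    consider "i = 0" | "i = 1" using \<open>i \<le> 1\<close> by (auto simp: le_Suc_eq)
    then show ?thesis
    proof cases
      case 1
      then show ?thesis unfolding f_def
        by (auto intro!: derivative_eq_intros dh)
    next
      case 2
      then show ?thesis unfolding f_def
        by (auto intro!: derivative_eq_intros dh dg simp: power2_eq_square algebra_simps)
    qed
  qed
  have bnd: "cmod (f (Suc 1) z) \<le> (\<bar>\<theta>\<bar> * m + 2 * \<theta>\<^sup>2 * m + 2 * \<theta>\<^sup>2 * x)\<^sup>2 + 2 * \<theta>\<^sup>2 * m"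
    if z: "z \<in> S" for z
  proof -
    obtain r where r: "z = of_real r" "0 \<le> r" "r \<le> 1" using z by (auto simp: S_def)
    have "h z = of_real (- (\<theta>\<^sup>2 * (m * r\<^sup>2 + 2 * x * r))) + \<i> * of_real (\<theta> * (x + m * r))"
      by (simp add: h_def r algebra_simps)
    then have "cmod (exp (h z)) \<le> 1"
      using assms r by simp
    have "cmod (g z) \<le> \<bar>\<theta>\<bar> * m + 2 * \<theta>\<^sup>2 * m + 2 * \<theta>\<^sup>2 * x"
    proof -
      have "g z = \<i> * of_real (\<theta> * m) - of_real (2 * \<theta>\<^sup>2 * m * r) - of_real (2 * \<theta>\<^sup>2 * x)"
        by (simp add: g_def r algebra_simps)
      also have "cmod \<dots> \<le> cmod (\<i> * of_real (\<theta> * m)) + cmod (of_real (2 * \<theta>\<^sup>2 * m * r)) + cmod (of_real (2 * \<theta>\<^sup>2 * x))"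
        by (intro order_trans[OF norm_triangle_ineq4] add_right_mono norm_triangle_ineq4)
      also have "\<dots> = \<bar>\<theta>\<bar> * m + 2 * \<theta>\<^sup>2 * m * r + 2 * \<theta>\<^sup>2 * x"
        using assms r by (simp only: norm_mult norm_of_real norm_ii abs_mult) simp
      also have "2 * \<theta>\<^sup>2 * m * r \<le> 2 * \<theta>\<^sup>2 * m"
        using assms r by (intro mult_left_le) auto
      finally show ?thesis by simp
    qed
    then have "(cmod (g z))\<^sup>2 \<le> (\<bar>\<theta>\<bar> * m + 2 * \<theta>\<^sup>2 * m + 2 * \<theta>\<^sup>2 * x)\<^sup>2" by (intro power_mono) auto
    then have "cmod ((g z)\<^sup>2) \<le> (\<bar>\<theta>\<bar> * m + 2 * \<theta>\<^sup>2 * m + 2 * \<theta>\<^sup>2 * x)\<^sup>2"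
      by (simp only: norm_power)
    moreover have "cmod (2 * of_real (\<theta>\<^sup>2 * m)) \<le> 2 * \<theta>\<^sup>2 * m"
      using assms by (simp only: norm_mult norm_of_real) simp
    ultimately have "cmod ((g z)\<^sup>2 - 2 * of_real (\<theta>\<^sup>2 * m)) \<le> (\<bar>\<theta>\<bar> * m + 2 * \<theta>\<^sup>2 * m + 2 * \<theta>\<^sup>2 * x)\<^sup>2 + 2 * \<theta>\<^sup>2 * m"
      by (rule order_trans[OF norm_triangle_ineq4 add_mono])
    with \<open>cmod (exp (h z)) \<le> 1\<close> have "cmod ((g z)\<^sup>2 - 2 * of_real (\<theta>\<^sup>2 * m)) * cmod (exp (h z))
        \<le> ((\<bar>\<theta>\<bar> * m + 2 * \<theta>\<^sup>2 * m + 2 * \<theta>\<^sup>2 * x)\<^sup>2 + 2 * \<theta>\<^sup>2 * m) * 1"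
      using assms by (intro mult_mono) auto
    then show ?thesis by (simp add: f_def norm_mult)
  qed
  have f0: "f 0 (of_real r) = swap_char \<theta> m r x" for r
    by (simp add: f_def h_def swap_char_def algebra_simps)
  have f1: "f 1 (of_real s) = (\<i> * of_real (\<theta> * m) - of_real (2 * \<theta>\<^sup>2 * m * s) - of_real (2 * \<theta>\<^sup>2 * x)) * swap_char \<theta> m s x"
    unfolding f0[symmetric] by (simp add: f_def g_def algebra_simps)
  have "cmod (f 0 (of_real (s + d)) - (\<Sum>i\<le>1. f i (of_real s) * (of_real (s + d) - of_real s) ^ i / fact i))
      \<le> ((\<bar>\<theta>\<bar> * m + 2 * \<theta>\<^sup>2 * m + 2 * \<theta>\<^sup>2 * x)\<^sup>2 + 2 * \<theta>\<^sup>2 * m) * cmod (of_real (s + d) - of_real s) ^ Suc 1 / fact 1"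
    by (rule complex_Taylor[OF S(1) der bnd S(2,3)]) auto
  moreover have "(\<Sum>i\<le>1. f i (of_real s) * (of_real (s + d) - of_real s) ^ i / fact i)
      = swap_char \<theta> m s x * (1 + of_real d * (\<i> * of_real (\<theta> * m) - of_real (2 * \<theta>\<^sup>2 * m * s) - of_real (2 * \<theta>\<^sup>2 * x)))"
    unfolding One_nat_def sum.atMost_Suc atMost_0 by (simp add: f0 f1[unfolded One_nat_def] algebra_simps)
  moreover have "cmod (of_real (s + d) - of_real s) = d" using assms by (simp flip: of_real_diff)
  ultimately show ?thesis by (simp only: f0) (simp add: power2_eq_square)
qed

declare One_nat_def [simp del]

section \<open>Integration over product samples\<close>

lemma sum_fun_upd_Suc:
  fixes g :: "'z \<Rightarrow> 'b :: comm_monoid_add"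
  shows "(\<Sum>j=1..Suc k. g ((x(Suc k := y)) j)) = (\<Sum>j=1..k. g (x j)) + g y"
proof -
  have "(\<Sum>j=1..k. g ((x(Suc k := y)) j)) = (\<Sum>j=1..k. g (x j))"
    by (intro sum.cong) auto
  then show ?thesis by (simp add: sum.nat_ivl_Suc' add.commute)
qed

lemma norm_integral_le_integral:
  fixes f :: "'z \<Rightarrow> 'b :: {banach, second_countable_topology}"
  assumes "integrable N f" "integrable N g" "\<And>x. norm (f x) \<le> g x"
  shows "norm (\<integral>x. f x \<partial>N) \<le> (\<integral>x. g x \<partial>N)"
  by (rule order_trans[OF integral_norm_bound integral_mono])
    (use assms in \<open>auto intro: Bochner_Integration.integrable_norm\<close>)

lemma ip_add_add: "ip m (\<lambda>i. s i + w i) (\<lambda>i. s i + w i) = ip m s s + (2 * ip m s w + ip m w w)"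
  by (simp add: ip_def algebra_simps sum.distrib sum_distrib_left)

context prob_space
begin

lemma integrable_PiM_component:
  fixes f :: "'a \<Rightarrow> 'b :: {banach, second_countable_topology}"
  assumes "integrable M f" "j \<in> I"
  shows "integrable (PiM I (\<lambda>_. M)) (\<lambda>x. f (x j))"
proof (rule integrable_distr[where T = "\<lambda>x. x j" and M' = M and f = f])
  show "(\<lambda>x. x j) \<in> measurable (PiM I (\<lambda>_. M)) M"
    using assms by simp
  show "integrable (distr (PiM I (\<lambda>_. M)) M (\<lambda>x. x j)) f"
    using assms prob_space_axioms by (subst distr_PiM_component[of I "\<lambda>_. M" j]) simp_all
qed

lemma borel_measurable_PiM_component:
  assumes "f \<in> borel_measurable M" "j \<in> I"
  shows "(\<lambda>x. f (x j)) \<in> borel_measurable (PiM I (\<lambda>_. M))"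
  using assms by (intro measurable_compose[OF measurable_component_singleton])

text \<open>Fubini with the last observation split off; the inner integral plays the role of the
  conditional expectation given the first \<open>k\<close> observations.\<close>

lemma integral_PiM_Suc:
  fixes f :: "(nat \<Rightarrow> 'a) \<Rightarrow> 'b :: {banach, second_countable_topology}"
  assumes "integrable (PiM {1..Suc k} (\<lambda>_. M)) f"
  shows "(\<integral>x. f x \<partial>PiM {1..Suc k} (\<lambda>_. M)) = (\<integral>x. \<integral>y. f (x(Suc k := y)) \<partial>M \<partial>PiM {1..k} (\<lambda>_. M))"
proof -
  interpret P: product_sigma_finite "\<lambda>_::nat. M" by standard
  have eq: "insert (Suc k) {1..k} = {1..Suc k}" by auto
  show ?thesis
    by (rule P.product_integral_insert[of "{1..k}" "Suc k" f, unfolded eq, OF _ _ assms]) auto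
qed

lemma nn_integral_PiM_Suc:
  assumes "f \<in> borel_measurable (PiM {1..Suc k} (\<lambda>_. M))"
  shows "(\<integral>\<^sup>+x. f x \<partial>PiM {1..Suc k} (\<lambda>_. M)) = (\<integral>\<^sup>+x. \<integral>\<^sup>+y. f (x(Suc k := y)) \<partial>M \<partial>PiM {1..k} (\<lambda>_. M))"
proof -
  interpret P: product_sigma_finite "\<lambda>_::nat. M" by standard
  have eq: "insert (Suc k) {1..k} = {1..Suc k}" by auto
  show ?thesis
    by (rule P.product_nn_integral_insert[of "{1..k}" "Suc k" f, unfolded eq, OF _ _ assms]) auto
qed

text \<open>Induction on the number of observations: the cross term with the new observation
  vanishes because \<open>u\<close> has mean zero. Integrability comes separately, from dominating
  the squared sum by \<open>k\<close> times the sum of squares.\<close>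

lemma
  fixes u :: "'a \<Rightarrow> real"
  assumes u: "u \<in> borel_measurable M" "integrable M (\<lambda>z. (u z)\<^sup>2)" "expectation u = 0"
  shows integrable_PiM_sum_square: "integrable (PiM {1..k} (\<lambda>_. M)) (\<lambda>x. (\<Sum>j=1..k. u (x j))\<^sup>2)"
    and integral_PiM_sum_square:
      "(\<integral>x. (\<Sum>j=1..k. u (x j))\<^sup>2 \<partial>PiM {1..k} (\<lambda>_. M)) = real k * expectation (\<lambda>z. (u z)\<^sup>2)"
proof -
  show int: "integrable (PiM {1..k} (\<lambda>_. M)) (\<lambda>x. (\<Sum>j=1..k. u (x j))\<^sup>2)" for k :: nat
  proof (rule Bochner_Integration.integrable_bound)
    show "integrable (PiM {1..k} (\<lambda>_. M)) (\<lambda>x. real k * (\<Sum>j=1..k. (u (x j))\<^sup>2))"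
      by (intro Bochner_Integration.integrable_sum integrable_mult_right integrable_PiM_component u)
    show "(\<lambda>x. (\<Sum>j=1..k. u (x j))\<^sup>2) \<in> borel_measurable (PiM {1..k} (\<lambda>_. M))"
      by (intro borel_measurable_power borel_measurable_sum borel_measurable_PiM_component u)
    have "(\<Sum>j=1..k. u (x j))\<^sup>2 \<le> real k * (\<Sum>j=1..k. (u (x j))\<^sup>2)" for x
      using Cauchy_Schwarz_ineq_sum[of "\<lambda>_. 1" "\<lambda>j. u (x j)" "{1..k}"] by simp
    then show "AE x in PiM {1..k} (\<lambda>_. M). norm ((\<Sum>j=1..k. u (x j))\<^sup>2) \<le> norm (real k * (\<Sum>j=1..k. (u (x j))\<^sup>2))"
      by (intro AE_I2) (simp add: abs_mult sum_nonneg)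
  qed
  have int_u: "integrable M u"
    using square_integrable_imp_integrable[OF u(1,2)] .
  show "(\<integral>x. (\<Sum>j=1..k. u (x j))\<^sup>2 \<partial>PiM {1..k} (\<lambda>_. M)) = real k * expectation (\<lambda>z. (u z)\<^sup>2)"
  proof (induction k)
    case (Suc k)
    interpret Pk: prob_space "PiM {1..k} (\<lambda>_. M)" by (intro prob_space_PiM prob_space_axioms)
    have sq: "expectation (\<lambda>y. (s + u y)\<^sup>2) = s\<^sup>2 + expectation (\<lambda>z. (u z)\<^sup>2)" for s
      using u int_u by (simp add: power2_sum prob_space)
    then show ?case
      unfolding integral_PiM_Suc[OF int] sum_fun_upd_Suc sq using int[of k] Suc
      by (simp add: Pk.prob_space distrib_right)
  qed simp
qed

end

text \<open>The whitened constraint functions at one fixed sample size. Both \<open>m\<close> and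
  \<open>v\<close> will change with the sample size while \<open>C\<close> stays the same, so all
  bounds below show their dependence on \<open>m\<close> and \<open>C\<close>.\<close>

locale orthonormal_features = prob_space Q for Q :: "'z measure" +
  fixes m :: nat and v :: "'z \<Rightarrow> nat \<Rightarrow> real" and C :: real
  assumes measurable_v: "i < m \<Longrightarrow> (\<lambda>z. v z i) \<in> borel_measurable Q"
    and integrable_norm4: "integrable Q (\<lambda>z. (ip m (v z) (v z))\<^sup>2)"
    and mean_zero: "i < m \<Longrightarrow> (\<integral>z. v z i \<partial>Q) = 0"
    and orthonormal: "i < m \<Longrightarrow> k < m \<Longrightarrow> (\<integral>z. v z i * v z k \<partial>Q) = (if i = k then 1 else 0)"
    and norm4_le: "(\<integral>z. (ip m (v z) (v z))\<^sup>2 \<partial>Q) \<le> C * (real m)\<^sup>2"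
    and m_pos: "1 \<le> m"
begin

lemma C_nonneg: "0 \<le> C"
proof -
  have "0 \<le> (\<integral>z. (ip m (v z) (v z))\<^sup>2 \<partial>Q)" by simp
  also note norm4_le
  finally show ?thesis using m_pos by (simp add: zero_le_mult_iff)
qed

lemma measurable_norm [measurable]: "(\<lambda>z. ip m (v z) (v z)) \<in> borel_measurable Q"
  unfolding ip_def by (intro borel_measurable_sum borel_measurable_times measurable_v) auto

lemma measurable_ip [measurable]: "(\<lambda>z. ip m s (v z)) \<in> borel_measurable Q"
  unfolding ip_def by (intro borel_measurable_sum borel_measurable_times measurable_v borel_measurable_const) auto

lemma integrable_norm: "integrable Q (\<lambda>z. ip m (v z) (v z))"
  by (rule square_integrable_imp_integrable[OF measurable_norm integrable_norm4])

lemma abs_prod_le: "i < m \<Longrightarrow> k < m \<Longrightarrow> \<bar>v z i * v z k\<bar> \<le> ip m (v z) (v z)"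
proof -
  assume ik: "i < m" "k < m"
  have sq: "(v z i)\<^sup>2 \<le> ip m (v z) (v z)" if "i < m" for i
    unfolding ip_def power2_eq_square using that by (intro member_le_sum) auto
  have "2 * \<bar>v z i * v z k\<bar> \<le> (v z i)\<^sup>2 + (v z k)\<^sup>2"
    using sum_squares_bound[of "\<bar>v z i\<bar>" "\<bar>v z k\<bar>"] by (simp add: abs_mult)
  with sq ik show ?thesis by (smt (verit))
qed

lemma integrable_prod: "i < m \<Longrightarrow> k < m \<Longrightarrow> integrable Q (\<lambda>z. v z i * v z k)"
  by (rule Bochner_Integration.integrable_bound[OF integrable_norm])
     (auto intro!: borel_measurable_times measurable_v AE_I2 simp: abs_prod_le)

lemma integrable_square: "i < m \<Longrightarrow> integrable Q (\<lambda>z. (v z i)\<^sup>2)"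
  using integrable_prod[of i i] by (simp add: power2_eq_square)

lemma integral_square: "i < m \<Longrightarrow> (\<integral>z. (v z i)\<^sup>2 \<partial>Q) = 1"
  using orthonormal[of i i] by (simp add: power2_eq_square)

lemma integrable_v: "i < m \<Longrightarrow> integrable Q (\<lambda>z. v z i)"
  using square_integrable_imp_integrable[OF measurable_v integrable_square] .

lemma integrable_ip: "integrable Q (\<lambda>z. ip m s (v z))"
  unfolding ip_def by (intro Bochner_Integration.integrable_sum integrable_mult_right integrable_v) auto

lemma integral_ip: "(\<integral>z. ip m s (v z) \<partial>Q) = 0"
  unfolding ip_def using integrable_v mean_zero
  by (subst Bochner_Integration.integral_sum) auto

lemma ip_square: "(ip m s (v z))\<^sup>2 = (\<Sum>i<m. \<Sum>k<m. s i * s k * (v z i * v z k))"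
  by (simp add: ip_def power2_eq_square sum_product mult_ac)

lemma integrable_ip_square: "integrable Q (\<lambda>z. (ip m s (v z))\<^sup>2)"
  unfolding ip_square
  by (intro Bochner_Integration.integrable_sum integrable_mult_right integrable_prod) auto

lemma integral_ip_square: "(\<integral>z. (ip m s (v z))\<^sup>2 \<partial>Q) = ip m s s"
proof -
  have "(\<integral>z. (ip m s (v z))\<^sup>2 \<partial>Q) = (\<Sum>i<m. \<integral>z. (\<Sum>k<m. s i * s k * (v z i * v z k)) \<partial>Q)"
    unfolding ip_square by (intro Bochner_Integration.integral_sum Bochner_Integration.integrable_sum
        integrable_mult_right integrable_prod) auto
  also have "\<dots> = (\<Sum>i<m. \<Sum>k<m. \<integral>z. s i * s k * (v z i * v z k) \<partial>Q)"
    by (intro sum.cong refl Bochner_Integration.integral_sum integrable_mult_right integrable_prod) auto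
  also have "\<dots> = (\<Sum>i<m. \<Sum>k<m. s i * s k * (if i = k then 1 else 0))"
    by (intro sum.cong refl) (simp add: orthonormal)
  also have "\<dots> = ip m s s" by (simp add: ip_def if_distrib cong: if_cong)
  finally show ?thesis .
qed

lemma integral_norm: "(\<integral>z. ip m (v z) (v z) \<partial>Q) = m"
  unfolding ip_def using integrable_prod orthonormal
  by (subst Bochner_Integration.integral_sum) auto

section \<open>Second and fourth moments of the partial sums\<close>

abbreviation sample :: "nat \<Rightarrow> (nat \<Rightarrow> 'z) measure" where
  "sample k \<equiv> PiM {1..k} (\<lambda>_. Q)"

definition psum :: "nat \<Rightarrow> (nat \<Rightarrow> 'z) \<Rightarrow> nat \<Rightarrow> real" where
  "psum k x i = (\<Sum>j=1..k. v (x j) i)"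

abbreviation psum_norm :: "nat \<Rightarrow> (nat \<Rightarrow> 'z) \<Rightarrow> real" where
  "psum_norm k x \<equiv> ip m (psum k x) (psum k x)"

lemma prob_space_sample: "prob_space (sample k)"
  by (intro prob_space_PiM prob_space_axioms)

lemma psum_upd: "psum (Suc k) (x(Suc k := y)) = (\<lambda>i. psum k x i + v y i)"
  unfolding psum_def by (rule ext) (rule sum_fun_upd_Suc)

lemma measurable_psum: "i < m \<Longrightarrow> (\<lambda>x. psum k x i) \<in> borel_measurable (sample k)"
  unfolding psum_def by (intro borel_measurable_sum borel_measurable_PiM_component measurable_v)

lemma measurable_psum_norm [measurable]: "psum_norm k \<in> borel_measurable (sample k)"
  unfolding ip_def by (intro borel_measurable_sum borel_measurable_times measurable_psum) auto

lemma integrable_psum_norm: "integrable (sample k) (psum_norm k)"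
  unfolding ip_def power2_eq_square[symmetric] psum_def
  by (intro Bochner_Integration.integrable_sum integrable_PiM_sum_square
      measurable_v integrable_square mean_zero) auto

lemma integral_psum_norm: "(\<integral>x. psum_norm k x \<partial>sample k) = real k * real m"
proof -
  have "(\<integral>x. psum_norm k x \<partial>sample k) = (\<Sum>i<m. \<integral>x. (\<Sum>j=1..k. v (x j) i)\<^sup>2 \<partial>sample k)"
    unfolding ip_def power2_eq_square[symmetric] psum_def
    by (intro Bochner_Integration.integral_sum integrable_PiM_sum_square
      measurable_v integrable_square mean_zero) auto
  also have "\<dots> = (\<Sum>i<m. real k * 1)"
  proof (intro sum.cong refl)
    fix i assume "i \<in> {..<m}"
    then have "i < m" by simp
    then show "(\<integral>x. (\<Sum>j=1..k. v (x j) i)\<^sup>2 \<partial>sample k) = real k * 1"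
      using integral_PiM_sum_square[OF measurable_v[OF \<open>i < m\<close>] integrable_square[OF \<open>i < m\<close>] mean_zero[OF \<open>i < m\<close>], of k]
      by (simp add: integral_square)
  qed
  finally show ?thesis by simp
qed

text \<open>With \<open>X = |s|^2\<close>, \<open>a = (s, v)\<close> and \<open>h = |v|^2\<close>,
  expand \<open>(X + 2 a + h)^2\<close> and use \<open>4 a h \<le> 4 a^2 + h^2\<close> and
  \<open>a^2 \<le> X h\<close>; this produces the coefficients 10 and 2. The term
  \<open>4 X a\<close> must be kept rather than estimated, since it integrates to zero.\<close>

lemma norm4_step:
  "(\<integral>\<^sup>+y. ennreal ((ip m (\<lambda>i. s i + v y i) (\<lambda>i. s i + v y i))\<^sup>2) \<partial>Q)
    \<le> ennreal ((ip m s s)\<^sup>2 + 10 * real m * ip m s s + 2 * C * (real m)\<^sup>2)"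
proof -
  define X where "X = ip m s s"
  define h where "h y = ip m (v y) (v y)" for y
  define g where "g y = X\<^sup>2 + 4 * X * ip m s (v y) + 10 * X * h y + 2 * (h y)\<^sup>2" for y
  have le: "(ip m (\<lambda>i. s i + v y i) (\<lambda>i. s i + v y i))\<^sup>2 \<le> g y" for y
  proof -
    define a where "a = ip m s (v y)"
    have "a\<^sup>2 \<le> X * h y" unfolding a_def X_def h_def by (rule ip_cauchy_schwarz)
    moreover have "0 \<le> (2 * a - h y)\<^sup>2" by simp
    ultimately have "(X + (2 * a + h y))\<^sup>2 \<le> X\<^sup>2 + 4 * X * a + 10 * X * h y + 2 * (h y)\<^sup>2"
      by (simp add: power2_eq_square algebra_simps)
    then show ?thesis unfolding ip_add_add g_def a_def X_def h_def .
  qed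
  have int: "integrable Q g"
    unfolding g_def h_def
    by (intro Bochner_Integration.integrable_add integrable_mult_right integrable_ip integrable_norm
        integrable_norm4) auto
  have "(\<integral>\<^sup>+y. ennreal ((ip m (\<lambda>i. s i + v y i) (\<lambda>i. s i + v y i))\<^sup>2) \<partial>Q) \<le> (\<integral>\<^sup>+y. ennreal (g y) \<partial>Q)"
    by (intro nn_integral_mono ennreal_leI le)
  also have "\<dots> = ennreal (\<integral>y. g y \<partial>Q)"
    using int by (intro nn_integral_eq_integral AE_I2 order_trans[OF zero_le_power2 le])
  also have "(\<integral>y. g y \<partial>Q) = X\<^sup>2 + 10 * X * m + 2 * (\<integral>z. (ip m (v z) (v z))\<^sup>2 \<partial>Q)"
    unfolding g_def h_def using integrable_ip integrable_norm integrable_norm4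
    by (simp add: integral_ip integral_norm prob_space)
  also have "\<dots> \<le> X\<^sup>2 + 10 * m * X + 2 * C * (real m)\<^sup>2" using norm4_le by (simp add: mult_ac)
  finally show ?thesis unfolding X_def using ennreal_leI by fastforce
qed

text \<open>The one-step bound is a recursion whose increment is
  \<open>10 * m * (k * m) + 2 * C * m\<^sup>2\<close>, so the fourth moment grows only quadratically
  in \<open>k\<close>. Working with nonnegative integrals makes finiteness a result of the induction
  instead of a prerequisite.\<close>

lemma nn_integral_psum_norm_square:
  "(\<integral>\<^sup>+x. ennreal ((psum_norm k x)\<^sup>2) \<partial>sample k) \<le> ennreal (real k * (10 * real k + 2 * C) * (real m)\<^sup>2)"
proof (induction k)
  case 0
  then show ?case by (simp add: psum_def ip_def)
next
  case (Suc k)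
  interpret Pk: prob_space "sample k" by (rule prob_space_sample)
  have "(\<integral>\<^sup>+x. ennreal ((psum_norm (Suc k) x)\<^sup>2) \<partial>sample (Suc k))
      = (\<integral>\<^sup>+x. \<integral>\<^sup>+y. ennreal ((ip m (\<lambda>i. psum k x i + v y i) (\<lambda>i. psum k x i + v y i))\<^sup>2) \<partial>Q \<partial>sample k)"
    by (subst nn_integral_PiM_Suc) (simp_all only: psum_upd, measurable)
  also have "\<dots> \<le> (\<integral>\<^sup>+x. ennreal ((psum_norm k x)\<^sup>2 + 10 * real m * psum_norm k x + 2 * C * (real m)\<^sup>2) \<partial>sample k)"
    by (intro nn_integral_mono norm4_step)
  also have "\<dots> = (\<integral>\<^sup>+x. ennreal ((psum_norm k x)\<^sup>2) + ennreal (10 * real m * psum_norm k x + 2 * C * (real m)\<^sup>2) \<partial>sample k)"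
    using C_nonneg by (intro nn_integral_cong) (simp flip: ennreal_plus add: add.assoc)
  also have "\<dots> = (\<integral>\<^sup>+x. ennreal ((psum_norm k x)\<^sup>2) \<partial>sample k)
      + (\<integral>\<^sup>+x. ennreal (10 * real m * psum_norm k x + 2 * C * (real m)\<^sup>2) \<partial>sample k)"
    by (intro nn_integral_add) measurable
  also have "(\<integral>\<^sup>+x. ennreal (10 * real m * psum_norm k x + 2 * C * (real m)\<^sup>2) \<partial>sample k)
      = ennreal (\<integral>x. 10 * real m * psum_norm k x + 2 * C * (real m)\<^sup>2 \<partial>sample k)"
    using C_nonneg integrable_psum_norm
    by (intro nn_integral_eq_integral AE_I2 Bochner_Integration.integrable_add integrable_mult_right) auto
  also have "(\<integral>x. 10 * real m * psum_norm k x + 2 * C * (real m)\<^sup>2 \<partial>sample k)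
      = 10 * real m * (real k * real m) + 2 * C * (real m)\<^sup>2"
    using integrable_psum_norm[of k] by (simp add: integral_psum_norm Pk.prob_space)
  also have "(\<integral>\<^sup>+x. ennreal ((psum_norm k x)\<^sup>2) \<partial>sample k) + ennreal (10 * real m * (real k * real m) + 2 * C * (real m)\<^sup>2)
      \<le> ennreal (real k * (10 * real k + 2 * C) * (real m)\<^sup>2) + ennreal (10 * real m * (real k * real m) + 2 * C * (real m)\<^sup>2)"
    using Suc by (rule add_right_mono)
  also have "\<dots> = ennreal (real k * (10 * real k + 2 * C) * (real m)\<^sup>2 + (10 * real m * (real k * real m) + 2 * C * (real m)\<^sup>2))"
    using C_nonneg by (intro ennreal_plus[symmetric]) auto
  also have "\<dots> \<le> ennreal (real (Suc k) * (10 * real (Suc k) + 2 * C) * (real m)\<^sup>2)"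
  proof (rule ennreal_leI)
    have "real (Suc k) * (10 * real (Suc k) + 2 * C) * (real m)\<^sup>2
        - (real k * (10 * real k + 2 * C) * (real m)\<^sup>2 + (10 * real m * (real k * real m) + 2 * C * (real m)\<^sup>2))
        = (10 * real k + 10) * (real m)\<^sup>2"
      by (simp add: algebra_simps power2_eq_square)
    moreover have "0 \<le> (10 * real k + 10) * (real m)\<^sup>2" by simp
    ultimately show "real k * (10 * real k + 2 * C) * (real m)\<^sup>2 + (10 * real m * (real k * real m) + 2 * C * (real m)\<^sup>2)
        \<le> real (Suc k) * (10 * real (Suc k) + 2 * C) * (real m)\<^sup>2" by linarith
  qed
  finally show ?case by simp
qed

lemma integrable_psum_norm_square: "integrable (sample k) (\<lambda>x. (psum_norm k x)\<^sup>2)"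
proof (rule integrableI_bounded)
  have "(\<integral>\<^sup>+x. ennreal (norm ((psum_norm k x)\<^sup>2)) \<partial>sample k) \<le> ennreal (real k * (10 * real k + 2 * C) * (real m)\<^sup>2)"
    using nn_integral_psum_norm_square[of k] by simp
  also have "\<dots> < \<infinity>" by simp
  finally show "(\<integral>\<^sup>+x. ennreal (norm ((psum_norm k x)\<^sup>2)) \<partial>sample k) < \<infinity>" .
qed measurable

lemma integral_psum_norm_square:
  assumes "k \<le> n"
  shows "(\<integral>x. (psum_norm k x)\<^sup>2 \<partial>sample k) \<le> (10 + 2 * C) * (real n)\<^sup>2 * (real m)\<^sup>2"
proof -
  have "ennreal (\<integral>x. (psum_norm k x)\<^sup>2 \<partial>sample k) \<le> ennreal (real k * (10 * real k + 2 * C) * (real m)\<^sup>2)"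
    using nn_integral_psum_norm_square[of k] integrable_psum_norm_square[of k]
    by (simp add: nn_integral_eq_integral)
  then have "(\<integral>x. (psum_norm k x)\<^sup>2 \<partial>sample k) \<le> real k * (10 * real k + 2 * C) * (real m)\<^sup>2"
    using C_nonneg by (subst (asm) ennreal_le_iff) auto
  also have "\<dots> \<le> (10 + 2 * C) * (real n)\<^sup>2 * (real m)\<^sup>2"
  proof (intro mult_right_mono)
    have "real k * (10 * real k + 2 * C) \<le> real n * (10 * real n + 2 * C * real n)"
    proof (cases "n = 0")
      case False
      then have "2 * C * 1 \<le> 2 * C * real n" using C_nonneg by (intro mult_left_mono) auto
      then have "10 * real k + 2 * C \<le> 10 * real n + 2 * C * real n" using assms by simp
      then show ?thesis using assms C_nonneg by (intro mult_mono) auto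
    qed (use assms in simp)
    then show "real k * (10 * real k + 2 * C) \<le> (10 + 2 * C) * (real n)\<^sup>2"
      by (simp add: power2_eq_square algebra_simps)
  qed simp
  finally show ?thesis .
qed

end

text \<open>As a function of \<open>x\<close> this is a pure exponential whose rate has real part
  \<open>- 2 * \<theta>\<^sup>2 * t\<close>, nonpositive for nonnegative \<open>t\<close>; the
  Taylor bounds for exponentials thereby become applicable.\<close>

lemma swap_char_factor:
  "swap_char \<theta> m t x = exp (of_real (- (\<theta>\<^sup>2 * m * t\<^sup>2)) + \<i> * of_real (\<theta> * m * t))
     * exp ((\<i> * of_real \<theta> - of_real (2 * \<theta>\<^sup>2 * t)) * of_real x)"
  unfolding swap_char_def exp_add[symmetric] by (simp add: algebra_simps)

lemma norm_swap_char_le: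
  assumes "0 \<le> t" "0 \<le> x" "0 \<le> m"
  shows "cmod (swap_char \<theta> m t x) \<le> 1"
  using assms by (simp add: swap_char_def)

lemma measurable_swap_char [measurable]:
  assumes [measurable]: "f \<in> borel_measurable N"
  shows "(\<lambda>x. swap_char \<theta> m t (f x)) \<in> borel_measurable N"
  unfolding swap_char_def by measurable

section \<open>Exchanging one observation for a Gaussian increment\<close>

context orthonormal_features
begin

text \<open>The partial sum is frozen at \<open>s\<close>. Three errors add up: the Taylor expansion
  in space, the residual of the approximate heat equation, and the Taylor expansion in time. The
  bound is a quadratic polynomial in \<open>R = |s|^2\<close> because two moments of
  \<open>R\<close> are available for the subsequent averaging; \<open>p\<close> and \<open>q\<close>
  are free AM-GM weights, fixed only then.\<close>

lemma swap_step_conditional: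
  fixes s :: "nat \<Rightarrow> real" and \<theta> t N p q :: real
  assumes \<theta>: "\<bar>\<theta>\<bar> \<le> 1" and N: "1 \<le> N" and t: "0 \<le> t" "t + 1 / N \<le> 1" and pq: "0 < p" "0 < q"
  defines "R \<equiv> ip m s s"
  shows "cmod ((\<integral>y. swap_char \<theta> m t (ip m (\<lambda>i. s i + v y i) (\<lambda>i. s i + v y i) / N) \<partial>Q)
      - swap_char \<theta> m (t + 1 / N) (R / N))
    \<le> (9 * \<theta>\<^sup>2 * (C * (real m)\<^sup>2 / p + 5 * C * (real m)\<^sup>2) / N\<^sup>2 + 20 * \<theta>\<^sup>2 * (real m)\<^sup>2 / N\<^sup>2)
      + (9 * \<theta>\<^sup>2 * p / N\<^sup>2 + 432 * \<bar>\<theta>\<bar> ^ 3 * q / N ^ 3 + 16 * \<bar>\<theta>\<bar> ^ 3 / N\<^sup>2) * R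
      + (432 * \<bar>\<theta>\<bar> ^ 3 * C * (real m)\<^sup>2 / (q * N ^ 3) + 8 * \<theta>\<^sup>2 / N ^ 4) * R\<^sup>2"
proof -
  define b where "b = \<i> * of_real \<theta> - of_real (2 * \<theta>\<^sup>2 * t)"
  define X where "X = R / N"
  define A where "A y = 2 * ip m s (v y) / N" for y
  define B where "B y = ip m (v y) (v y) / N" for y
  define G where "G y = swap_char \<theta> m t (ip m (\<lambda>i. s i + v y i) (\<lambda>i. s i + v y i) / N)" for y
  \<comment> \<open>The increment of the argument is \<open>A y + B y\<close>, where
    \<open>A\<close> has mean zero, \<open>B\<close> has mean \<open>m / N\<close> and
    \<open>A\<^sup>2\<close> has mean \<open>4 * X / N\<close>; only these three moments enter the
    integral of \<open>F\<close>.\<close>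
  define F where "F y = swap_char \<theta> m t X * (1 + b * of_real (A y + B y) + b\<^sup>2 * of_real ((A y)\<^sup>2) / 2)" for y
  have N0: "0 < N" using N by simp
  have R0: "0 \<le> R" and X0: "0 \<le> X" using N by (auto simp: R_def X_def)
  have t1: "t \<le> 1" using t N0 by (smt (verit) divide_nonneg_pos)
  have \<theta>2: "\<theta>\<^sup>2 \<le> \<bar>\<theta>\<bar>"
  proof -
    have "\<bar>\<theta>\<bar> * \<bar>\<theta>\<bar> \<le> \<bar>\<theta>\<bar> * 1" using \<theta> by (intro mult_left_mono) auto
    then show ?thesis by (simp add: power2_eq_square)
  qed
  have b_le: "cmod b \<le> 3 * \<bar>\<theta>\<bar>"
  proof -
    have "cmod b \<le> cmod (\<i> * of_real \<theta>) + cmod (of_real (2 * \<theta>\<^sup>2 * t))"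
      unfolding b_def by (rule norm_triangle_ineq4)
    also have "\<dots> = \<bar>\<theta>\<bar> + 2 * (\<theta>\<^sup>2 * t)" using t by (simp only: norm_mult norm_of_real norm_ii abs_mult) simp
    also have "\<theta>\<^sup>2 * t \<le> \<theta>\<^sup>2 * 1" using t1 by (intro mult_left_mono) auto
    finally show ?thesis using \<theta>2 by simp
  qed
  have b2: "(cmod b)\<^sup>2 \<le> 9 * \<theta>\<^sup>2" and b3: "cmod b ^ 3 \<le> 27 * \<bar>\<theta>\<bar> ^ 3"
    using power_mono[OF b_le norm_ge_zero, of 2] power_mono[OF b_le norm_ge_zero, of 3]
    by (simp_all add: power_mult_distrib)
  \<comment> \<open>An integrable majorant of the remainder:
    \<open>2 |i| h \<le> p i^2 + h^2 / p\<close> for the mixed term, and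
    \<open>2 |i|^3 \<le> q i^2 + i^4 / q\<close> with \<open>i^2 \<le> R h\<close> for the cubic
    one. The factors come from \<open>|b| \<le> 3 |\<theta>|\<close>, and 108 is 4 * 27.\<close>
  define H where "H y = 9 * \<theta>\<^sup>2 * ((p * (ip m s (v y))\<^sup>2 + (ip m (v y) (v y))\<^sup>2 / p) / N\<^sup>2
        + 5 * (ip m (v y) (v y))\<^sup>2 / N\<^sup>2)
      + 108 * \<bar>\<theta>\<bar> ^ 3 * (4 * (q * (ip m s (v y))\<^sup>2 + R\<^sup>2 * (ip m (v y) (v y))\<^sup>2 / q) / N ^ 3)" for y
  have GF: "cmod (G y - F y) \<le> H y" for y
  proof -
    define i where "i = ip m s (v y)"
    define h where "h = ip m (v y) (v y)"
    have h0: "0 \<le> h" by (simp add: h_def)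
    have i2: "i\<^sup>2 \<le> R * h" unfolding i_def R_def h_def by (rule ip_cauchy_schwarz)
    have Y: "ip m (\<lambda>i. s i + v y i) (\<lambda>i. s i + v y i) / N = X + (A y + B y)"
      by (simp add: ip_add_add X_def A_def B_def R_def add_divide_distrib)
    have "0 \<le> X + (A y + B y)" unfolding Y[symmetric] using N0 by simp
    then have "cmod (exp (b * of_real (X + (A y + B y))) - exp (b * of_real X) * (1 + b * of_real (A y + B y) + b\<^sup>2 * of_real ((A y)\<^sup>2) / 2))
      \<le> (cmod b)\<^sup>2 * (\<bar>A y\<bar> * \<bar>B y\<bar> + 5 * (B y)\<^sup>2) + 4 * cmod b ^ 3 * \<bar>A y\<bar> ^ 3"
      using t X0 by (intro cmod_exp_taylor_split_le) (auto simp: b_def)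
    moreover have "cmod (G y - F y) = cmod (exp (of_real (- (\<theta>\<^sup>2 * m * t\<^sup>2)) + \<i> * of_real (\<theta> * m * t)))
        * cmod (exp (b * of_real (X + (A y + B y))) - exp (b * of_real X) * (1 + b * of_real (A y + B y) + b\<^sup>2 * of_real ((A y)\<^sup>2) / 2))"
      unfolding G_def F_def Y swap_char_factor b_def[symmetric] norm_mult[symmetric]
      by (simp only: right_diff_distrib mult.assoc)
    moreover have "cmod (exp (of_real (- (\<theta>\<^sup>2 * m * t\<^sup>2)) + \<i> * of_real (\<theta> * m * t))) \<le> 1" by simp
    ultimately have "cmod (G y - F y) \<le> (cmod b)\<^sup>2 * (\<bar>A y\<bar> * \<bar>B y\<bar> + 5 * (B y)\<^sup>2) + 4 * cmod b ^ 3 * \<bar>A y\<bar> ^ 3"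
      using mult_mono[of "cmod (exp (of_real (- (\<theta>\<^sup>2 * m * t\<^sup>2)) + \<i> * of_real (\<theta> * m * t)))" 1
        "cmod (exp (b * of_real (X + (A y + B y))) - exp (b * of_real X) * (1 + b * of_real (A y + B y) + b\<^sup>2 * of_real ((A y)\<^sup>2) / 2))"]
      by simp
    also have "\<dots> \<le> 9 * \<theta>\<^sup>2 * ((p * i\<^sup>2 + h\<^sup>2 / p) / N\<^sup>2 + 5 * h\<^sup>2 / N\<^sup>2)
        + 4 * (27 * \<bar>\<theta>\<bar> ^ 3) * (4 * (q * i\<^sup>2 + R\<^sup>2 * h\<^sup>2 / q) / N ^ 3)"
    proof (intro add_mono mult_mono b2 b3 order_refl)
      have "0 \<le> (p * \<bar>i\<bar> - h)\<^sup>2" by simp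
      then have "2 * \<bar>i\<bar> * h * p \<le> p * (p * i\<^sup>2) + h\<^sup>2" by (simp add: power2_eq_square algebra_simps)
      then have "2 * \<bar>i\<bar> * h \<le> p * i\<^sup>2 + h\<^sup>2 / p" using pq by (simp add: field_simps power2_eq_square)
      then show "\<bar>A y\<bar> * \<bar>B y\<bar> \<le> (p * i\<^sup>2 + h\<^sup>2 / p) / N\<^sup>2"
        unfolding A_def B_def i_def[symmetric] h_def[symmetric] using N0 h0
        by (simp add: abs_mult divide_right_mono power2_eq_square)
      show "5 * (B y)\<^sup>2 \<le> 5 * h\<^sup>2 / N\<^sup>2" by (simp add: B_def h_def power_divide)
      have "0 \<le> (q * \<bar>i\<bar> - i\<^sup>2)\<^sup>2" by simp
      then have "2 * \<bar>i\<bar> ^ 3 * q \<le> q * (q * i\<^sup>2) + (i\<^sup>2)\<^sup>2"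
        by (simp add: power2_eq_square power3_eq_cube algebra_simps)
      also have "(i\<^sup>2)\<^sup>2 \<le> (R * h)\<^sup>2" using i2 by (intro power_mono) auto
      finally have "2 * \<bar>i\<bar> ^ 3 \<le> q * i\<^sup>2 + R\<^sup>2 * h\<^sup>2 / q"
        using pq by (simp add: field_simps power2_eq_square)
      then have "4 * (2 * \<bar>i\<bar> ^ 3) / N ^ 3 \<le> 4 * (q * i\<^sup>2 + R\<^sup>2 * h\<^sup>2 / q) / N ^ 3"
        using N0 by (intro divide_right_mono mult_left_mono) auto
      moreover have "\<bar>A y\<bar> ^ 3 = 4 * (2 * \<bar>i\<bar> ^ 3) / N ^ 3"
        unfolding A_def i_def[symmetric] using N0 by (simp add: abs_mult power_mult_distrib power_divide)
      ultimately show "\<bar>A y\<bar> ^ 3 \<le> 4 * (q * i\<^sup>2 + R\<^sup>2 * h\<^sup>2 / q) / N ^ 3" by simp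
    qed auto
    finally show ?thesis by (simp add: H_def i_def h_def)
  qed
  have int_H: "integrable Q H"
    unfolding H_def by (intro Bochner_Integration.integrable_add integrable_mult_right integrable_divide
        integrable_ip_square integrable_norm4)
  have H_int: "(\<integral>y. H y \<partial>Q) \<le> 9 * \<theta>\<^sup>2 * ((p * R + C * (real m)\<^sup>2 / p) / N\<^sup>2 + 5 * (C * (real m)\<^sup>2) / N\<^sup>2)
      + 108 * \<bar>\<theta>\<bar> ^ 3 * (4 * (q * R + R\<^sup>2 * (C * (real m)\<^sup>2) / q) / N ^ 3)"
  proof -
    have "(\<integral>y. H y \<partial>Q) = 9 * \<theta>\<^sup>2 * ((p * R + (\<integral>z. (ip m (v z) (v z))\<^sup>2 \<partial>Q) / p) / N\<^sup>2 + 5 * (\<integral>z. (ip m (v z) (v z))\<^sup>2 \<partial>Q) / N\<^sup>2)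
      + 108 * \<bar>\<theta>\<bar> ^ 3 * (4 * (q * R + R\<^sup>2 * (\<integral>z. (ip m (v z) (v z))\<^sup>2 \<partial>Q) / q) / N ^ 3)"
      unfolding H_def R_def using integrable_ip_square[of s] integrable_norm4
      by (simp add: integral_ip_square)
    also have "\<dots> \<le> 9 * \<theta>\<^sup>2 * ((p * R + C * (real m)\<^sup>2 / p) / N\<^sup>2 + 5 * (C * (real m)\<^sup>2) / N\<^sup>2)
      + 108 * \<bar>\<theta>\<bar> ^ 3 * (4 * (q * R + R\<^sup>2 * (C * (real m)\<^sup>2) / q) / N ^ 3)"
      using pq N0 norm4_le by (intro add_mono mult_left_mono divide_right_mono order_refl) auto
    finally show ?thesis .
  qed
  have int_A: "integrable Q A" and int_A2: "integrable Q (\<lambda>y. (A y)\<^sup>2)" and int_B: "integrable Q B"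
    unfolding A_def B_def power_divide power_mult_distrib
    using integrable_ip integrable_ip_square integrable_norm
    by (intro integrable_divide integrable_mult_right; simp)+
  have int_F: "integrable Q F"
    unfolding F_def using int_A int_A2 int_B
    by (intro integrable_mult_right Bochner_Integration.integrable_add integrable_const
        integrable_divide integrable_of_real; simp)
  have F_int: "(\<integral>y. F y \<partial>Q) = swap_char \<theta> m t X * (1 + b * of_real (m / N) + b\<^sup>2 * of_real (2 * X / N))"
  proof -
    have "(\<integral>y. A y + B y \<partial>Q) = m / N"
      using int_A int_B by (simp, simp add: A_def B_def integral_ip integral_norm)
    moreover have "(\<integral>y. (A y)\<^sup>2 \<partial>Q) = 4 * R / N\<^sup>2"
      unfolding A_def power_divide power_mult_distrib by (simp add: integral_ip_square R_def)
    then have "(\<integral>y. (A y)\<^sup>2 \<partial>Q) = 4 * X / N"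
      by (simp add: X_def power2_eq_square)
    ultimately have int_c: "(\<integral>y. complex_of_real (A y + B y) \<partial>Q) = of_real (m / N)"
        "(\<integral>y. complex_of_real ((A y)\<^sup>2) \<partial>Q) = of_real (4 * X / N)"
      by (simp_all only: integral_complex_of_real)
    have i1: "integrable Q (\<lambda>y. b * complex_of_real (A y + B y))"
      using int_A int_B by (intro integrable_mult_right integrable_of_real Bochner_Integration.integrable_add)
    have i2: "integrable Q (\<lambda>y. b\<^sup>2 * complex_of_real ((A y)\<^sup>2) / 2)"
      using int_A2 by (intro integrable_mult_right integrable_divide integrable_of_real)
    have "(\<integral>y. F y \<partial>Q) = swap_char \<theta> m t X * (\<integral>y. (1 + b * of_real (A y + B y)) + b\<^sup>2 * of_real ((A y)\<^sup>2) / 2 \<partial>Q)"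
      unfolding F_def by (rule integral_mult_right_zero)
    also have "(\<integral>y. (1 + b * of_real (A y + B y)) + b\<^sup>2 * of_real ((A y)\<^sup>2) / 2 \<partial>Q)
        = (\<integral>y. 1 + b * of_real (A y + B y) \<partial>Q) + (\<integral>y. b\<^sup>2 * of_real ((A y)\<^sup>2) / 2 \<partial>Q)"
      by (intro Bochner_Integration.integral_add Bochner_Integration.integrable_add integrable_const i1 i2)
    also have "(\<integral>y. 1 + b * of_real (A y + B y) \<partial>Q) = 1 + b * of_real (m / N)"
      using i1 by (subst Bochner_Integration.integral_add) (simp_all only: integrable_const integral_mult_right_zero int_c, simp add: prob_space)
    also have "(\<integral>y. b\<^sup>2 * of_real ((A y)\<^sup>2) / 2 \<partial>Q) = b\<^sup>2 * of_real (2 * X / N)"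
      by (simp only: integral_divide_zero integral_mult_right_zero int_c) simp
    finally show ?thesis .
  qed
  have int_G: "integrable Q G"
  proof (rule integrable_const_bound[of _ 1])
    show "AE y in Q. norm (G y) \<le> 1"
      using t N0 by (intro AE_I2) (simp add: G_def norm_swap_char_le)
    show "G \<in> borel_measurable Q"
      unfolding G_def ip_add_add by measurable
  qed
  have "cmod ((\<integral>y. G y \<partial>Q) - (\<integral>y. F y \<partial>Q)) \<le> (\<integral>y. H y \<partial>Q)"
  proof -
    have "(\<integral>y. G y \<partial>Q) - (\<integral>y. F y \<partial>Q) = (\<integral>y. G y - F y \<partial>Q)"
      using int_F int_G by simp
    also have "cmod \<dots> \<le> (\<integral>y. H y \<partial>Q)"
      by (intro norm_integral_le_integral int_H GF Bochner_Integration.integrable_diff int_F int_G)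
    finally show ?thesis .
  qed
  also note H_int
  finally have 1: "cmod ((\<integral>y. G y \<partial>Q) - (\<integral>y. F y \<partial>Q))
      \<le> 9 * \<theta>\<^sup>2 * ((p * R + C * (real m)\<^sup>2 / p) / N\<^sup>2 + 5 * (C * (real m)\<^sup>2) / N\<^sup>2)
      + 108 * \<bar>\<theta>\<bar> ^ 3 * (4 * (q * R + R\<^sup>2 * (C * (real m)\<^sup>2) / q) / N ^ 3)" .
  \<comment> \<open>The first-order time expansion. Its terms in \<open>m\<close> agree exactly with
    those of the integral of \<open>F\<close>.\<close>
  define T where "T = swap_char \<theta> m t X *
      (1 + of_real (1 / N) * (\<i> * of_real (\<theta> * m) - of_real (2 * \<theta>\<^sup>2 * m * t) - of_real (2 * \<theta>\<^sup>2 * X)))"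
  have 2: "cmod (T - swap_char \<theta> m (t + 1 / N) X) \<le> (20 * \<theta>\<^sup>2 * (real m)\<^sup>2 + 8 * \<theta>\<^sup>2 * X\<^sup>2) / N\<^sup>2"
  proof -
    have "cmod (T - swap_char \<theta> m (t + 1 / N) X) = cmod (swap_char \<theta> m (t + 1 / N) X - T)"
      by (rule norm_minus_commute)
    also have "\<dots> \<le> ((\<bar>\<theta>\<bar> * m + 2 * \<theta>\<^sup>2 * m + 2 * \<theta>\<^sup>2 * X)\<^sup>2 + 2 * \<theta>\<^sup>2 * m) * (1 / N)\<^sup>2"
      unfolding T_def using t N0 X0 by (intro swap_char_time_step) auto
    also have "\<dots> \<le> (20 * \<theta>\<^sup>2 * (real m)\<^sup>2 + 8 * \<theta>\<^sup>2 * X\<^sup>2) * (1 / N)\<^sup>2"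
    proof (rule mult_right_mono)
      have "2 * \<theta>\<^sup>2 * X \<le> 2 * \<bar>\<theta>\<bar> * X" "2 * \<theta>\<^sup>2 * m \<le> 2 * \<bar>\<theta>\<bar> * m"
        using \<theta>2 X0 by (auto intro!: mult_right_mono)
      then have "\<bar>\<theta>\<bar> * m + 2 * \<theta>\<^sup>2 * m + 2 * \<theta>\<^sup>2 * X \<le> 3 * \<bar>\<theta>\<bar> * m + 2 * \<bar>\<theta>\<bar> * X" by simp
      then have "(\<bar>\<theta>\<bar> * m + 2 * \<theta>\<^sup>2 * m + 2 * \<theta>\<^sup>2 * X)\<^sup>2 \<le> (3 * \<bar>\<theta>\<bar> * m + 2 * \<bar>\<theta>\<bar> * X)\<^sup>2"
        using X0 by (intro power_mono) auto
      also have "\<dots> \<le> 2 * (3 * \<bar>\<theta>\<bar> * m)\<^sup>2 + 2 * (2 * \<bar>\<theta>\<bar> * X)\<^sup>2"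
        using sum_squares_bound[of "3 * \<bar>\<theta>\<bar> * m" "2 * \<bar>\<theta>\<bar> * X"] by (simp add: power2_sum)
      also have "\<dots> = 18 * \<theta>\<^sup>2 * (real m)\<^sup>2 + 8 * \<theta>\<^sup>2 * X\<^sup>2"
        by (simp add: power_mult_distrib)
      finally have "(\<bar>\<theta>\<bar> * m + 2 * \<theta>\<^sup>2 * m + 2 * \<theta>\<^sup>2 * X)\<^sup>2 \<le> 18 * \<theta>\<^sup>2 * (real m)\<^sup>2 + 8 * \<theta>\<^sup>2 * X\<^sup>2" .
      moreover have "2 * \<theta>\<^sup>2 * real m \<le> 2 * \<theta>\<^sup>2 * (real m)\<^sup>2"
        using m_pos by (intro mult_left_mono) (auto simp: power2_eq_square)
      ultimately show "(\<bar>\<theta>\<bar> * m + 2 * \<theta>\<^sup>2 * m + 2 * \<theta>\<^sup>2 * X)\<^sup>2 + 2 * \<theta>\<^sup>2 * m \<le> 20 * \<theta>\<^sup>2 * (real m)\<^sup>2 + 8 * \<theta>\<^sup>2 * X\<^sup>2"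
        by linarith
    qed simp
    finally show ?thesis by (simp add: power_divide)
  qed
  have 3: "cmod ((\<integral>y. F y \<partial>Q) - T) \<le> 16 * \<bar>\<theta>\<bar> ^ 3 * X / N"
  proof -
    \<comment> \<open>The coefficient of \<open>X / N\<close> in the difference: the second-order
      parts in \<theta> cancel and leave the order \<theta> cubed, which is the residual of the
      truncated heat solution.\<close>
    have bsq: "2 * b\<^sup>2 + of_real (2 * \<theta>\<^sup>2) = of_real (8 * \<theta> ^ 4 * t\<^sup>2) - \<i> * of_real (8 * \<theta> ^ 3 * t)"
      by (simp add: b_def power2_eq_square power3_eq_cube power4_eq_xxxx algebra_simps)
    have "(\<integral>y. F y \<partial>Q) - T = swap_char \<theta> m t X * of_real (X / N) * (2 * b\<^sup>2 + of_real (2 * \<theta>\<^sup>2))"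
      unfolding F_int T_def b_def by (simp add: algebra_simps add_divide_distrib diff_divide_distrib)
    also have "cmod \<dots> = cmod (swap_char \<theta> m t X) * (X / N) * cmod (of_real (8 * \<theta> ^ 4 * t\<^sup>2) - \<i> * of_real (8 * \<theta> ^ 3 * t))"
      unfolding bsq norm_mult norm_of_real using X0 N0 by simp
    also have "\<dots> \<le> 1 * (X / N) * (16 * \<bar>\<theta>\<bar> ^ 3)"
    proof (intro mult_mono order_refl)
      show "cmod (swap_char \<theta> m t X) \<le> 1" using t X0 by (simp add: norm_swap_char_le)
      have "cmod (of_real (8 * \<theta> ^ 4 * t\<^sup>2) - \<i> * of_real (8 * \<theta> ^ 3 * t)) \<le> cmod (of_real (8 * \<theta> ^ 4 * t\<^sup>2)) + cmod (\<i> * of_real (8 * \<theta> ^ 3 * t))"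
        by (rule norm_triangle_ineq4)
      also have "\<dots> = 8 * \<bar>\<theta>\<bar> ^ 3 * (\<bar>\<theta>\<bar> * t\<^sup>2) + 8 * \<bar>\<theta>\<bar> ^ 3 * t"
        using t by (simp only: norm_mult norm_of_real norm_ii abs_mult power_abs)
          (simp add: power3_eq_cube power4_eq_xxxx abs_mult)
      also have "\<bar>\<theta>\<bar> * t\<^sup>2 \<le> 1 * 1" using \<theta> t t1 by (intro mult_mono power_le_one) auto
      also have "8 * \<bar>\<theta>\<bar> ^ 3 * t \<le> 8 * \<bar>\<theta>\<bar> ^ 3 * 1" using t1 by (intro mult_left_mono) auto
      finally show "cmod (of_real (8 * \<theta> ^ 4 * t\<^sup>2) - \<i> * of_real (8 * \<theta> ^ 3 * t)) \<le> 16 * \<bar>\<theta>\<bar> ^ 3"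
        by (simp add: mult_left_mono)
    qed (use X0 N0 in auto)
    finally show ?thesis by (simp add: mult_ac)
  qed
  have "cmod ((\<integral>y. G y \<partial>Q) - swap_char \<theta> m (t + 1 / N) X)
      = cmod ((((\<integral>y. G y \<partial>Q) - (\<integral>y. F y \<partial>Q)) + ((\<integral>y. F y \<partial>Q) - T)) + (T - swap_char \<theta> m (t + 1 / N) X))"
    by simp
  also have "\<dots> \<le> (9 * \<theta>\<^sup>2 * ((p * R + C * (real m)\<^sup>2 / p) / N\<^sup>2 + 5 * (C * (real m)\<^sup>2) / N\<^sup>2)
      + 108 * \<bar>\<theta>\<bar> ^ 3 * (4 * (q * R + R\<^sup>2 * (C * (real m)\<^sup>2) / q) / N ^ 3)
      + 16 * \<bar>\<theta>\<bar> ^ 3 * X / N) + (20 * \<theta>\<^sup>2 * (real m)\<^sup>2 + 8 * \<theta>\<^sup>2 * X\<^sup>2) / N\<^sup>2"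
    by (rule norm_triangle_le[OF add_mono[OF norm_triangle_le[OF add_mono[OF 1 3]] 2]])
  also have "\<dots> = (9 * \<theta>\<^sup>2 * (C * (real m)\<^sup>2 / p + 5 * C * (real m)\<^sup>2) / N\<^sup>2 + 20 * \<theta>\<^sup>2 * (real m)\<^sup>2 / N\<^sup>2)
      + (9 * \<theta>\<^sup>2 * p / N\<^sup>2 + 432 * \<bar>\<theta>\<bar> ^ 3 * q / N ^ 3 + 16 * \<bar>\<theta>\<bar> ^ 3 / N\<^sup>2) * R
      + (432 * \<bar>\<theta>\<bar> ^ 3 * C * (real m)\<^sup>2 / (q * N ^ 3) + 8 * \<theta>\<^sup>2 / N ^ 4) * R\<^sup>2"
    using N0 pq unfolding X_def
    by (simp add: add_divide_distrib distrib_left distrib_right power_divide power2_eq_square power3_eq_cube power4_eq_xxxx mult_ac)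
  finally show ?thesis by (simp only: G_def X_def)
qed

text \<open>The conditional bound averaged over the first \<open>k\<close> observations, with
  \<open>|S|^2\<close> and \<open>|S|^4\<close> having means of order \<open>N m\<close> and
  \<open>N^2 m^2\<close>. The factor \<open>1 / n\<close> leaves room for \<open>n\<close> such
  exchanges.\<close>

lemma swap_step:
  fixes \<theta> :: real and n k :: nat
  assumes \<theta>: "\<bar>\<theta>\<bar> \<le> 1" and k: "k < n"
  shows "cmod ((\<integral>x. swap_char \<theta> m (1 - real (Suc k) / n) (psum_norm (Suc k) x / n) \<partial>sample (Suc k))
      - (\<integral>x. swap_char \<theta> m (1 - real k / n) (psum_norm k x / n) \<partial>sample k))
    \<le> (5000 * (1 + C)\<^sup>2 * \<theta>\<^sup>2 * real m ^ 3 / sqrt n + 16 * \<bar>\<theta>\<bar> ^ 3 * m) / n"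
proof -
  define N where "N = real n"
  \<comment> \<open>The Gaussian variance remaining once observation \<open>Suc k\<close> has been
    inserted; before, it was \<open>t + 1 / N\<close>, so each exchange trades a variance of exactly
    \<open>1 / N\<close>.\<close>
  define t where "t = 1 - real (Suc k) / N"
  \<comment> \<open>With these two weights every AM-GM term is, after averaging, at most of order
    \<open>\<theta>\<^sup>2 * m ^ 3 / N powr (3/2)\<close>.\<close>
  define p where "p = 1 / sqrt N"
  define q where "q = sqrt N * m"
  define a0 where "a0 = 9 * \<theta>\<^sup>2 * (C * (real m)\<^sup>2 / p + 5 * C * (real m)\<^sup>2) / N\<^sup>2 + 20 * \<theta>\<^sup>2 * (real m)\<^sup>2 / N\<^sup>2"
  define a1 where "a1 = 9 * \<theta>\<^sup>2 * p / N\<^sup>2 + 432 * \<bar>\<theta>\<bar> ^ 3 * q / N ^ 3 + 16 * \<bar>\<theta>\<bar> ^ 3 / N\<^sup>2"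
  define a2 where "a2 = 432 * \<bar>\<theta>\<bar> ^ 3 * C * (real m)\<^sup>2 / (q * N ^ 3) + 8 * \<theta>\<^sup>2 / N ^ 4"
  interpret Pk: prob_space "sample k" by (rule prob_space_sample)
  interpret PSk: prob_space "sample (Suc k)" by (rule prob_space_sample)
  have N1: "1 \<le> N" using k by (simp add: N_def)
  then have N0: "0 < N" by simp
  have pq: "0 < p" "0 < q" using N0 m_pos by (auto simp: p_def q_def)
  have tk: "t + 1 / N = 1 - real k / N" by (simp add: t_def add_divide_distrib)
  have t: "0 \<le> t" "t + 1 / N \<le> 1"
    unfolding tk using k N0 by (auto simp: t_def N_def)
  have a_nonneg: "0 \<le> a1" "0 \<le> a2"
    using pq N0 C_nonneg by (auto simp: a1_def a2_def)
  have int_S: "integrable (sample (Suc k)) (\<lambda>x. swap_char \<theta> m t (psum_norm (Suc k) x / N))"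
  proof (rule PSk.integrable_const_bound[of _ 1])
    show "AE x in sample (Suc k). norm (swap_char \<theta> m t (psum_norm (Suc k) x / N)) \<le> 1"
      using t N0 by (intro AE_I2 norm_swap_char_le) auto
  qed measurable
  have int_k: "integrable (sample k) (\<lambda>x. swap_char \<theta> m (t + 1 / N) (psum_norm k x / N))"
  proof (rule Pk.integrable_const_bound[of _ 1])
    show "AE x in sample k. norm (swap_char \<theta> m (t + 1 / N) (psum_norm k x / N)) \<le> 1"
      using t N0 by (intro AE_I2 norm_swap_char_le) auto
  qed measurable
  define J where "J x = (\<integral>y. swap_char \<theta> m t (ip m (\<lambda>i. psum k x i + v y i) (\<lambda>i. psum k x i + v y i) / N) \<partial>Q)" for x
  have J_eq: "(\<integral>x. swap_char \<theta> m t (psum_norm (Suc k) x / N) \<partial>sample (Suc k)) = (\<integral>x. J x \<partial>sample k)"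
    unfolding integral_PiM_Suc[OF int_S] psum_upd J_def ..
  have bound: "cmod (J x - swap_char \<theta> m (t + 1 / N) (psum_norm k x / N)) \<le> a0 + a1 * psum_norm k x + a2 * (psum_norm k x)\<^sup>2" for x
    unfolding J_def a0_def a1_def a2_def by (rule swap_step_conditional[OF \<theta> N1 t pq])
  have int_J: "integrable (sample k) J"
  proof (rule Pk.integrable_const_bound[of _ 1])
    show "AE x in sample k. norm (J x) \<le> 1"
    proof (intro AE_I2)
      fix x
      have "cmod (J x) \<le> (\<integral>y. 1 \<partial>Q)"
        unfolding J_def
      proof (intro norm_integral_le_integral integrable_const)
        show "integrable Q (\<lambda>y. swap_char \<theta> m t (ip m (\<lambda>i. psum k x i + v y i) (\<lambda>i. psum k x i + v y i) / N))"
          by (rule integrable_const_bound[of _ 1])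
            (use t N0 in \<open>simp add: norm_swap_char_le\<close>, unfold ip_add_add, measurable)
      qed (use t N0 in \<open>simp add: norm_swap_char_le\<close>)
      then show "norm (J x) \<le> 1" by (simp add: prob_space)
    qed
    show "J \<in> borel_measurable (sample k)"
    proof -
      interpret P: product_sigma_finite "\<lambda>_::nat. Q" by standard
      have "(\<lambda>(x, y). swap_char \<theta> m t (psum_norm (Suc k) (x(Suc k := y)) / N)) \<in> borel_measurable (sample k \<Otimes>\<^sub>M Q)"
      proof -
        have "(\<lambda>(x, y). x(Suc k := y)) \<in> measurable (sample k \<Otimes>\<^sub>M Q) (PiM (insert (Suc k) {1..k}) (\<lambda>_. Q))"
          using measurable_add_dim[of "Suc k" "{1..k}" "\<lambda>_. Q"] by simp
        also have "insert (Suc k) {1..k} = {1..Suc k}" by auto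
        finally have "(\<lambda>z. swap_char \<theta> m t (psum_norm (Suc k) ((\<lambda>(x, y). x(Suc k := y)) z) / N)) \<in> borel_measurable (sample k \<Otimes>\<^sub>M Q)"
          by (rule measurable_compose) measurable
        then show ?thesis by (simp add: case_prod_beta)
      qed
      then show ?thesis
        unfolding J_def psum_upd[symmetric] by (rule borel_measurable_lebesgue_integral)
    qed
  qed
  have int_b: "integrable (sample k) (\<lambda>x. a0 + a1 * psum_norm k x + a2 * (psum_norm k x)\<^sup>2)"
    by (intro Bochner_Integration.integrable_add integrable_mult_right Pk.integrable_const
        integrable_psum_norm integrable_psum_norm_square)
  have "cmod ((\<integral>x. J x \<partial>sample k) - (\<integral>x. swap_char \<theta> m (t + 1 / N) (psum_norm k x / N) \<partial>sample k))
      = cmod (\<integral>x. J x - swap_char \<theta> m (t + 1 / N) (psum_norm k x / N) \<partial>sample k)"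
    using int_J int_k by simp
  also have "\<dots> \<le> (\<integral>x. a0 + a1 * psum_norm k x + a2 * (psum_norm k x)\<^sup>2 \<partial>sample k)"
    by (intro norm_integral_le_integral Bochner_Integration.integrable_diff
        int_J int_k int_b bound)
  also have "\<dots> = a0 + a1 * (real k * m) + a2 * (\<integral>x. (psum_norm k x)\<^sup>2 \<partial>sample k)"
    using integrable_psum_norm[of k] integrable_psum_norm_square[of k]
    by (simp add: integral_psum_norm Pk.prob_space)
  also have "\<dots> \<le> a0 + a1 * (N * m) + a2 * ((10 + 2 * C) * N\<^sup>2 * (real m)\<^sup>2)"
    unfolding N_def using k a_nonneg[unfolded N_def] integral_psum_norm_square[of k n]
    by (intro add_mono mult_left_mono mult_right_mono order_refl) auto
  also have "\<dots> \<le> (5000 * (1 + C)\<^sup>2 * \<theta>\<^sup>2 * real m ^ 3 / sqrt N + 16 * \<bar>\<theta>\<bar> ^ 3 * m) / N"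
    (is "?L \<le> ?U")
  proof -
    define r where "r = sqrt N"
    have r: "1 \<le> r" and Nr: "N = r\<^sup>2" using N1 by (auto simp: r_def)
    define M where "M = real m"
    have M1: "1 \<le> M" using m_pos by (simp add: M_def)
    \<comment> \<open>The common unit: each error term except the heat residual is a constant
      multiple of \<open>T\<close> at most, using that \<open>m\<close> and \<open>r\<close> are at
      least 1 and \<open>|\<theta>|\<close> is at most 1.\<close>
    define T where "T = \<theta>\<^sup>2 * M ^ 3 / r ^ 3"
    have r0: "0 < r" using r by simp
    have T0: "0 \<le> T" using M1 r0 by (simp add: T_def)
    have c3: "\<bar>\<theta>\<bar> ^ 3 \<le> \<theta>\<^sup>2"
      using \<theta> power_decreasing[of 2 3 "\<bar>\<theta>\<bar>"] by simp
    have M12: "1 \<le> M\<^sup>2" and M23: "M\<^sup>2 \<le> M ^ 3" and M13: "M \<le> M ^ 3"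
      using M1 power_increasing[of 2 3 M] power_increasing[of 1 3 M] one_le_power[of M 2] by auto
    have r34: "r ^ 3 \<le> r ^ 4" using r by (intro power_increasing) auto
    have e1: "\<theta>\<^sup>2 * M\<^sup>2 / r ^ 3 \<le> T" "\<theta>\<^sup>2 * M / r ^ 3 \<le> T"
      unfolding T_def using M23 M13 r0 by (auto intro!: divide_right_mono mult_left_mono)
    have e2: "\<theta>\<^sup>2 * M\<^sup>2 / r ^ 4 \<le> T"
    proof -
      have "\<theta>\<^sup>2 * M\<^sup>2 / r ^ 4 \<le> \<theta>\<^sup>2 * M\<^sup>2 / r ^ 3"
        using r34 r0 by (intro divide_left_mono) auto
      with e1(1) show ?thesis by linarith
    qed
    have e3: "\<bar>\<theta>\<bar> ^ 3 * M\<^sup>2 / r ^ 3 \<le> T" "\<bar>\<theta>\<bar> ^ 3 * M ^ 3 / r ^ 3 \<le> T"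
    proof -
      have "\<bar>\<theta>\<bar> ^ 3 * M\<^sup>2 / r ^ 3 \<le> \<theta>\<^sup>2 * M\<^sup>2 / r ^ 3"
        using c3 r0 by (intro divide_right_mono mult_right_mono) auto
      with e1(1) show "\<bar>\<theta>\<bar> ^ 3 * M\<^sup>2 / r ^ 3 \<le> T" by linarith
      show "\<bar>\<theta>\<bar> ^ 3 * M ^ 3 / r ^ 3 \<le> T"
        unfolding T_def using c3 r0 M1 by (intro divide_right_mono mult_right_mono) auto
    qed
    have id0: "9 * x * (C * M\<^sup>2 / (1 / r) + 5 * C * M\<^sup>2) / (r\<^sup>2)\<^sup>2 + 20 * x * M\<^sup>2 / (r\<^sup>2)\<^sup>2
        = 9 * C * (x * M\<^sup>2 / r ^ 3) + (45 * C + 20) * (x * M\<^sup>2 / r ^ 4)" for x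
      using r0 M1 by (simp add: field_simps power_numeral_reduce)
    have id1: "(9 * x * (1 / r) / (r\<^sup>2)\<^sup>2 + 432 * y * (r * M) / (r\<^sup>2) ^ 3 + 16 * y / (r\<^sup>2)\<^sup>2) * (r\<^sup>2 * M)
        = 9 * (x * M / r ^ 3) + 432 * (y * M\<^sup>2 / r ^ 3) + 16 * y * M / r\<^sup>2" for x y
      using r0 M1 by (simp add: field_simps power_numeral_reduce)
    have id2: "(432 * y * C * M\<^sup>2 / (r * M * (r\<^sup>2) ^ 3) + 8 * x / (r\<^sup>2) ^ 4) * (K * (r\<^sup>2)\<^sup>2 * M\<^sup>2)
        = 432 * C * K * (y * M ^ 3 / r ^ 3) + 8 * K * (x * M\<^sup>2 / r ^ 4)" for x y K
      using r0 M1 by (simp add: field_simps power_numeral_reduce)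
    have id3: "K * (x * M ^ 3 / r ^ 3) + 16 * y * M / r\<^sup>2 = (K * x * M ^ 3 / r + 16 * y * M) / r\<^sup>2" for x y K
      using r0 by (simp add: field_simps power_numeral_reduce)
    have "?L = 9 * C * (\<theta>\<^sup>2 * M\<^sup>2 / r ^ 3) + (45 * C + 20) * (\<theta>\<^sup>2 * M\<^sup>2 / r ^ 4)
        + (9 * (\<theta>\<^sup>2 * M / r ^ 3) + 432 * (\<bar>\<theta>\<bar> ^ 3 * M\<^sup>2 / r ^ 3) + 16 * \<bar>\<theta>\<bar> ^ 3 * M / N)
        + (432 * C * (10 + 2 * C) * (\<bar>\<theta>\<bar> ^ 3 * M ^ 3 / r ^ 3) + 8 * (10 + 2 * C) * (\<theta>\<^sup>2 * M\<^sup>2 / r ^ 4))"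
      unfolding a0_def a1_def a2_def p_def q_def r_def[symmetric] M_def[symmetric]
      unfolding Nr id0 id1 id2 ..
    also have "\<dots> \<le> 9 * C * T + (45 * C + 20) * T + (9 * T + 432 * T + 16 * \<bar>\<theta>\<bar> ^ 3 * M / N)
        + (432 * C * (10 + 2 * C) * T + 8 * (10 + 2 * C) * T)"
      using e1 e2 e3 C_nonneg by (intro add_mono mult_left_mono order_refl) auto
    also have "\<dots> = (541 + 4390 * C + 864 * C\<^sup>2) * T + 16 * \<bar>\<theta>\<bar> ^ 3 * M / N"
      by (simp add: algebra_simps power2_eq_square)
    also have "\<dots> \<le> 5000 * (1 + C)\<^sup>2 * T + 16 * \<bar>\<theta>\<bar> ^ 3 * M / N"
    proof (intro add_mono mult_right_mono T0 order_refl)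
      have "541 + 4390 * C + 864 * C\<^sup>2 \<le> 5000 + 10000 * C + 5000 * C\<^sup>2"
        using C_nonneg zero_le_power2[of C] by linarith
      also have "\<dots> = 5000 * (1 + C)\<^sup>2" by (simp add: power2_eq_square algebra_simps)
      finally show "541 + 4390 * C + 864 * C\<^sup>2 \<le> 5000 * (1 + C)\<^sup>2" .
    qed
    also have "\<dots> = ?U"
      unfolding T_def r_def[symmetric] M_def[symmetric] unfolding Nr id3 ..
    finally show ?thesis .
  qed
  finally show ?thesis
    unfolding J_eq[symmetric] tk unfolding t_def N_def .
qed

text \<open>Telescoping over \<open>n\<close> exchanges. At \<open>k = n\<close> no Gaussian part
  remains and \<open>swap_char\<close> is the exact exponential; at \<open>k = 0\<close> the sum is
  empty and the value is explicit. The target \<open>exp (- (\<theta>\<^sup>2 * m))\<close> is the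
  characteristic function of N(0, 2 m) at \<theta>.\<close>

lemma norm_chf_psum_norm_diff:
  fixes \<theta> :: real
  assumes \<theta>: "\<bar>\<theta>\<bar> \<le> 1" and n: "1 \<le> n"
  shows "cmod ((\<integral>x. exp (\<i> * of_real (\<theta> * (psum_norm n x / n - m))) \<partial>sample n) - of_real (exp (- (\<theta>\<^sup>2 * m))))
    \<le> 5000 * (1 + C)\<^sup>2 * \<theta>\<^sup>2 * real m ^ 3 / sqrt n + 16 * \<bar>\<theta>\<bar> ^ 3 * m"
proof -
  define e where "e = 5000 * (1 + C)\<^sup>2 * \<theta>\<^sup>2 * real m ^ 3 / sqrt n + 16 * \<bar>\<theta>\<bar> ^ 3 * m"
  define a where "a k = (\<integral>x. swap_char \<theta> m (1 - real k / n) (psum_norm k x / n) \<partial>sample k)" for k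
  have "cmod (a k - a 0) \<le> real k * (e / n)" if "k \<le> n" for k
    using that
  proof (induction k)
    case (Suc k)
    then have "cmod (a (Suc k) - a k) \<le> e / n"
      using swap_step[OF \<theta>, of k n] by (simp add: a_def e_def)
    then have "cmod ((a (Suc k) - a k) + (a k - a 0)) \<le> e / n + real k * (e / n)"
      using Suc by (intro norm_triangle_le add_mono) auto
    then show ?case by (simp add: algebra_simps add_divide_distrib)
  qed simp
  from this[of n] have le: "cmod (a n - a 0) \<le> e" using n by simp
  interpret P0: prob_space "sample 0" by (rule prob_space_sample)
  have a0: "a 0 = swap_char \<theta> m 1 0"
    using P0.prob_space by (simp add: a_def psum_def ip_def)
  have an: "a n = (\<integral>x. exp (\<i> * of_real (\<theta> * (psum_norm n x / n))) \<partial>sample n)"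
    using n by (simp add: a_def swap_char_def)
  \<comment> \<open>A unimodular factor that centres the statistic at \<open>m\<close> without
    changing the error.\<close>
  define u where "u = exp (- (\<i> * of_real (\<theta> * m)))"
  have u: "cmod u = 1" by (simp add: u_def)
  have "u * a n = (\<integral>x. exp (\<i> * of_real (\<theta> * (psum_norm n x / n - m))) \<partial>sample n)"
    unfolding an u_def integral_mult_right_zero[symmetric] exp_add[symmetric]
    by (simp add: algebra_simps)
  moreover have "u * a 0 = of_real (exp (- (\<theta>\<^sup>2 * m)))"
    unfolding a0 u_def swap_char_def exp_add[symmetric] by (simp add: algebra_simps flip: exp_of_real)
  moreover have "cmod (u * a n - u * a 0) \<le> e"
    using le u by (simp add: norm_mult flip: right_diff_distrib)
  ultimately show ?thesis by (simp add: e_def)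
qed

end

section \<open>The statistic of a random sample\<close>

lemma emp_lik_cong:
  assumes "\<And>j i. j \<in> {1..n} \<Longrightarrow> i < m \<Longrightarrow> a j i = a' j i"
  shows "emp_lik n m a = emp_lik n m a'"
proof -
  have "(\<Sum>j=1..n. \<pi> j * a j i) = (\<Sum>j=1..n. \<pi> j * a' j i)" if "i < m" for \<pi> i
    using assms that by (intro sum.cong) auto
  then have "{\<pi> \<in> prob_vectors n. \<forall>i<m. (\<Sum>j=1..n. \<pi> j * a j i) = 0}
      = {\<pi> \<in> prob_vectors n. \<forall>i<m. (\<Sum>j=1..n. \<pi> j * a' j i) = 0}" by simp
  then show ?thesis unfolding emp_lik_def by (rule arg_cong)
qed

text \<open>The constraint is linear in the observations, so whitening applies \<open>A\<close> to
  the constraint vector; by injectivity of \<open>A\<close> the feasible weights are the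
  same.\<close>

lemma emp_lik_whitened:
  assumes "whitens m W A"
  shows "emp_lik n m (\<lambda>j i. ip m (A i) (a j)) = emp_lik n m a"
proof -
  have sum: "(\<Sum>j=1..n. \<pi> j * ip m (A i) (a j)) = ip m (A i) (\<lambda>p. \<Sum>j=1..n. \<pi> j * a j p)" for \<pi> i
  proof -
    have "(\<Sum>j=1..n. \<pi> j * ip m (A i) (a j)) = (\<Sum>j=1..n. \<Sum>p<m. A i p * (\<pi> j * a j p))"
      by (simp add: ip_def sum_distrib_left mult_ac)
    also have "\<dots> = (\<Sum>p<m. \<Sum>j=1..n. A i p * (\<pi> j * a j p))" by (rule sum.swap)
    finally show ?thesis by (simp add: ip_def sum_distrib_left)
  qed
  have "(\<forall>i<m. (\<Sum>j=1..n. \<pi> j * ip m (A i) (a j)) = 0) \<longleftrightarrow> (\<forall>i<m. (\<Sum>j=1..n. \<pi> j * a j i) = 0)" for \<pi>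
  proof
    assume "\<forall>i<m. (\<Sum>j=1..n. \<pi> j * ip m (A i) (a j)) = 0"
    then show "\<forall>i<m. (\<Sum>j=1..n. \<pi> j * a j i) = 0"
      using assms unfolding sum whitens_def by blast
  next
    assume "\<forall>i<m. (\<Sum>j=1..n. \<pi> j * a j i) = 0"
    then show "\<forall>i<m. (\<Sum>j=1..n. \<pi> j * ip m (A i) (a j)) = 0"
      unfolding sum by (simp add: ip_def)
  qed
  then show ?thesis by (simp add: emp_lik_def)
qed

section \<open>Reduction of the statistic to the squared norm, with high probability\<close>

context orthonormal_features
begin

text \<open>The threshold is a multiple of a bound on the mean, so that quantities of different
  orders get the same exceptional probability \<open>1 / \<rho>\<close>.\<close>

lemma sample_markov:
  assumes "integrable (sample n) u" "\<And>x. 0 \<le> u x" "(\<integral>x. u x \<partial>sample n) \<le> e" "0 < e" "0 < \<rho>"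
  shows "{x \<in> space (sample n). u x \<ge> e * \<rho>} \<in> sets (sample n)"
    and "measure (sample n) {x \<in> space (sample n). u x \<ge> e * \<rho>} \<le> 1 / \<rho>"
proof -
  have [measurable]: "u \<in> borel_measurable (sample n)" using assms(1) by simp
  show "{x \<in> space (sample n). u x \<ge> e * \<rho>} \<in> sets (sample n)" by measurable
  have "measure (sample n) {x \<in> space (sample n). u x \<ge> e * \<rho>} \<le> (\<integral>x. u x \<partial>sample n) / (e * \<rho>)"
    using assms by (intro integral_Markov_inequality_measure[where A = "{}"]) auto
  also have "\<dots> \<le> e / (e * \<rho>)"
    using assms by (intro divide_right_mono) auto
  finally show "measure (sample n) {x \<in> space (sample n). u x \<ge> e * \<rho>} \<le> 1 / \<rho>"
    using assms by simp
qed

lemma integrable_prod_square: "i < m \<Longrightarrow> k < m \<Longrightarrow> integrable Q (\<lambda>z. (v z i * v z k)\<^sup>2)"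
proof (rule Bochner_Integration.integrable_bound[OF integrable_norm4])
  assume ik: "i < m" "k < m"
  then show "(\<lambda>z. (v z i * v z k)\<^sup>2) \<in> borel_measurable Q"
    by (intro borel_measurable_power borel_measurable_times measurable_v)
  show "AE z in Q. norm ((v z i * v z k)\<^sup>2) \<le> norm ((ip m (v z) (v z))\<^sup>2)"
  proof (rule AE_I2)
    fix z
    have "\<bar>v z i * v z k\<bar>\<^sup>2 \<le> (ip m (v z) (v z))\<^sup>2"
      using abs_prod_le[OF ik] by (intro power_mono) auto
    then show "norm ((v z i * v z k)\<^sup>2) \<le> norm ((ip m (v z) (v z))\<^sup>2)" by simp
  qed
qed

text \<open>The squared Frobenius distance of the sample second-moment matrix from the
  identity.\<close>

definition cov_error :: "nat \<Rightarrow> (nat \<Rightarrow> 'z) \<Rightarrow> real" where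
  "cov_error n x = (\<Sum>i<m. \<Sum>k<m. ((\<Sum>j=1..n. v (x j) i * v (x j) k) / n - (if i = k then 1 else 0))\<^sup>2)"

text \<open>Each entry is the average of independent centred variables, so its mean square is at
  most the second moment of \<open>v i * v k\<close> divided by \<open>n\<close>. Summed over all
  index pairs, these second moments give precisely the fourth moment of the norm.\<close>

lemma
  assumes n: "1 \<le> n"
  shows integrable_cov_error: "integrable (sample n) (cov_error n)"
    and integral_cov_error: "(\<integral>x. cov_error n x \<partial>sample n) \<le> C * (real m)\<^sup>2 / n"
proof -
  define u where "u i k z = v z i * v z k - (if i = k then 1 else 0)" for i k z
  have n0: "0 < real n" using n by simp
  have u_meas: "u i k \<in> borel_measurable Q" if "i < m" "k < m" for i k
    unfolding u_def using that by (intro borel_measurable_diff borel_measurable_times measurable_v borel_measurable_const)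
  have u_int: "integrable Q (\<lambda>z. (u i k z)\<^sup>2)" and u_mean: "(\<integral>z. u i k z \<partial>Q) = 0"
    and u_var: "(\<integral>z. (u i k z)\<^sup>2 \<partial>Q) \<le> (\<integral>z. (v z i * v z k)\<^sup>2 \<partial>Q)" if "i < m" "k < m" for i k
  proof -
    define d :: real where "d = (if i = k then 1 else 0)"
    have eq: "(u i k z)\<^sup>2 = (v z i * v z k)\<^sup>2 - 2 * d * (v z i * v z k) + d\<^sup>2" for z
      by (simp add: u_def d_def[symmetric] power2_diff mult_ac)
    show "integrable Q (\<lambda>z. (u i k z)\<^sup>2)"
      unfolding eq using that
      by (intro Bochner_Integration.integrable_add Bochner_Integration.integrable_diff
          integrable_mult_right integrable_prod integrable_prod_square integrable_const)
    show "(\<integral>z. u i k z \<partial>Q) = 0"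
      unfolding u_def using that by (simp add: integrable_prod orthonormal prob_space)
    have "(\<integral>z. (u i k z)\<^sup>2 \<partial>Q) = (\<integral>z. (v z i * v z k)\<^sup>2 \<partial>Q) - 2 * d * d + d\<^sup>2"
      unfolding eq using that orthonormal[OF that]
      by (simp add: integrable_prod integrable_prod_square prob_space d_def)
    then show "(\<integral>z. (u i k z)\<^sup>2 \<partial>Q) \<le> (\<integral>z. (v z i * v z k)\<^sup>2 \<partial>Q)" by (simp add: power2_eq_square)
  qed
  have eq: "cov_error n x = (\<Sum>i<m. \<Sum>k<m. (\<Sum>j=1..n. u i k (x j))\<^sup>2 / (real n)\<^sup>2)" for x
  proof -
    have "(\<Sum>j=1..n. v (x j) i * v (x j) k) / n - (if i = k then 1 else 0) = (\<Sum>j=1..n. u i k (x j)) / n" for i k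
      using n0 by (simp add: u_def sum_subtractf field_simps)
    then show ?thesis by (simp add: cov_error_def power_divide)
  qed
  show "integrable (sample n) (cov_error n)"
    unfolding eq using u_meas u_int u_mean
    by (intro Bochner_Integration.integrable_sum integrable_divide integrable_PiM_sum_square) auto
  have "(\<integral>x. cov_error n x \<partial>sample n) = (\<Sum>i<m. \<Sum>k<m. \<integral>x. (\<Sum>j=1..n. u i k (x j))\<^sup>2 / (real n)\<^sup>2 \<partial>sample n)"
  proof -
    have int: "integrable (sample n) (\<lambda>x. (\<Sum>j=1..n. u i k (x j))\<^sup>2 / (real n)\<^sup>2)" if "i < m" "k < m" for i k
      using u_meas u_int u_mean that by (intro integrable_divide integrable_PiM_sum_square) auto
    have "(\<integral>x. cov_error n x \<partial>sample n) = (\<Sum>i<m. \<integral>x. (\<Sum>k<m. (\<Sum>j=1..n. u i k (x j))\<^sup>2 / (real n)\<^sup>2) \<partial>sample n)"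
      unfolding eq using int by (intro Bochner_Integration.integral_sum Bochner_Integration.integrable_sum) auto
    also have "\<dots> = (\<Sum>i<m. \<Sum>k<m. \<integral>x. (\<Sum>j=1..n. u i k (x j))\<^sup>2 / (real n)\<^sup>2 \<partial>sample n)"
      using int by (intro sum.cong refl Bochner_Integration.integral_sum) auto
    finally show ?thesis .
  qed
  also have "\<dots> \<le> (\<Sum>i<m. \<Sum>k<m. (\<integral>z. (v z i * v z k)\<^sup>2 \<partial>Q) / n)"
  proof (intro sum_mono)
    fix i k assume "i \<in> {..<m}" "k \<in> {..<m}"
    then have ik: "i < m" "k < m" by auto
    have "(\<integral>x. (\<Sum>j=1..n. u i k (x j))\<^sup>2 / (real n)\<^sup>2 \<partial>sample n) = (\<integral>z. (u i k z)\<^sup>2 \<partial>Q) / n"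
      using integral_PiM_sum_square[OF u_meas[OF ik] u_int[OF ik] u_mean[OF ik], of n] n0
      by (simp add: power2_eq_square)
    then show "(\<integral>x. (\<Sum>j=1..n. u i k (x j))\<^sup>2 / (real n)\<^sup>2 \<partial>sample n) \<le> (\<integral>z. (v z i * v z k)\<^sup>2 \<partial>Q) / n"
      using u_var[OF ik] n0 by (simp add: divide_right_mono)
  qed
  also have "\<dots> = (\<integral>z. (ip m (v z) (v z))\<^sup>2 \<partial>Q) / n"
  proof -
    have "(ip m (v z) (v z))\<^sup>2 = (\<Sum>i<m. \<Sum>k<m. (v z i * v z k)\<^sup>2)" for z
      by (simp add: ip_def power2_eq_square sum_product mult_ac)
    moreover have "(\<integral>z. (\<Sum>i<m. \<Sum>k<m. (v z i * v z k)\<^sup>2) \<partial>Q) = (\<Sum>i<m. \<integral>z. (\<Sum>k<m. (v z i * v z k)\<^sup>2) \<partial>Q)"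
      using integrable_prod_square
      by (intro Bochner_Integration.integral_sum Bochner_Integration.integrable_sum) auto
    moreover have "\<dots> = (\<Sum>i<m. \<Sum>k<m. \<integral>z. (v z i * v z k)\<^sup>2 \<partial>Q)"
      using integrable_prod_square by (intro sum.cong refl Bochner_Integration.integral_sum) auto
    ultimately show ?thesis by (simp only: sum_divide_distrib)
  qed
  also have "\<dots> \<le> C * (real m)\<^sup>2 / n"
    using norm4_le by (intro divide_right_mono) auto
  finally show "(\<integral>x. cov_error n x \<partial>sample n) \<le> C * (real m)\<^sup>2 / n" .
qed

text \<open>This sum has a double use: it enters the cubic error term, and its square root bounds
  the largest squared norm in the sample.\<close>

lemma
  shows integrable_sum_norm4: "integrable (sample n) (\<lambda>x. \<Sum>j=1..n. (ip m (v (x j)) (v (x j)))\<^sup>2)"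
    and integral_sum_norm4: "(\<integral>x. (\<Sum>j=1..n. (ip m (v (x j)) (v (x j)))\<^sup>2) \<partial>sample n) \<le> n * (C * (real m)\<^sup>2)"
proof -
  have int: "integrable (sample n) (\<lambda>x. (ip m (v (x j)) (v (x j)))\<^sup>2)" if "j \<in> {1..n}" for j
    using integrable_PiM_component[OF integrable_norm4 that] .
  then show "integrable (sample n) (\<lambda>x. \<Sum>j=1..n. (ip m (v (x j)) (v (x j)))\<^sup>2)"
    by (intro Bochner_Integration.integrable_sum)
  have "(\<integral>x. (\<Sum>j=1..n. (ip m (v (x j)) (v (x j)))\<^sup>2) \<partial>sample n) = (\<Sum>j=1..n. \<integral>x. (ip m (v (x j)) (v (x j)))\<^sup>2 \<partial>sample n)"
    using int by (rule Bochner_Integration.integral_sum)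
  also have "\<dots> = (\<Sum>j=1..n. \<integral>z. (ip m (v z) (v z))\<^sup>2 \<partial>Q)"
  proof (intro sum.cong refl)
    fix j assume j: "j \<in> {1..n}"
    have "distr (sample n) Q (\<lambda>x. x j) = Q"
      using j prob_space_axioms by (intro distr_PiM_component[of "{1..n}" "\<lambda>_. Q" j]) auto
    then show "(\<integral>x. (ip m (v (x j)) (v (x j)))\<^sup>2 \<partial>sample n) = (\<integral>z. (ip m (v z) (v z))\<^sup>2 \<partial>Q)"
      using integral_distr[of "\<lambda>x. x j" "sample n" Q "\<lambda>z. (ip m (v z) (v z))\<^sup>2"] j by simp
  qed
  also have "\<dots> \<le> n * (C * (real m)\<^sup>2)"
    using norm4_le by (simp add: mult_left_mono)
  finally show "(\<integral>x. (\<Sum>j=1..n. (ip m (v (x j)) (v (x j)))\<^sup>2) \<partial>sample n) \<le> n * (C * (real m)\<^sup>2)" .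
qed

text \<open>Outside three Markov events, \<beta> is of order \<open>m / n\<close>, the covariance
  error of order \<open>m / sqrt n\<close> and \<open>G\<close> of order \<open>n m^2\<close>. The
  covariance error then contributes order \<open>m^2 / sqrt n\<close>, the cubic term
  \<open>sqrt m\<close> times as much; this \<open>sqrt m\<close> is absorbed by the normalisation
  of the statistic.\<close>

lemma neg2_log_emp_lik_near_psum_norm:
  fixes \<rho> :: real
  assumes n: "1 \<le> n" and \<rho>: "1 \<le> \<rho>"
    and small: "2 * (1 + C) * \<rho>\<^sup>2 * ((real m)\<^sup>2 / sqrt n) \<le> 1 / 64"
  obtains B where "B \<in> sets (sample n)" "measure (sample n) B \<le> 3 / \<rho>"
    "\<And>x. x \<in> space (sample n) - B \<Longrightarrow> \<exists>l. neg2_log (emp_lik n m (\<lambda>j. v (x j))) = ereal l \<and>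
        \<bar>l - psum_norm n x / n\<bar> \<le> 100 * (1 + C) * \<rho> ^ 3 * ((real m)\<^sup>2 / sqrt n) * sqrt m"
proof -
  define N where "N = real n"
  define r where "r = sqrt N"
  define D where "D = 1 + C"
  define M where "M = real m"
  define \<eta> where "\<eta> = M\<^sup>2 / r"
  have N1: "1 \<le> N" using n by (simp add: N_def)
  then have r1: "1 \<le> r" and Nr: "N = r\<^sup>2" by (auto simp: r_def)
  have r0: "0 < r" and N0: "0 < N" using r1 N1 by auto
  have D1: "1 \<le> D" using C_nonneg by (simp add: D_def)
  have M1: "1 \<le> M" using m_pos by (simp add: M_def)
  have \<eta>0: "0 \<le> \<eta>" using r0 by (simp add: \<eta>_def)
  have \<rho>0: "0 < \<rho>" using \<rho> by simp
  define B1 where "B1 = {x \<in> space (sample n). psum_norm n x \<ge> N * M * \<rho>}"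
  define B2 where "B2 = {x \<in> space (sample n). cov_error n x \<ge> D * M\<^sup>2 / N * \<rho>}"
  define B3 where "B3 = {x \<in> space (sample n). (\<Sum>j=1..n. (ip m (v (x j)) (v (x j)))\<^sup>2) \<ge> N * (D * M\<^sup>2) * \<rho>}"
  have B1: "B1 \<in> sets (sample n)" "measure (sample n) B1 \<le> 1 / \<rho>"
    unfolding B1_def using \<rho>0 N0 M1 integral_psum_norm[of n]
    by (intro sample_markov integrable_psum_norm; simp add: N_def M_def)+
  have "C * M\<^sup>2 / N \<le> D * M\<^sup>2 / N"
    using N0 by (intro divide_right_mono mult_right_mono) (auto simp: D_def)
  then have B2: "B2 \<in> sets (sample n)" "measure (sample n) B2 \<le> 1 / \<rho>"
    unfolding B2_def using \<rho>0 N0 M1 D1 integral_cov_error[OF n]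
    by (intro sample_markov integrable_cov_error n; simp add: cov_error_def N_def M_def sum_nonneg)+
  have "N * (C * M\<^sup>2) \<le> N * (D * M\<^sup>2)"
    using N0 by (intro mult_left_mono mult_right_mono) (auto simp: D_def)
  with integral_sum_norm4[of n]
  have "(\<integral>x. (\<Sum>j=1..n. (ip m (v (x j)) (v (x j)))\<^sup>2) \<partial>sample n) \<le> N * (D * M\<^sup>2)"
    unfolding N_def M_def by (rule order_trans)
  then have B3: "B3 \<in> sets (sample n)" "measure (sample n) B3 \<le> 1 / \<rho>"
    unfolding B3_def using \<rho>0 N0 M1 D1
    by (intro sample_markov integrable_sum_norm4; simp add: sum_nonneg)+
  interpret S: prob_space "sample n" by (rule prob_space_sample)
  show ?thesis
  proof (rule that)
    show "B1 \<union> B2 \<union> B3 \<in> sets (sample n)" using B1 B2 B3 by auto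
    have "measure (sample n) (B1 \<union> B2 \<union> B3) \<le> measure (sample n) B1 + measure (sample n) B2 + measure (sample n) B3"
      using B1 B2 B3 by (intro order_trans[OF measure_Un_le] add_right_mono measure_Un_le) auto
    then show "measure (sample n) (B1 \<union> B2 \<union> B3) \<le> 3 / \<rho>" using B1 B2 B3 by linarith
  next
    fix x assume "x \<in> space (sample n) - (B1 \<union> B2 \<union> B3)"
    then have b1: "psum_norm n x \<le> N * M * \<rho>" and b2: "cov_error n x \<le> D * M\<^sup>2 / N * \<rho>"
      and b3: "(\<Sum>j=1..n. (ip m (v (x j)) (v (x j)))\<^sup>2) \<le> N * (D * M\<^sup>2) * \<rho>"
      by (auto simp: B1_def B2_def B3_def)
    define b where "b i = (\<Sum>j=1..n. v (x j) i) / real n" for i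
    define \<beta> where "\<beta> = ip m b b"
    have \<beta>_eq: "\<beta> = psum_norm n x / N\<^sup>2"
    proof -
      have "b i = psum n x i / N" for i by (simp add: b_def psum_def N_def)
      then show ?thesis by (simp add: \<beta>_def ip_def sum_divide_distrib power2_eq_square)
    qed
    have \<beta>0: "0 \<le> \<beta>" by (simp add: \<beta>_def)
    have \<beta>: "\<beta> \<le> M * \<rho> / N"
      unfolding \<beta>_eq using divide_right_mono[OF b1, of "N\<^sup>2"] N0 by (simp add: power2_eq_square)
    have M2: "M \<le> M\<^sup>2" using M1 by (simp add: power2_eq_square)
    \<comment> \<open>Markov gives the bound with \<open>sqrt (D * \<rho>)\<close>; as
      \<open>D * \<rho>\<close> is at least 1, the root is dropped.\<close>
    define e where "e = D * \<rho> * M / r"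
    have e0: "0 \<le> e" using D1 \<rho>0 M1 r0 by (simp add: e_def)
    have sq_le: "y \<le> y\<^sup>2" if "1 \<le> y" for y :: real
      using that by (simp add: power2_eq_square)
    have cov: "cov_error n x \<le> e\<^sup>2"
    proof -
      have "D * \<rho> \<le> (D * \<rho>)\<^sup>2" using D1 \<rho> by (intro sq_le) (simp add: mult_ge1_I)
      then have "D * \<rho> * (M\<^sup>2 / N) \<le> (D * \<rho>)\<^sup>2 * (M\<^sup>2 / N)" using N0 by (intro mult_right_mono) auto
      with b2 show ?thesis by (simp add: e_def power_divide power_mult_distrib Nr mult_ac)
    qed
    have \<beta>_r: "\<beta> \<le> \<rho> * M / r"
    proof -
      have "M * \<rho> / N \<le> M * \<rho> / r"
        using M1 \<rho>0 r1 by (intro divide_left_mono) (auto simp: Nr power2_eq_square)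
      with \<beta> show ?thesis by (simp add: mult_ac)
    qed
    have e\<beta>: "e + \<beta> \<le> 2 * D * \<rho> * M / r"
    proof -
      have "1 * (\<rho> * M / r) \<le> D * (\<rho> * M / r)" using D1 \<rho>0 M1 r0 by (intro mult_right_mono) auto
      moreover have "e = D * (\<rho> * M / r)" by (simp add: e_def)
      moreover have "2 * D * \<rho> * M / r = 2 * (D * (\<rho> * M / r))" by simp
      ultimately show ?thesis using \<beta>_r by linarith
    qed
    have \<rho>2: "\<rho> \<le> \<rho>\<^sup>2" by (rule sq_le[OF \<rho>])
    have small': "2 * D * \<rho>\<^sup>2 * \<eta> \<le> 1 / 64"
      using small by (simp add: D_def \<eta>_def M_def r_def N_def)
    have "2 * D * \<rho> * M / r \<le> 2 * D * \<rho>\<^sup>2 * \<eta>"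
    proof -
      have "2 * D * \<rho> * M / r \<le> 2 * D * \<rho>\<^sup>2 * M\<^sup>2 / r"
        using D1 \<rho>0 M1 r0 M2 \<rho>2 by (intro divide_right_mono mult_mono) auto
      then show ?thesis by (simp add: \<eta>_def)
    qed
    with e\<beta> small' have e\<beta>_small: "e + \<beta> \<le> 1 / 64" by linarith
    define F where "F = (\<Sum>j=1..n. (ip m (v (x j)) (v (x j)))\<^sup>2)"
    have F0: "0 \<le> F" by (simp add: F_def sum_nonneg)
    define G where "G = 2 * D * \<rho>\<^sup>2 * N * M\<^sup>2"
    \<comment> \<open>A single fourth power is at most the sum of all of them, so each squared norm
      is at most of order \<open>m * sqrt n\<close>, while \<beta> is of order
      \<open>m / n\<close>.\<close>
    have \<beta>j: "\<beta> * ip m (v (x j)) (v (x j)) \<le> 1 / 64" if j: "j \<in> {1..n}" for j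
    proof -
      define h where "h = ip m (v (x j)) (v (x j))"
      have "h\<^sup>2 \<le> F" unfolding F_def h_def using j by (intro member_le_sum) auto
      also have "F \<le> N * (D * M\<^sup>2) * \<rho>" using b3 by (simp add: F_def)
      also have "\<dots> \<le> (D * \<rho> * M * r)\<^sup>2"
      proof -
        have "D * \<rho> \<le> (D * \<rho>)\<^sup>2" using D1 \<rho> by (intro sq_le) (simp add: mult_ge1_I)
        then have "D * \<rho> * (M\<^sup>2 * N) \<le> (D * \<rho>)\<^sup>2 * (M\<^sup>2 * N)" using N0 by (intro mult_right_mono) auto
        then show ?thesis by (simp add: power_mult_distrib Nr mult_ac)
      qed
      finally have h: "h \<le> D * \<rho> * M * r"
        using D1 \<rho>0 M1 r0 by (intro power2_le_imp_le[of h]) auto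
      have "\<beta> * h \<le> (M * \<rho> / N) * (D * \<rho> * M * r)"
        using \<beta> h \<beta>0 M1 \<rho>0 N0 by (intro mult_mono) (auto simp: h_def)
      also have "\<dots> = D * \<rho>\<^sup>2 * \<eta>"
        using r0 by (simp add: \<eta>_def Nr power2_eq_square)
      also have "\<dots> \<le> 1 / 64"
      proof -
        have "0 \<le> D * \<rho>\<^sup>2 * \<eta>" using D1 \<eta>0 by simp
        then show ?thesis using small' by linarith
      qed
      finally show ?thesis by (simp add: h_def)
    qed
    have FG: "F + n * \<beta>\<^sup>2 \<le> G"
    proof -
      have "F \<le> D * (\<rho> * (N * M\<^sup>2))" using b3 by (simp add: F_def mult_ac)
      also have "\<dots> \<le> D * (\<rho>\<^sup>2 * (N * M\<^sup>2))"
        using \<rho>2 D1 N0 by (intro mult_left_mono mult_right_mono) auto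
      finally have 1: "F \<le> D * (\<rho>\<^sup>2 * (N * M\<^sup>2))" .
      have "\<beta>\<^sup>2 \<le> (M * \<rho>)\<^sup>2"
      proof (rule power_mono[OF _ \<beta>0])
        have "M * \<rho> / N \<le> M * \<rho> / 1" using N1 M1 \<rho>0 by (intro divide_left_mono) auto
        with \<beta> show "\<beta> \<le> M * \<rho>" by simp
      qed
      then have "N * \<beta>\<^sup>2 \<le> N * (M * \<rho>)\<^sup>2" using N0 by (intro mult_left_mono) auto
      also have "\<dots> = 1 * (\<rho>\<^sup>2 * (N * M\<^sup>2))" by (simp add: power_mult_distrib mult_ac)
      also have "\<dots> \<le> D * (\<rho>\<^sup>2 * (N * M\<^sup>2))" using D1 N0 by (intro mult_right_mono) auto
      finally show ?thesis using 1 by (simp add: G_def N_def mult_ac)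
    qed
    have half: "e + \<beta> \<le> 1 / 2" and eighth: "\<beta> \<le> 1 / 8"
      using e\<beta>_small e0 by linarith+
    obtain l where l: "neg2_log (emp_lik n m (\<lambda>j. v (x j))) = ereal l"
      "\<bar>l - real n * \<beta>\<bar> \<le> 2 * real n * \<beta> * (e + \<beta>) + 32 * sqrt (real n * \<beta> ^ 3 * G)"
      by (rule neg2_log_emp_lik_approx[where n = n and m = m and e = e and a = "\<lambda>j. v (x j)" and G = G and b = b,
            folded \<beta>_def,
            OF n b_def e0 cov[unfolded cov_error_def] half eighth \<beta>j FG[unfolded F_def]])
    have n\<beta>: "real n * \<beta> = psum_norm n x / n"
      using N0 by (simp add: \<beta>_eq N_def power2_eq_square)
    have N\<beta>: "N * \<beta> \<le> M * \<rho>" using mult_left_mono[OF \<beta>, of N] N0 by simp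
    define sM where "sM = sqrt M"
    have sM: "1 \<le> sM" "sM\<^sup>2 = M" using M1 by (auto simp: sM_def)
    have \<rho>3: "\<rho>\<^sup>2 \<le> \<rho> ^ 3" using \<rho> by (intro power_increasing) auto
    have t1: "2 * N * \<beta> * (e + \<beta>) \<le> 4 * (D * \<rho> ^ 3 * \<eta> * sM)"
    proof -
      have "2 * (N * \<beta>) * (e + \<beta>) \<le> 2 * (M * \<rho>) * (2 * D * \<rho> * M / r)"
      proof (rule mult_mono[OF _ e\<beta>])
        show "2 * (N * \<beta>) \<le> 2 * (M * \<rho>)" using N\<beta> by linarith
      qed (use \<beta>0 e0 M1 \<rho>0 in auto)
      also have "\<dots> = 4 * (D * \<rho>\<^sup>2 * \<eta> * 1)" by (simp add: \<eta>_def power2_eq_square)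
      also have "\<dots> \<le> 4 * (D * \<rho> ^ 3 * \<eta> * sM)"
        using \<rho>3 sM D1 \<eta>0 \<rho>0 by (intro mult_left_mono mult_mono) auto
      finally show ?thesis by (simp add: mult_ac)
    qed
    \<comment> \<open>Up to constants the radicand is
      \<open>N * (M / N)^3 * N * M^2 = M^5 / N\<close>, that is
      \<open>\<eta>\<^sup>2 * M\<close>.\<close>
    have t2: "sqrt (real n * \<beta> ^ 3 * G) \<le> 2 * (D * \<rho> ^ 3 * \<eta> * sM)"
    proof (rule real_le_lsqrt)
      have "real n * \<beta> ^ 3 * G \<le> N * (M * \<rho> / N) ^ 3 * G"
        unfolding N_def[symmetric] using \<beta> \<beta>0 N0 D1 \<rho>0
        by (intro mult_right_mono mult_left_mono power_mono) (auto simp: G_def)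
      also have "\<dots> = 2 * D * \<rho> ^ 5 * M ^ 5 / N"
        unfolding G_def using N0 by (simp add: field_simps power_numeral_reduce)
      also have "\<dots> \<le> 4 * D\<^sup>2 * \<rho> ^ 6 * M ^ 5 / N"
      proof (intro divide_right_mono mult_right_mono)
        show "2 * D * \<rho> ^ 5 \<le> 4 * D\<^sup>2 * \<rho> ^ 6"
        proof (rule mult_mono)
          show "2 * D \<le> 4 * D\<^sup>2" using sq_le[OF D1] D1 by linarith
          show "\<rho> ^ 5 \<le> \<rho> ^ 6" using \<rho> by (intro power_increasing) auto
        qed (use D1 \<rho>0 in auto)
      qed (use M1 N0 in auto)
      also have "\<dots> = (2 * (D * \<rho> ^ 3 * \<eta> * sM))\<^sup>2"
        unfolding \<eta>_def power_mult_distrib power_divide sM Nr using r0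
        by (simp add: field_simps power_numeral_reduce)
      finally show "real n * \<beta> ^ 3 * G \<le> (2 * (D * \<rho> ^ 3 * \<eta> * sM))\<^sup>2" .
    qed (use D1 \<rho>0 \<eta>0 sM in auto)
    \<comment> \<open>The two contributions add up to 4 + 32 * 2 = 68, rounded up to 100.\<close>
    have "\<bar>l - psum_norm n x / n\<bar> \<le> 100 * (D * \<rho> ^ 3 * \<eta> * sM)"
    proof -
      have "0 \<le> D * \<rho> ^ 3 * \<eta> * sM" using D1 \<rho>0 \<eta>0 sM by simp
      with l(2) t1 t2 show ?thesis unfolding n\<beta> N_def by linarith
    qed
    also have "100 * (D * \<rho> ^ 3 * \<eta> * sM) = 100 * (1 + C) * \<rho> ^ 3 * ((real m)\<^sup>2 / sqrt n) * sqrt m"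
      by (simp only: D_def \<eta>_def M_def r_def N_def sM_def mult.assoc)
    finally show "\<exists>l. neg2_log (emp_lik n m (\<lambda>j. v (x j))) = ereal l \<and>
        \<bar>l - psum_norm n x / n\<bar> \<le> 100 * (1 + C) * \<rho> ^ 3 * ((real m)\<^sup>2 / sqrt n) * sqrt m"
      using l(1) by blast
  qed
qed

end

section \<open>Convergence in distribution\<close>

text \<open>A Slutsky argument for extended real variables: outside a small event \<open>X n\<close>
  is finite and within \<delta> of \<open>T n\<close>, so its distribution function is squeezed
  between those of \<open>T n\<close> at points shifted by \<delta>. Continuity of the limit removes
  the shift.\<close>

lemma conv_in_distribution_approx:
  fixes X :: "nat \<Rightarrow> 'a \<Rightarrow> ereal" and T :: "nat \<Rightarrow> 'a \<Rightarrow> real"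
  assumes M: "prob_space M"
    and X: "\<And>n. X n \<in> borel_measurable M" and T: "\<And>n. T n \<in> borel_measurable M"
    and conv: "weak_conv_m (\<lambda>n. distr M borel (T n)) L"
    and cont: "\<And>x. isCont (cdf L) x"
    and close: "\<And>\<epsilon> \<delta> :: real. 0 < \<epsilon> \<Longrightarrow> 0 < \<delta> \<Longrightarrow> \<forall>\<^sub>F n in sequentially. \<exists>B\<in>sets M. measure M B \<le> \<epsilon> \<and>
      (\<forall>\<omega>\<in>space M - B. \<exists>y. X n \<omega> = ereal y \<and> \<bar>y - T n \<omega>\<bar> \<le> \<delta>)"
  shows "conv_in_distribution M X L"
  unfolding conv_in_distribution_def weak_conv_def
proof (intro conjI allI impI X)
  fix x
  interpret prob_space M by fact
  define p where "p n = measure M {\<omega> \<in> space M. X n \<omega> \<le> ereal x}" for n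
  have T_conv: "(\<lambda>n. measure M {\<omega> \<in> space M. T n \<omega> \<le> y}) \<longlonglongrightarrow> cdf L y" for y
  proof -
    have eq: "cdf (distr M borel (T n)) y = measure M {\<omega> \<in> space M. T n \<omega> \<le> y}" for n
    proof -
      have "T n -` {..y} \<inter> space M = {\<omega> \<in> space M. T n \<omega> \<le> y}" by auto
      then show ?thesis using T[of n] by (simp add: cdf_def measure_distr)
    qed
    show ?thesis
      using conv cont unfolding weak_conv_m_def weak_conv_def eq[symmetric] by blast
  qed
  show "p \<longlonglongrightarrow> cdf L x"
  proof (rule LIMSEQ_I)
    fix r :: real assume "0 < r"
    \<comment> \<open>Three errors of this size occur: the exceptional event, the convergence of
      \<open>T n\<close> at the shifted point, and the modulus of continuity of the limit.\<close>
    define \<epsilon> where "\<epsilon> = r / 4"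
    have \<epsilon>: "0 < \<epsilon>" using \<open>0 < r\<close> by (simp add: \<epsilon>_def)
    obtain d where d: "0 < d" "\<And>y. \<bar>y - x\<bar> < d \<Longrightarrow> \<bar>cdf L y - cdf L x\<bar> < \<epsilon>"
      using cont[of x] \<epsilon> unfolding continuous_at_eps_delta by (auto simp: dist_real_def)
    define \<delta> where "\<delta> = d / 2"
    have \<delta>: "0 < \<delta>" using d by (simp add: \<delta>_def)
    have F: "\<bar>cdf L (x + \<delta>) - cdf L x\<bar> < \<epsilon>" "\<bar>cdf L (x - \<delta>) - cdf L x\<bar> < \<epsilon>"
      using d by (auto intro!: d(2) simp: \<delta>_def)
    have ev: "\<forall>\<^sub>F n in sequentially. \<bar>measure M {\<omega> \<in> space M. T n \<omega> \<le> y} - cdf L y\<bar> < \<epsilon>" for y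
      using tendstoD[OF T_conv \<epsilon>] by (simp add: dist_real_def)
    have "\<forall>\<^sub>F n in sequentially. norm (p n - cdf L x) < r"
      using ev[of "x + \<delta>"] ev[of "x - \<delta>"] close[OF \<epsilon> \<delta>]
    proof eventually_elim
      case (elim n)
      then obtain B where B: "B \<in> sets M" "measure M B \<le> \<epsilon>"
        and XT: "\<And>\<omega>. \<omega> \<in> space M - B \<Longrightarrow> \<exists>y. X n \<omega> = ereal y \<and> \<bar>y - T n \<omega>\<bar> \<le> \<delta>" by blast
      have [measurable]: "X n \<in> borel_measurable M" "T n \<in> borel_measurable M" using X T by auto
      have set: "{\<omega> \<in> space M. X n \<omega> \<le> ereal x} \<in> sets M" "{\<omega> \<in> space M. T n \<omega> \<le> y} \<in> sets M" for y
        by measurable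
      have "p n \<le> measure M ({\<omega> \<in> space M. T n \<omega> \<le> x + \<delta>} \<union> B)"
        unfolding p_def
      proof (intro finite_measure_mono sets.Un set B subsetI)
        fix \<omega> assume \<omega>: "\<omega> \<in> {\<omega> \<in> space M. X n \<omega> \<le> ereal x}"
        show "\<omega> \<in> {\<omega> \<in> space M. T n \<omega> \<le> x + \<delta>} \<union> B"
        proof (cases "\<omega> \<in> B")
          case False
          with XT[of \<omega>] \<omega> show ?thesis by (auto simp: abs_le_iff)
        qed simp
      qed
      also have "\<dots> \<le> measure M {\<omega> \<in> space M. T n \<omega> \<le> x + \<delta>} + measure M B"
        by (intro measure_Un_le set B)
      finally have upper: "p n \<le> measure M {\<omega> \<in> space M. T n \<omega> \<le> x + \<delta>} + \<epsilon>" using B by linarith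
      have "measure M {\<omega> \<in> space M. T n \<omega> \<le> x - \<delta>} \<le> measure M ({\<omega> \<in> space M. X n \<omega> \<le> ereal x} \<union> B)"
      proof (intro finite_measure_mono sets.Un set B subsetI)
        fix \<omega> assume \<omega>: "\<omega> \<in> {\<omega> \<in> space M. T n \<omega> \<le> x - \<delta>}"
        show "\<omega> \<in> {\<omega> \<in> space M. X n \<omega> \<le> ereal x} \<union> B"
        proof (cases "\<omega> \<in> B")
          case False
          with XT[of \<omega>] \<omega> show ?thesis by (auto simp: abs_le_iff)
        qed simp
      qed
      also have "\<dots> \<le> p n + measure M B"
        unfolding p_def by (intro measure_Un_le set B)
      finally have lower: "measure M {\<omega> \<in> space M. T n \<omega> \<le> x - \<delta>} \<le> p n + \<epsilon>" using B by linarith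
      show "norm (p n - cdf L x) < r"
        using upper lower elim(1,2) F unfolding \<epsilon>_def real_norm_def by linarith
    qed
    then show "\<exists>no. \<forall>n\<ge>no. norm (p n - cdf L x) < r" by (simp add: eventually_sequentially)
  qed
qed

lemma isCont_cdf_std_normal: "isCont (cdf std_normal_distribution) x"
proof -
  interpret real_distribution std_normal_distribution by (rule real_dist_normal_dist)
  have "emeasure std_normal_distribution {x} = (\<integral>\<^sup>+y. ennreal (std_normal_density y) * indicator {x} y \<partial>lborel)"
    by (rule emeasure_density) auto
  also have "\<dots> = 0"
    by (rule nn_integral_null_set) (rule finite_imp_null_set_lborel, simp)
  finally show ?thesis
    by (simp add: isCont_cdf measure_def)
qed

lemma measurable_neg2_log [measurable]: "neg2_log \<in> borel_measurable borel"
  unfolding neg2_log_def by measurable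

section \<open>Passage from the given functions to orthonormal ones\<close>

lemma regular_dispersion_lower:
  assumes "regular_dispersion m W"
  obtains c where "0 < c" "\<And>n u. 1 \<le> n \<Longrightarrow> c * ip (m n) u u \<le> quad_form (m n) (W n) u"
proof -
  define I where "I = (INF n\<in>{1..}. INF u\<in>{u. L2_set u {..<m n} = 1}. ereal (quad_form (m n) (W n) u))"
  have "0 < I" using assms by (simp add: regular_dispersion_def I_def)
  \<comment> \<open>The infimum is an extended real and may be infinite, so a real \<open>c\<close>
    strictly between 0 and it is chosen. Homogeneity of degree two then extends the bound from unit
    vectors to all vectors.\<close>
  then obtain c where c: "0 < ereal c" "ereal c < I" using ereal_dense2 by blast
  have unit: "c \<le> quad_form (m n) (W n) u" if "1 \<le> n" "L2_set u {..<m n} = 1" for n u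
  proof -
    have "I \<le> ereal (quad_form (m n) (W n) u)"
      unfolding I_def using that by (intro INF_lower2[of n] INF_lower2[of u]) auto
    with c(2) have "ereal c < ereal (quad_form (m n) (W n) u)" by (rule less_le_trans)
    then show ?thesis by simp
  qed
  show ?thesis
  proof (rule that)
    show "0 < c" using c by simp
    fix n u assume n: "1 \<le> (n :: nat)"
    define l where "l = L2_set u {..<m n}"
    have l2: "l\<^sup>2 = ip (m n) u u"
      by (simp add: l_def L2_set_def ip_def sum_nonneg power2_eq_square[symmetric])
    show "c * ip (m n) u u \<le> quad_form (m n) (W n) u"
    proof (cases "l = 0")
      case True
      then have "\<And>i. i < m n \<Longrightarrow> u i = 0" by (simp add: l_def L2_set_eq_0_iff)
      then show ?thesis by (simp add: ip_def quad_form_def)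
    next
      case False
      then have "0 < l" using L2_set_nonneg[of u "{..<m n}"] unfolding l_def by linarith
      define w where "w i = u i / l" for i
      have "L2_set w {..<m n} = L2_set (\<lambda>i. (1 / l) * u i) {..<m n}" by (simp add: w_def[abs_def])
      also have "\<dots> = (1 / l) * L2_set u {..<m n}"
        using \<open>0 < l\<close> by (intro L2_set_right_distrib[symmetric]) auto
      also have "\<dots> = 1" using \<open>0 < l\<close> by (simp add: l_def)
      finally have "c \<le> quad_form (m n) (W n) w" by (rule unit[OF n])
      moreover have "quad_form (m n) (W n) w = quad_form (m n) (W n) u / l\<^sup>2"
        by (simp add: quad_form_def w_def sum_divide_distrib power2_eq_square)
      ultimately show ?thesis using \<open>0 < l\<close> by (simp add: l2[symmetric] field_simps)
    qed
  qed
qed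

text \<open>Orthonormality is the whitening identity integrated entry by entry. Whitening enlarges
  the squared norm by a factor of at most \<open>1 / c\<close>, hence the fourth power of the norm
  by at most \<open>1 / c\<^sup>2\<close>; this bound does not involve the dimension.\<close>

lemma orthonormal_features_whitened:
  fixes w :: "'z \<Rightarrow> nat \<Rightarrow> real"
  assumes Q: "prob_space Q" and m: "1 \<le> m"
    and meas: "\<And>i. i < m \<Longrightarrow> (\<lambda>z. w z i) \<in> borel_measurable Q"
    and mean: "\<And>i. i < m \<Longrightarrow> (\<integral>z. w z i \<partial>Q) = 0"
    and int4: "integrable Q (\<lambda>z. (ip m (w z) (w z))\<^sup>2)"
    and le4: "(\<integral>z. (ip m (w z) (w z))\<^sup>2 \<partial>Q) \<le> K * (real m)\<^sup>2"
    and c: "0 < c" "\<And>u. c * ip m u u \<le> quad_form m (\<lambda>i k. \<integral>z. w z i * w z k \<partial>Q) u"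
  obtains A where "whitens m (\<lambda>i k. \<integral>z. w z i * w z k \<partial>Q) A"
    "orthonormal_features Q m (\<lambda>z i. ip m (A i) (w z)) (K / c\<^sup>2)"
proof -
  interpret prob_space Q by fact
  define W where "W i k = (\<integral>z. w z i * w z k \<partial>Q)" for i k
  have norm_meas: "(\<lambda>z. ip m (w z) (w z)) \<in> borel_measurable Q"
    unfolding ip_def using meas by (intro borel_measurable_sum borel_measurable_times) auto
  have int2: "integrable Q (\<lambda>z. ip m (w z) (w z))"
    by (rule square_integrable_imp_integrable[OF norm_meas int4])
  have int_prod: "integrable Q (\<lambda>z. w z i * w z k)" if "i < m" "k < m" for i k
  proof (rule Bochner_Integration.integrable_bound[OF int2])
    show "(\<lambda>z. w z i * w z k) \<in> borel_measurable Q" using meas that by (intro borel_measurable_times)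
    have sq: "(w z i)\<^sup>2 \<le> ip m (w z) (w z)" if "i < m" for i z
      unfolding ip_def power2_eq_square using that by (intro member_le_sum) auto
    have "\<bar>w z i * w z k\<bar> \<le> ip m (w z) (w z)" for z
    proof -
      have "2 * \<bar>w z i * w z k\<bar> \<le> (w z i)\<^sup>2 + (w z k)\<^sup>2"
        using sum_squares_bound[of "\<bar>w z i\<bar>" "\<bar>w z k\<bar>"] by (simp add: abs_mult)
      with sq[OF that(1), of z] sq[OF that(2), of z] show ?thesis by linarith
    qed
    then show "AE z in Q. norm (w z i * w z k) \<le> norm (ip m (w z) (w z))" by (intro AE_I2) simp
  qed
  have int1: "integrable Q (\<lambda>z. w z i)" if "i < m" for i
    using square_integrable_imp_integrable[OF meas[OF that]] int_prod[OF that that]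
    by (simp add: power2_eq_square)
  have "\<exists>A. whitens m W A"
  proof (rule whitens_exists)
    fix u :: "nat \<Rightarrow> real" assume "\<exists>i<m. u i \<noteq> 0"
    then have "0 < ip m u u"
      unfolding ip_def by (auto intro!: sum_pos2 simp: zero_less_mult_iff neq_iff)
    then have "0 < c * ip m u u" using c by simp
    also have "\<dots> \<le> quad_form m W u" using c(2)[of u] by (simp add: W_def[abs_def])
    finally show "0 < quad_form m W u" .
  qed (simp add: W_def mult.commute)
  then obtain A where A: "whitens m W A" ..
  define v where "v z i = ip m (A i) (w z)" for z i
  have v_le: "(ip m (v z) (v z))\<^sup>2 \<le> (ip m (w z) (w z))\<^sup>2 / c\<^sup>2" for z
  proof -
    have "ip m (v z) (v z) \<le> ip m (w z) (w z) / c"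
      unfolding v_def using c by (intro whitens_norm_le[OF A]) (auto simp: W_def[abs_def])
    from power_mono[OF this, of 2] show ?thesis by (simp add: power_divide)
  qed
  have v_meas: "(\<lambda>z. v z i) \<in> borel_measurable Q" if "i < m" for i
    unfolding v_def ip_def using meas by (intro borel_measurable_sum borel_measurable_times) auto
  have v_int4: "integrable Q (\<lambda>z. (ip m (v z) (v z))\<^sup>2)"
  proof (rule Bochner_Integration.integrable_bound[of _ "\<lambda>z. (ip m (w z) (w z))\<^sup>2 / c\<^sup>2"])
    show "(\<lambda>z. (ip m (v z) (v z))\<^sup>2) \<in> borel_measurable Q"
      unfolding ip_def using v_meas by (intro borel_measurable_power borel_measurable_sum borel_measurable_times) auto
  qed (use int4 v_le in auto)
  have "orthonormal_features Q m v (K / c\<^sup>2)"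
  proof
    show "(\<lambda>z. v z i) \<in> borel_measurable Q" if "i < m" for i by (rule v_meas[OF that])
    show "integrable Q (\<lambda>z. (ip m (v z) (v z))\<^sup>2)" by fact
    show "(\<integral>z. v z i \<partial>Q) = 0" if "i < m" for i
      unfolding v_def ip_def using int1 mean by (subst Bochner_Integration.integral_sum) auto
    show "(\<integral>z. v z i * v z k \<partial>Q) = (if i = k then 1 else 0)" if "i < m" "k < m" for i k
    proof -
      have "(\<integral>z. v z i * v z k \<partial>Q) = (\<integral>z. (\<Sum>p<m. \<Sum>q<m. A i p * A k q * (w z p * w z q)) \<partial>Q)"
        unfolding v_def ip_def sum_product by (simp add: mult_ac)
      also have "\<dots> = (\<Sum>p<m. \<Sum>q<m. A i p * A k q * W p q)"
      proof -
        have int: "integrable Q (\<lambda>z. A i p * A k q * (w z p * w z q))" if "p < m" "q < m" for p q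
          using int_prod[OF that] by (rule integrable_mult_right)
        have "(\<integral>z. (\<Sum>p<m. \<Sum>q<m. A i p * A k q * (w z p * w z q)) \<partial>Q)
            = (\<Sum>p<m. \<integral>z. (\<Sum>q<m. A i p * A k q * (w z p * w z q)) \<partial>Q)"
          by (intro Bochner_Integration.integral_sum Bochner_Integration.integrable_sum int) auto
        also have "\<dots> = (\<Sum>p<m. \<Sum>q<m. \<integral>z. A i p * A k q * (w z p * w z q) \<partial>Q)"
          by (intro sum.cong refl Bochner_Integration.integral_sum int) auto
        finally show ?thesis by (simp add: W_def)
      qed
      also have "\<dots> = (\<Sum>p<m. \<Sum>q<m. A i p * W p q * A k q)" by (simp add: mult_ac)
      also have "\<dots> = (if i = k then 1 else 0)" using A that by (simp add: whitens_def)
      finally show ?thesis .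
    qed
    have "(\<integral>z. (ip m (v z) (v z))\<^sup>2 \<partial>Q) \<le> (\<integral>z. (ip m (w z) (w z))\<^sup>2 / c\<^sup>2 \<partial>Q)"
      using v_int4 int4 v_le by (intro integral_mono) auto
    also have "\<dots> \<le> K * (real m)\<^sup>2 / c\<^sup>2"
      using le4 by (simp add: divide_right_mono)
    finally show "(\<integral>z. (ip m (v z) (v z))\<^sup>2 \<partial>Q) \<le> K / c\<^sup>2 * (real m)\<^sup>2" by simp
  qed (rule m)
  with A show ?thesis using that by (simp add: v_def[abs_def] W_def[abs_def])
qed

theorem theorem7p2:
  fixes M :: "'a measure" and Q :: "'z measure"
    and Z :: "nat \<Rightarrow> 'a \<Rightarrow> 'z"
    and m :: "nat \<Rightarrow> nat"
    and w :: "nat \<Rightarrow> 'z \<Rightarrow> nat \<Rightarrow> real"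
  assumes "prob_space M"
    and "prob_space.indep_vars M (\<lambda>_. Q) Z {1..}"
    and "\<And>j. j \<ge> 1 \<Longrightarrow> distr M Q (Z j) = Q"
    and "\<And>n. n \<ge> 1 \<Longrightarrow> m n \<ge> 1"
    and "filterlim m at_top sequentially"
    and "\<And>n i. n \<ge> 1 \<Longrightarrow> i < m n \<Longrightarrow> (\<lambda>z. w n z i) \<in> borel_measurable Q"
    and "\<And>n. n \<ge> 1 \<Longrightarrow> integrable Q (\<lambda>z. (L2_set (w n z) {..<m n})\<^sup>2)"
    and "\<And>n i. n \<ge> 1 \<Longrightarrow> i < m n \<Longrightarrow> (\<integral>z. w n z i \<partial>Q) = 0"
    and "regular_dispersion m (\<lambda>n i k. \<integral>z. w n z i * w n z k \<partial>Q)"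
    and "\<forall>\<^sub>F n in sequentially. integrable Q (\<lambda>z. (L2_set (w n z) {..<m n}) ^ 4)"
    and "(\<lambda>n. \<integral>z. (L2_set (w n z) {..<m n}) ^ 4 \<partial>Q) \<in> O(\<lambda>n. real (m n) ^ 2)"
    and "(\<lambda>n. real (m n) ^ 4) \<in> o(\<lambda>n. real n)"
  shows "conv_in_distribution M
    (\<lambda>n \<omega>. (neg2_log (emp_lik n (m n) (\<lambda>j. w n (Z j \<omega>))) - ereal (real (m n)))
              / ereal (sqrt (2 * real (m n))))
    std_normal_distribution"
proof -
  interpret M: prob_space M by fact
  have Z: "Z j \<in> measurable M Q" if "1 \<le> j" for j
    using assms(2) that by (simp add: M.indep_vars_def2)
  have Q: "prob_space Q"
    using M.prob_space_distr[OF Z[of 1]] assms(3)[of 1] by simp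
  \<comment> \<open>The first \<open>n\<close> observations as one random element of the product
    space. Independence and equal laws make its distribution the product measure, to which the
    sample estimates apply.\<close>
  define zz where "zz n \<omega> = (\<lambda>j\<in>{1..n}. Z j \<omega>)" for n \<omega>
  have zz: "zz n \<in> measurable M (PiM {1..n} (\<lambda>_. Q))" for n
    unfolding zz_def by (intro measurable_restrict Z) auto
  have distr_zz: "distr M (PiM {1..n} (\<lambda>_. Q)) (zz n) = PiM {1..n} (\<lambda>_. Q)" if "1 \<le> n" for n
  proof -
    have "M.indep_vars (\<lambda>_. Q) Z {1..n}"
      using assms(2) by (rule M.indep_vars_subset) auto
    then have "distr M (PiM {1..n} (\<lambda>_. Q)) (zz n) = PiM {1..n} (\<lambda>j. distr M Q (Z j))"
      unfolding zz_def using that Z by (subst (asm) M.indep_vars_iff_distr_eq_PiM') auto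
    also have "\<dots> = PiM {1..n} (\<lambda>_. Q)"
      using assms(3) by (intro PiM_cong) auto
    finally show ?thesis .
  qed
  have norm2: "(L2_set (w n z) {..<m n})\<^sup>2 = ip (m n) (w n z) (w n z)" for n z
    by (simp add: L2_set_def ip_def sum_nonneg power2_eq_square[symmetric])
  have norm4: "(L2_set (w n z) {..<m n}) ^ 4 = (ip (m n) (w n z) (w n z))\<^sup>2" for n z
    unfolding norm2[symmetric] by (simp flip: power_mult)
  obtain c where c: "0 < c" "\<And>n u. 1 \<le> n \<Longrightarrow>
      c * ip (m n) u u \<le> quad_form (m n) (\<lambda>i k. \<integral>z. w n z i * w n z k \<partial>Q) u"
    using regular_dispersion_lower[OF assms(9)] by blast
  obtain K where "\<forall>\<^sub>F n in sequentially.
      norm (\<integral>z. (L2_set (w n z) {..<m n}) ^ 4 \<partial>Q) \<le> K * norm (real (m n) ^ 2)"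
    using assms(11) by (rule landau_o.bigE)
  then have "\<forall>\<^sub>F n in sequentially. 1 \<le> n \<and> integrable Q (\<lambda>z. (ip (m n) (w n z) (w n z))\<^sup>2)
      \<and> (\<integral>z. (ip (m n) (w n z) (w n z))\<^sup>2 \<partial>Q) \<le> K * (real (m n))\<^sup>2"
    using assms(10) eventually_ge_at_top[of 1]
    by eventually_elim (auto simp: norm4)
  then obtain n0 where n0: "\<And>n. n0 \<le> n \<Longrightarrow> 1 \<le> n"
      "\<And>n. n0 \<le> n \<Longrightarrow> integrable Q (\<lambda>z. (ip (m n) (w n z) (w n z))\<^sup>2)"
      "\<And>n. n0 \<le> n \<Longrightarrow> (\<integral>z. (ip (m n) (w n z) (w n z))\<^sup>2 \<partial>Q) \<le> K * (real (m n))\<^sup>2"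
    unfolding eventually_sequentially by blast
  define C where "C = K / c\<^sup>2"
  have ex: "\<exists>A. n0 \<le> n \<longrightarrow> whitens (m n) (\<lambda>i k. \<integral>z. w n z i * w n z k \<partial>Q) A
      \<and> orthonormal_features Q (m n) (\<lambda>z i. ip (m n) (A i) (w n z)) C" for n
  proof (cases "n0 \<le> n")
    case n: True
    show ?thesis
      unfolding C_def
      by (rule orthonormal_features_whitened[OF Q assms(4)[OF n0(1)[OF n]] assms(6)[OF n0(1)[OF n]]
            assms(8)[OF n0(1)[OF n]] n0(2)[OF n] n0(3)[OF n] c(1) c(2)[OF n0(1)[OF n]]]) blast+
  qed simp
  from choice[OF allI[OF ex]] obtain A where
    "\<forall>n. n0 \<le> n \<longrightarrow> whitens (m n) (\<lambda>i k. \<integral>z. w n z i * w n z k \<partial>Q) (A n)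
      \<and> orthonormal_features Q (m n) (\<lambda>z i. ip (m n) (A n i) (w n z)) C" ..
  then have A: "\<And>n. n0 \<le> n \<Longrightarrow> whitens (m n) (\<lambda>i k. \<integral>z. w n z i * w n z k \<partial>Q) (A n)"
      "\<And>n. n0 \<le> n \<Longrightarrow> orthonormal_features Q (m n) (\<lambda>z i. ip (m n) (A n i) (w n z)) C"
    by blast+
  define v where "v n z i = ip (m n) (A n i) (w n z)" for n z i
  have v: "orthonormal_features Q (m n) (v n) C" if "n0 \<le> n" for n
    using A(2)[OF that] by (simp add: v_def[abs_def])
  have emp_lik_v: "emp_lik n (m n) (\<lambda>j. v n (zz n \<omega> j)) = emp_lik n (m n) (\<lambda>j. w n (Z j \<omega>))"
    if "n0 \<le> n" for n \<omega>
  proof -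
    have "emp_lik n (m n) (\<lambda>j. v n (zz n \<omega> j)) = emp_lik n (m n) (\<lambda>j. v n (Z j \<omega>))"
      by (rule emp_lik_cong) (simp add: zz_def)
    also have "\<dots> = emp_lik n (m n) (\<lambda>j. w n (Z j \<omega>))"
      unfolding v_def by (rule emp_lik_whitened[OF A(1)[OF that]])
    finally show ?thesis .
  qed
  define R where "R n x = ip (m n) (orthonormal_features.psum (v n) n x) (orthonormal_features.psum (v n) n x)" for n x
  have R_meas: "R n \<in> borel_measurable (PiM {1..n} (\<lambda>_. Q))" if "n0 \<le> n" for n
    unfolding R_def[abs_def] using v[OF that] by (rule orthonormal_features.measurable_psum_norm)
  \<comment> \<open>Below \<open>n0\<close> the features need not be orthonormal; the value 0 there
    makes \<open>T n\<close> a random variable for every \<open>n\<close>, as the continuity theorem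
    requires.\<close>
  define T where "T n \<omega> = (if n0 \<le> n then (R n (zz n \<omega>) / n - m n) / sqrt (2 * real (m n)) else 0)" for n \<omega>
  have T: "T n \<in> borel_measurable M" for n
  proof (cases "n0 \<le> n")
    case True
    have "(\<lambda>\<omega>. R n (zz n \<omega>)) \<in> borel_measurable M"
      by (rule measurable_compose[OF zz R_meas[OF True]])
    then show ?thesis unfolding T_def[abs_def] using True by simp
  qed (simp add: T_def[abs_def])
  \<comment> \<open>The square root of \<open>m^4 / n\<close>: the growth condition says exactly
    that this tends to 0, and all error bounds are expressed through it.\<close>
  define \<eta> where "\<eta> n = (real (m n))\<^sup>2 / sqrt n" for n
  have \<eta>: "\<eta> \<longlonglongrightarrow> 0"
  proof -
    have "(\<lambda>n. sqrt (real (m n) ^ 4 / real n)) \<longlonglongrightarrow> sqrt 0"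
      by (intro tendsto_real_sqrt smalloD_tendsto[OF assms(12)])
    moreover have "sqrt (real (m n) ^ 4 / real n) = \<eta> n" for n
    proof -
      have "real (m n) ^ 4 = ((real (m n))\<^sup>2)\<^sup>2" by (simp flip: power_mult)
      then have "sqrt (real (m n) ^ 4) = (real (m n))\<^sup>2" by (simp only: real_sqrt_abs abs_power2)
      then show ?thesis by (simp add: \<eta>_def real_sqrt_divide)
    qed
    ultimately show ?thesis by simp
  qed
  have m_lim: "filterlim (\<lambda>n. real (m n)) at_top sequentially"
    using filterlim_compose[OF filterlim_real_sequentially assms(5)] .
  have conv: "weak_conv_m (\<lambda>n. distr M borel (T n)) std_normal_distribution"
  proof (rule levy_continuity)
    show "real_distribution (distr M borel (T n))" for n
      using T by (rule M.real_distribution_distr)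
    show "real_distribution std_normal_distribution" by (rule real_dist_normal_dist)
    fix t :: real
    \<comment> \<open>Standardising rescales the argument of the characteristic function, so that
      \<open>\<theta>\<^sup>2 * m\<close> is constantly \<open>t\<^sup>2 / 2\<close> and the
      approximating value becomes the standard normal one.\<close>
    define \<theta> where "\<theta> n = t / sqrt (2 * real (m n))" for n
    have "filterlim (\<lambda>n. sqrt (2 * real (m n))) at_top sequentially"
      by (intro filterlim_compose[OF sqrt_at_top] filterlim_tendsto_pos_mult_at_top[OF tendsto_const _ m_lim]) simp
    then have \<theta>: "\<theta> \<longlonglongrightarrow> 0"
      unfolding \<theta>_def[abs_def] by (intro tendsto_divide_0[OF tendsto_const] filterlim_at_top_imp_at_infinity)
    have bound: "\<forall>\<^sub>F n in sequentially.
        norm (char (distr M borel (T n)) t - char std_normal_distribution t)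
        \<le> 2500 * (1 + C)\<^sup>2 * t\<^sup>2 * \<eta> n + 8 * t\<^sup>2 * \<bar>\<theta> n\<bar>"
    proof -
      have "\<forall>\<^sub>F n in sequentially. \<bar>\<theta> n\<bar> < 1"
        using tendstoD[OF \<theta>, of 1] by simp
      then show ?thesis
        using eventually_ge_at_top[of n0]
      proof eventually_elim
        case (elim n)
        interpret orthonormal_features Q "m n" "v n" C by (rule v[OF elim(2)])
        have n: "1 \<le> n" by (rule n0(1)[OF elim(2)])
        have m0: "0 < real (m n)" using assms(4)[OF n] by simp
        have R: "R n = psum_norm n" by (simp add: R_def[abs_def])
        have "char (distr M borel (T n)) t = (\<integral>\<omega>. exp (\<i> * of_real (t * T n \<omega>)) \<partial>M)"
          unfolding char_def by (subst integral_distr) (auto simp: T)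
        also have "\<dots> = (\<integral>\<omega>. exp (\<i> * of_real (\<theta> n * (psum_norm n (zz n \<omega>) / n - m n))) \<partial>M)"
          using elim(2) by (simp add: T_def \<theta>_def R)
        also have "\<dots> = (\<integral>x. exp (\<i> * of_real (\<theta> n * (psum_norm n x / n - m n))) \<partial>distr M (sample n) (zz n))"
          by (rule integral_distr[symmetric, OF zz]) measurable
        finally have "char (distr M borel (T n)) t
            = (\<integral>x. exp (\<i> * of_real (\<theta> n * (psum_norm n x / n - m n))) \<partial>sample n)"
          unfolding distr_zz[OF n] .
        moreover have \<theta>2: "(\<theta> n)\<^sup>2 * m n = t\<^sup>2 / 2"
          using m0 by (simp add: \<theta>_def power_divide)
        then have "char std_normal_distribution t = of_real (exp (- ((\<theta> n)\<^sup>2 * m n)))"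
          by (simp add: char_std_normal_distribution)
        ultimately have "norm (char (distr M borel (T n)) t - char std_normal_distribution t)
            \<le> 5000 * (1 + C)\<^sup>2 * (\<theta> n)\<^sup>2 * real (m n) ^ 3 / sqrt n + 16 * \<bar>\<theta> n\<bar> ^ 3 * m n"
          using norm_chf_psum_norm_diff[of "\<theta> n" n] elim(1) n by simp
        also have "5000 * (1 + C)\<^sup>2 * (\<theta> n)\<^sup>2 * real (m n) ^ 3 / sqrt n
            = 5000 * (1 + C)\<^sup>2 * ((\<theta> n)\<^sup>2 * m n) * \<eta> n"
          by (simp add: \<eta>_def power2_eq_square power3_eq_cube)
        also have "16 * \<bar>\<theta> n\<bar> ^ 3 * m n = 16 * \<bar>\<theta> n\<bar> * ((\<theta> n)\<^sup>2 * m n)"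
          by (simp add: power2_eq_square power3_eq_cube flip: abs_mult)
        finally show ?case unfolding \<theta>2 by (simp add: mult_ac)
      qed
    qed
    have "(\<lambda>n. 2500 * (1 + C)\<^sup>2 * t\<^sup>2 * \<eta> n + 8 * t\<^sup>2 * \<bar>\<theta> n\<bar>)
        \<longlonglongrightarrow> 2500 * (1 + C)\<^sup>2 * t\<^sup>2 * 0 + 8 * t\<^sup>2 * \<bar>0\<bar>"
      by (intro tendsto_intros \<eta> \<theta>)
    then have "(\<lambda>n. 2500 * (1 + C)\<^sup>2 * t\<^sup>2 * \<eta> n + 8 * t\<^sup>2 * \<bar>\<theta> n\<bar>) \<longlonglongrightarrow> 0" by simp
    from Lim_null_comparison[OF bound this]
    show "(\<lambda>n. char (distr M borel (T n)) t) \<longlonglongrightarrow> char std_normal_distribution t"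
      by (rule LIM_zero_cancel)
  qed
  show ?thesis
  proof (rule conv_in_distribution_approx[OF assms(1) _ T conv isCont_cdf_std_normal])
    fix n
    have "(\<lambda>\<omega>. emp_lik n (m n) (\<lambda>j. w n (Z j \<omega>))) \<in> borel_measurable M"
    proof (rule borel_measurable_emp_lik)
      \<comment> \<open>The membership of \<open>j\<close> forces \<open>n\<close> to be at least 1,
        where the measurability assumption applies; for \<open>n = 0\<close> there are no
        observations to consider.\<close>
      fix j i assume "j \<in> {1..n}" "i < m n"
      then show "(\<lambda>\<omega>. w n (Z j \<omega>) i) \<in> borel_measurable M"
        using measurable_compose[OF Z assms(6)] by auto
    qed
    from measurable_compose[OF this measurable_neg2_log]
    show "(\<lambda>\<omega>. (neg2_log (emp_lik n (m n) (\<lambda>j. w n (Z j \<omega>))) - ereal (real (m n)))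
        / ereal (sqrt (2 * real (m n)))) \<in> borel_measurable M"
      by (intro borel_measurable_ereal_divide borel_measurable_ereal_diff borel_measurable_const)
  next
    fix \<epsilon> \<delta> :: real assume \<epsilon>: "0 < \<epsilon>" and \<delta>: "0 < \<delta>"
    \<comment> \<open>Chosen so that the three Markov events together have probability at most
      \<epsilon>. It does not depend on \<open>n\<close>, so the smallness condition holds
      eventually.\<close>
    define \<rho> where "\<rho> = max 1 (3 / \<epsilon>)"
    have \<rho>: "1 \<le> \<rho>" "3 / \<rho> \<le> \<epsilon>"
    proof -
      show "1 \<le> \<rho>" by (simp add: \<rho>_def)
      have "3 / \<epsilon> \<le> \<rho>" by (simp add: \<rho>_def)
      then show "3 / \<rho> \<le> \<epsilon>" using \<epsilon> \<open>1 \<le> \<rho>\<close> by (simp add: field_simps)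
    qed
    have "(\<lambda>n. 2 * (1 + C) * \<rho>\<^sup>2 * \<eta> n) \<longlonglongrightarrow> 2 * (1 + C) * \<rho>\<^sup>2 * 0"
      by (intro tendsto_intros \<eta>)
    then have "\<forall>\<^sub>F n in sequentially. 2 * (1 + C) * \<rho>\<^sup>2 * \<eta> n < 1 / 64"
      by (rule order_tendstoD) simp
    moreover have "(\<lambda>n. 100 * (1 + C) * \<rho> ^ 3 * \<eta> n) \<longlonglongrightarrow> 100 * (1 + C) * \<rho> ^ 3 * 0"
      by (intro tendsto_intros \<eta>)
    then have "\<forall>\<^sub>F n in sequentially. 100 * (1 + C) * \<rho> ^ 3 * \<eta> n < \<delta>"
      by (rule order_tendstoD) (simp add: \<delta>)
    ultimately show "\<forall>\<^sub>F n in sequentially. \<exists>B\<in>sets M. measure M B \<le> \<epsilon> \<and> (\<forall>\<omega>\<in>space M - B.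
        \<exists>y. (neg2_log (emp_lik n (m n) (\<lambda>j. w n (Z j \<omega>))) - ereal (real (m n))) / ereal (sqrt (2 * real (m n)))
          = ereal y \<and> \<bar>y - T n \<omega>\<bar> \<le> \<delta>)"
      using eventually_ge_at_top[of n0]
    proof eventually_elim
      case (elim n)
      interpret orthonormal_features Q "m n" "v n" C by (rule v[OF elim(3)])
      have n: "1 \<le> n" by (rule n0(1)[OF elim(3)])
      have m0: "0 < real (m n)" using assms(4)[OF n] by simp
      have R: "R n = psum_norm n" by (simp add: R_def[abs_def])
      have small: "2 * (1 + C) * \<rho>\<^sup>2 * ((real (m n))\<^sup>2 / sqrt n) \<le> 1 / 64"
        using elim(1) by (simp only: \<eta>_def less_imp_le)
      obtain B where B: "B \<in> sets (sample n)" "measure (sample n) B \<le> 3 / \<rho>"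
        and near: "\<And>x. x \<in> space (sample n) - B \<Longrightarrow> \<exists>l. neg2_log (emp_lik n (m n) (\<lambda>j. v n (x j))) = ereal l \<and>
          \<bar>l - psum_norm n x / n\<bar> \<le> 100 * (1 + C) * \<rho> ^ 3 * ((real (m n))\<^sup>2 / sqrt n) * sqrt (m n)"
        using neg2_log_emp_lik_near_psum_norm[OF n \<rho>(1) small] by blast
      define B' where "B' = zz n -` B \<inter> space M"
      show ?case
      proof (intro bexI[of _ B'] conjI ballI)
        show "B' \<in> sets M" unfolding B'_def using zz B(1) by (rule measurable_sets)
        have "measure M B' = measure (distr M (sample n) (zz n)) B"
          unfolding B'_def by (rule measure_distr[symmetric, OF zz B(1)])
        then show "measure M B' \<le> \<epsilon>" using B(2) \<rho>(2) unfolding distr_zz[OF n] by linarith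
        fix \<omega> assume \<omega>: "\<omega> \<in> space M - B'"
        then have "zz n \<omega> \<in> space (sample n) - B"
          using measurable_space[OF zz] by (auto simp: B'_def)
        from near[OF this] obtain l where l: "neg2_log (emp_lik n (m n) (\<lambda>j. w n (Z j \<omega>))) = ereal l"
          and l_le: "\<bar>l - psum_norm n (zz n \<omega>) / n\<bar> \<le> 100 * (1 + C) * \<rho> ^ 3 * \<eta> n * sqrt (m n)"
          unfolding emp_lik_v[OF elim(3)] \<eta>_def by blast
        have pos: "0 < sqrt (2 * real (m n))" using m0 by simp
        have "\<bar>(l - m n) / sqrt (2 * real (m n)) - T n \<omega>\<bar> = \<bar>l - psum_norm n (zz n \<omega>) / n\<bar> / sqrt (2 * real (m n))"
        proof -
          have "(l - m n) / sqrt (2 * real (m n)) - T n \<omega> = (l - psum_norm n (zz n \<omega>) / n) / sqrt (2 * real (m n))"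
            using elim(3) by (simp add: T_def R flip: diff_divide_distrib)
          then show ?thesis using pos by (simp only: abs_divide abs_of_pos)
        qed
        also have "\<dots> \<le> \<delta>"
        proof -
          have "\<bar>l - psum_norm n (zz n \<omega>) / n\<bar> \<le> \<delta> * sqrt (m n)"
            using elim(2) by (intro order_trans[OF l_le] mult_right_mono) auto
          also have "\<dots> \<le> \<delta> * sqrt (2 * real (m n))"
            using \<delta> by (intro mult_left_mono) auto
          finally show ?thesis using pos by (simp only: pos_divide_le_eq)
        qed
        finally have "\<bar>(l - m n) / sqrt (2 * real (m n)) - T n \<omega>\<bar> \<le> \<delta>" .
        moreover have "(ereal l - ereal (real (m n))) / ereal (sqrt (2 * real (m n)))
            = ereal ((l - m n) / sqrt (2 * real (m n)))"
          using pos by (simp add: ereal_divide)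
        ultimately show "\<exists>y. (neg2_log (emp_lik n (m n) (\<lambda>j. w n (Z j \<omega>))) - ereal (real (m n)))
            / ereal (sqrt (2 * real (m n))) = ereal y \<and> \<bar>y - T n \<omega>\<bar> \<le> \<delta>"
          unfolding l by blast
      qed
    qed
  qed
qed

end
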